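(* Let $1\le q\le p<\infty$, let $r\in(1,\infty]$ be the conjugate exponent of $q$ ($q^{-1}+r^{-1}=1$), $I=[0,T]$ with $T>0$, $E$ a Banach space, and $h\in L^p(I,E)$. Let $k\colon I\times I\to\mathcal L(E)$ be such that $k(t,s)=0$ for $t<s$ and: $(\mathrm k_1)$ $k$ is strongly measurable on the product measure space $I\times I$; $(\mathrm k_2)$ $k(t,\cdot)\in L^r(I,\mathcal L(E))$ for every $t\in I$; $(\mathrm k_3)$ the function $t\mapsto k(t,\cdot)$ belongs to $L^p(I,L^r(I,\mathcal L(E)))$. Let $F\colon I\times E\multimap E$ satisfy: (1) for every $(t,x)\in I\times E$ the set $F(t,x)$ is nonempty and convex; (2) $F(\cdot,x)$ has a strongly measurable selection for every $x\in E$; (3) for a.a. $t\in I$ the graph of $F(t,\cdot)$ is sequentially closed in $(E,|\cdot|)\times(E,w)$, where $w$ is the weak topology; (4) there are $b\in L^q(I,\mathbb R)$ and $c>0$ such that $\sup\{|y|:y\in F(t,x)\}\le b(t)+c|x|^{p/q}$ for all $x\in E$ and a.a. $t\in I$; (5) for every closed separable subspace $E_0$ of $E$ there exists $\eta_{E_0}\in L^{\frac{pq}{p-q}}(I,\mathbb R)$ such that for all bounded $\Omega\subset E_0$ and a.a. $t\in I$, $\beta_{E_0}(F(t,\Omega)\cap E_0)\le\eta_{E_0}(t)\beta_{E_0}(\Omega)$. Suppose there is $R>0$ such that $$\big\|\,\|k(t,\cdot)\|_r\,\big\|_p\Big(\|b\|_q+c\big(R+\|h\|_p\big)^{p/q}\Big)\le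 R.$$ Then the Volterra integral inclusion $$x(t)\in h(t)+\int_0^tk(t,s)F(s,x(s))\,ds\quad\text{a.e. on }I$$ possesses a $p$-integrable solution.
   Context: $\multimap$ denotes set-valued maps; $F(t,\Omega)=\bigcup_{x\in\Omega}F(t,x)$. $\mathcal L(E)$ is the space of bounded linear operators on $E$ with the operator norm. $\|\,\|k(t,\cdot)\|_r\,\|_p$ is the $L^p(I)$-norm of $t\mapsto\|k(t,\cdot)\|_{L^r(I,\mathcal L(E))}$. When $p=q$, $\frac{pq}{p-q}$ means $\infty$. For $E_0\subset E$ and bounded $\Omega\subset E_0$, $\beta_{E_0}(\Omega)$ is the infimum of $\varepsilon>0$ such that $\Omega$ is covered by finitely many balls $B_E(x_i,\varepsilon)$ with centers $x_i\in E_0$ (so $\beta_{E_0}(\emptyset)=0$). A $p$-integrable solution is $x\in L^p(I,E)$ for which there is $w\in L^q(I,E)$ with $w(s)\in F(s,x(s))$ for a.a. $s\in I$ and $x(t)=h(t)+\int_0^tk(t,s)w(s)\,ds$ for a.a. $t\in I$. *)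

theory Defs
  imports "HOL-Analysis.Analysis" "HOL-Probability.Essential_Supremum"
begin

text \<open>The library's \<^const>\<open>has_bochner_integral\<close> is restricted to second countable value spaces.
  Neither a general Banach space nor its space of bounded operators has this property, so strong
  measurability and the Bochner integral are set up here without it.\<close>

definition strongly_measurable :: "'a measure \<Rightarrow> ('a \<Rightarrow> 'b::real_normed_vector) \<Rightarrow> bool" where
  "strongly_measurable M f \<longleftrightarrow>
     (\<exists>s. (\<forall>n::nat. simple_function M (s n)) \<and> (AE x in M. (\<lambda>n. s n x) \<longlonglongrightarrow> f x))"

definition has_strong_integral ::
    "'a measure \<Rightarrow> ('a \<Rightarrow> 'b::real_normed_vector) \<Rightarrow> 'b \<Rightarrow> bool" where
  "has_strong_integral M f v \<longleftrightarrow>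
     strongly_measurable M f \<and>
     (\<exists>s. (\<forall>n::nat. Bochner_Integration.simple_bochner_integrable M (s n)) \<and>
          (\<lambda>n. \<integral>\<^sup>+x. ennreal (norm (f x - s n x)) \<partial>M) \<longlonglongrightarrow> 0 \<and>
          (\<lambda>n. Bochner_Integration.simple_bochner_integral M (s n)) \<longlonglongrightarrow> v)"

text \<open>The elements of \<open>Lp_space\<close> are functions rather than equivalence classes. The value
  of \<open>Lp_norm\<close> is meaningful for members of \<open>Lp_space\<close> only.\<close>

definition Lp_space :: "ereal \<Rightarrow> 'a measure \<Rightarrow> ('a \<Rightarrow> 'b::real_normed_vector) set" where
  "Lp_space p M = {f. strongly_measurable M f \<and>
     (if p = \<infinity> then \<exists>C. AE x in M. norm (f x) \<le> C
      else integrable M (\<lambda>x. norm (f x) powr real_of_ereal p))}"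

definition Lp_norm :: "ereal \<Rightarrow> 'a measure \<Rightarrow> ('a \<Rightarrow> 'b::real_normed_vector) \<Rightarrow> real" where
  "Lp_norm p M f =
     (if p = \<infinity> then real_of_ereal (esssup M (\<lambda>x. ereal (norm (f x))))
      else (\<integral>x. norm (f x) powr real_of_ereal p \<partial>M) powr (1 / real_of_ereal p))"

text \<open>\<open>Lp_Lr_space p r M N\<close> is the Bochner space of \<open>p\<close>-integrable functions on \<open>M\<close> with values in
  the Banach space \<open>L\<^sup>r(N)\<close>. Choosing a representative of each of the finitely many values, one may
  take the approximating simple functions with values in \<^const>\<open>Lp_space\<close>. For \<open>r = \<infinity>\<close> the
  approximation condition does not follow from joint measurability.\<close>

definition Lp_Lr_space ::
    "ereal \<Rightarrow> ereal \<Rightarrow> 'a measure \<Rightarrow> 'b measure \<Rightarrow> ('a \<Rightarrow> 'b \<Rightarrow> 'c::real_normed_vector) set" where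
  "Lp_Lr_space p r M N = {f.
     (\<forall>t\<in>space M. f t \<in> Lp_space r N) \<and>
     (\<exists>s. (\<forall>n::nat. simple_function M (s n) \<and> (\<forall>t\<in>space M. s n t \<in> Lp_space r N)) \<and>
          (AE t in M. (\<lambda>n. Lp_norm r N (\<lambda>u. s n t u - f t u)) \<longlonglongrightarrow> 0)) \<and>
     (\<lambda>t. Lp_norm r N (f t)) \<in> Lp_space p M}"

definition weak_topology :: "'a::real_normed_vector topology" where
  "weak_topology = topology_generated_by {blinfun_apply \<phi> -` U | (\<phi> :: 'a \<Rightarrow>\<^sub>L real) U. open U}"

definition sequentially_closedin :: "'a topology \<Rightarrow> 'a set \<Rightarrow> bool" where
  "sequentially_closedin X S \<longleftrightarrow>
     S \<subseteq> topspace X \<and>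
     (\<forall>\<sigma> l. (\<forall>n::nat. \<sigma> n \<in> S) \<and> limitin X \<sigma> l sequentially \<longrightarrow> l \<in> S)"

text \<open>Extended real values: the infimum is \<open>\<infinity>\<close> when there is no finite cover.\<close>

definition ball_mnc :: "'a::metric_space set \<Rightarrow> 'a set \<Rightarrow> ereal" where
  "ball_mnc E\<^sub>0 \<Omega> =
     Inf {ereal \<epsilon> | \<epsilon>. \<epsilon> > 0 \<and> (\<exists>C. finite C \<and> C \<subseteq> E\<^sub>0 \<and> \<Omega> \<subseteq> (\<Union>x\<in>C. ball x \<epsilon>))}"

definition p_integrable_solution ::
    "real \<Rightarrow> real \<Rightarrow> real \<Rightarrow> (real \<Rightarrow> 'a) \<Rightarrow> (real \<Rightarrow> real \<Rightarrow> 'a \<Rightarrow>\<^sub>L 'a) \<Rightarrow>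
     (real \<Rightarrow> 'a \<Rightarrow> 'a set) \<Rightarrow> (real \<Rightarrow> 'a::banach) \<Rightarrow> bool" where
  "p_integrable_solution T p q h k F x \<longleftrightarrow>
     x \<in> Lp_space (ereal p) (lebesgue_on {0..T}) \<and>
     (\<exists>w \<in> Lp_space (ereal q) (lebesgue_on {0..T}).
        (AE s in lebesgue_on {0..T}. w s \<in> F s (x s)) \<and>
        (AE t in lebesgue_on {0..T}.
           \<exists>v. has_strong_integral (lebesgue_on {0..t}) (\<lambda>s. blinfun_apply (k t s) (w s)) v \<and>
               x t = h t + v))"

end

theory Submission
  imports Defs "HOL-Library.Diagonal_Subsequence"
begin

text \<open>No fixed point theorem and no weak compactness is needed. Tonelli's delay, with the integral
  truncated at the left end of each block of length \<open>\<delta>\<close>, yields countably valued \<open>\<sigma>\<^sub>n\<close> and strongly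
  measurable \<open>w\<^sub>n s \<in> F s (\<sigma>\<^sub>n s)\<close> with \<open>\<sigma>\<^sub>n - (h + \<integral>k w\<^sub>n) \<longrightarrow> 0\<close> almost everywhere; the smallness
  condition on \<open>R\<close> keeps all \<open>w\<^sub>n\<close> below one function \<open>G \<in> L\<^sup>q\<close>. Everything lives in a closed separable
  subspace \<open>E\<^sub>0\<close>, where the measure of noncompactness is a limit of sublinear functionals and hence
  passes through the integral. With (5) this gives a Gronwall inequality for the measure of
  noncompactness of \<open>{w\<^sub>n s}\<close>, so these sets are relatively compact for almost all \<open>s\<close>.

  Approximating \<open>t \<mapsto> k t\<close> by simple functions, one diagonal subsequence makes \<open>\<integral>k w\<^sub>n\<close> converge
  almost everywhere. Finally, iterated midpoints of tails of \<open>(w\<^sub>n)\<close> that almost minimise a strictly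
  convex integral functional converge almost everywhere to some \<open>w\<close>. The integrals converge along
  with them, and the closed graph with convex values gives \<open>w s \<in> F s (x s)\<close>.\<close>

section \<open>Strong measurability\<close>

text \<open>Null sets shape the proof. The exceptional set in (4) depends on the point, the one in
  (5) on the set, and (2) provides selections along constants. Hence the approximants are countably
  valued, and (5) is invoked for a countable family of test sets: finite unions of balls with
  rational radii and centres in a dense sequence, cut down to the subspace. Truncating at the left
  end of a block makes the integral depend on selections already fixed, so each block is one
  explicit selection. The separable subspace is built after all approximants are known; it must
  contain them, because (5) controls the values of \<open>F\<close> inside the subspace only.
  Relative compactness of the selections at almost every time gives no subsequence common to these
  times. Convex combinations whose coefficients do not depend on the time replace it: they commute
  with the integral, and a strictly convex functional singles out a sequence of them that converges
  almost everywhere.\<close>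

lemma strongly_measurable_simple:
  "simple_function M f \<Longrightarrow> strongly_measurable M f"
  unfolding strongly_measurable_def by (intro exI[of _ "\<lambda>_. f"]) auto

lemma strongly_measurable_const: "strongly_measurable M (\<lambda>x. c)"
  by (intro strongly_measurable_simple) auto

lemma strongly_measurable_compose2:
  assumes f: "strongly_measurable M f" and g: "strongly_measurable M g"
    and \<phi>: "\<And>z. isCont (\<lambda>(x, y). \<phi> x y) z"
  shows "strongly_measurable M (\<lambda>x. \<phi> (f x) (g x))"
proof -
  obtain s t where s: "\<And>n::nat. simple_function M (s n)" "AE x in M. (\<lambda>n. s n x) \<longlonglongrightarrow> f x"
    and t: "\<And>n::nat. simple_function M (t n)" "AE x in M. (\<lambda>n. t n x) \<longlonglongrightarrow> g x"
    using f g unfolding strongly_measurable_def by blast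
  have 1: "simple_function M (\<lambda>x. \<phi> (s n x) (t n x))" for n
    by (rule simple_function_compose2[OF s(1) t(1)])
  have "AE x in M. (\<lambda>n. \<phi> (s n x) (t n x)) \<longlonglongrightarrow> \<phi> (f x) (g x)"
    using s(2) t(2)
  proof eventually_elim
    case (elim x)
    have "(\<lambda>n. (s n x, t n x)) \<longlonglongrightarrow> (f x, g x)"
      by (intro tendsto_Pair elim)
    from isCont_tendsto_compose[OF \<phi> this] show ?case by simp
  qed
  with 1 show ?thesis unfolding strongly_measurable_def
    by (intro exI[of _ "\<lambda>n x. \<phi> (s n x) (t n x)"]) auto
qed

lemma strongly_measurable_compose:
  assumes "strongly_measurable M f" "\<And>z. isCont \<phi> z"
  shows "strongly_measurable M (\<lambda>x. \<phi> (f x))"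
  using strongly_measurable_compose2[of M f "\<lambda>_. 0::real" "\<lambda>x y. \<phi> x", OF assms(1) strongly_measurable_const]
    isCont_o2[OF isCont_fst[OF continuous_ident] assms(2)]
  by (auto simp: case_prod_unfold)

lemma strongly_measurable_add:
  "strongly_measurable M f \<Longrightarrow> strongly_measurable M g \<Longrightarrow> strongly_measurable M (\<lambda>x. f x + g x)"
  by (rule strongly_measurable_compose2[of _ _ _ "(+)"]) (auto simp: case_prod_unfold intro!: continuous_intros)

lemma strongly_measurable_diff:
  "strongly_measurable M f \<Longrightarrow> strongly_measurable M g \<Longrightarrow> strongly_measurable M (\<lambda>x. f x - g x)"
  by (rule strongly_measurable_compose2[of _ _ _ "(-)"]) (auto simp: case_prod_unfold intro!: continuous_intros)

lemma strongly_measurable_scaleR: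
  "strongly_measurable M f \<Longrightarrow> strongly_measurable M g \<Longrightarrow> strongly_measurable M (\<lambda>x. f x *\<^sub>R g x)"
  by (rule strongly_measurable_compose2[of _ _ _ "(*\<^sub>R)"]) (auto simp: case_prod_unfold intro!: continuous_intros)

lemma strongly_measurable_blinfun_apply:
  "strongly_measurable M f \<Longrightarrow> strongly_measurable M g \<Longrightarrow> strongly_measurable M (\<lambda>x. blinfun_apply (f x) (g x))"
  by (rule strongly_measurable_compose2[of _ _ _ "blinfun_apply"]) (auto simp: case_prod_unfold intro!: continuous_intros)

lemma strongly_measurable_cong_AE:
  assumes "strongly_measurable M f" "AE x in M. f x = g x"
  shows "strongly_measurable M g"
proof -
  obtain s where s: "\<And>n::nat. simple_function M (s n)" "AE x in M. (\<lambda>n. s n x) \<longlonglongrightarrow> f x"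
    using assms(1) unfolding strongly_measurable_def by blast
  have "AE x in M. (\<lambda>n. s n x) \<longlonglongrightarrow> g x"
    using s(2) assms(2) by eventually_elim simp
  with s(1) show ?thesis unfolding strongly_measurable_def by blast
qed

lemma (in complete_measure) borel_measurable_cong_AE':
  fixes f g :: "'a \<Rightarrow> real"
  assumes f: "f \<in> borel_measurable M" and eq: "AE x in M. f x = g x"
  shows "g \<in> borel_measurable M"
proof (rule measurableI)
  fix A :: "real set" assume A: "A \<in> sets borel"
  show "g -` A \<inter> space M \<in> sets M"
  proof (rule in_sets_AE)
    show "AE x in M. (x \<in> f -` A \<inter> space M) = (x \<in> g -` A \<inter> space M)"
      using eq by eventually_elim auto
    show "f -` A \<inter> space M \<in> sets M" using f A by (rule measurable_sets)
  qed auto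
qed auto

text \<open>Strong measurability permits changes on arbitrary subsets of null sets, so the step to
  Borel measurability rests on completeness.\<close>

lemma (in complete_measure) strongly_measurable_real:
  fixes f :: "'a \<Rightarrow> real"
  assumes "strongly_measurable M f"
  shows "f \<in> borel_measurable M"
proof -
  obtain s where s: "\<And>n::nat. simple_function M (s n)" "AE x in M. (\<lambda>n. s n x) \<longlonglongrightarrow> f x"
    using assms unfolding strongly_measurable_def by blast
  have "(\<lambda>x. lim (\<lambda>n. s n x)) \<in> borel_measurable M"
    by (rule borel_measurable_lim_metric) (rule borel_measurable_simple_function[OF s(1)])
  moreover have "AE x in M. lim (\<lambda>n. s n x) = f x"
    using s(2) by eventually_elim (rule limI)
  ultimately show ?thesis by (rule borel_measurable_cong_AE')
qed

lemma (in complete_measure) borel_measurable_strong_compose: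
  fixes f :: "'a \<Rightarrow> 'b::real_normed_vector" and \<phi> :: "'b \<Rightarrow> real"
  assumes "strongly_measurable M f" "\<And>z. isCont \<phi> z"
  shows "(\<lambda>x. \<phi> (f x)) \<in> borel_measurable M"
  by (rule strongly_measurable_real[OF strongly_measurable_compose[OF assms]])

lemma (in complete_measure) borel_measurable_strong_norm:
  assumes "strongly_measurable M f"
  shows "(\<lambda>x. norm (f x)) \<in> borel_measurable M"
  using assms by (intro borel_measurable_strong_compose) auto

lemma (in complete_measure) strongly_measurable_dominated_approx:
  fixes f :: "'a \<Rightarrow> 'b::real_normed_vector"
  assumes "strongly_measurable M f"
  obtains s where "\<And>n::nat. simple_function M (s n)" "AE x in M. (\<lambda>n. s n x) \<longlonglongrightarrow> f x"
    "\<And>n x. x \<in> space M \<Longrightarrow> norm (s n x) \<le> norm (f x)"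
proof -
  obtain s where s: "\<And>n::nat. simple_function M (s n)" "AE x in M. (\<lambda>n. s n x) \<longlonglongrightarrow> f x"
    using assms unfolding strongly_measurable_def by blast
  from borel_measurable_implies_simple_function_sequence_real[OF borel_measurable_strong_norm[OF assms]]
  obtain m where m: "\<And>n. simple_function M (m n)" "incseq m"
      "\<And>x. bdd_above (range (\<lambda>i. m i x))" "(\<lambda>x. norm (f x)) = (SUP i. m i)" "\<And>i x. 0 \<le> m i x"
    by auto
  have sup: "(SUP i. m i x) = norm (f x)" for x
    using fun_cong[OF m(4), of x] by (simp add: image_image)
  have lim: "(\<lambda>i. m i x) \<longlonglongrightarrow> norm (f x)" for x
    using LIMSEQ_incseq_SUP[OF m(3)[of x]] m(2) sup[of x] by (simp add: incseq_def le_fun_def)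
  have le: "m i x \<le> norm (f x)" for i x
    using sup[of x] cSUP_upper[OF UNIV_I m(3)[of x]] by metis
  \<comment> \<open>Radial truncation: \<open>s n x\<close> is shortened to length at most
    \<open>m n x\<close>, where the simple functions \<open>m n\<close> increase to the norm of
    \<open>f\<close>. The convention \<open>a / 0 = 0\<close> is harmless where
    \<open>s n x = 0\<close>.\<close>
  define t where "t n x = (min 1 (m n x / norm (s n x))) *\<^sub>R s n x" for n x
  show thesis
  proof (rule that[of t])
    show "simple_function M (t n)" for n
      unfolding t_def by (rule simple_function_compose2[OF m(1) s(1), where h = "\<lambda>a b. min 1 (a / norm b) *\<^sub>R b"])
    have n: "norm (t n x) \<le> m n x" for n x
      using m(5)[of n x] by (cases "s n x = 0") (auto simp: t_def min_def abs_mult divide_simps not_le)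
    then show "norm (t n x) \<le> norm (f x)" for n x
      using le order_trans by blast
    show "AE x in M. (\<lambda>n. t n x) \<longlonglongrightarrow> f x"
      using s(2)
    proof eventually_elim
      case (elim x)
      show ?case
      proof (cases "f x = 0")
        case True
        have "t n x = 0" for n using n[of n x] le[of n x] True
          by (metis norm_le_zero_iff norm_zero order_trans)
        then show ?thesis using True by simp
      next
        case False
        have "(\<lambda>n. (min 1 (m n x / norm (s n x))) *\<^sub>R s n x) \<longlonglongrightarrow> (min 1 (norm (f x) / norm (f x))) *\<^sub>R f x"
          using False by (intro tendsto_intros elim lim) auto
        then show ?thesis using False by (simp add: t_def)
      qed
    qed
  qed
qed

text \<open>Borel-Cantelli in integrated form: the series has a finite integral, so it converges
  almost everywhere and its terms vanish.\<close>

lemma AE_tendsto_0_if_summable_integrals: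
  fixes f :: "nat \<Rightarrow> 'a \<Rightarrow> real"
  assumes f: "\<And>n. integrable M (f n)" "\<And>n x. x \<in> space M \<Longrightarrow> 0 \<le> f n x"
    and s: "summable (\<lambda>n. \<integral>x. f n x \<partial>M)"
  shows "AE x in M. (\<lambda>n. f n x) \<longlonglongrightarrow> 0"
proof -
  have [measurable]: "f n \<in> borel_measurable M" for n using f(1) by auto
  have "(\<integral>\<^sup>+x. (\<Sum>n. ennreal (f n x)) \<partial>M) = (\<Sum>n. \<integral>\<^sup>+x. ennreal (f n x) \<partial>M)"
    by (rule nn_integral_suminf) auto
  also have "\<dots> = (\<Sum>n. ennreal (\<integral>x. f n x \<partial>M))"
    using f by (intro suminf_cong nn_integral_eq_integral) auto
  also have "\<dots> < \<infinity>"
    using f(2) by (subst suminf_ennreal2[OF _ s]) (auto intro: integral_nonneg_AE)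
  finally have "AE x in M. (\<Sum>n. ennreal (f n x)) \<noteq> \<infinity>"
    by (intro nn_integral_noteq_infinite) auto
  then show ?thesis
  proof (rule AE_mp, intro AE_I2 impI)
    fix x assume x: "x \<in> space M" "(\<Sum>n. ennreal (f n x)) \<noteq> \<infinity>"
    then have "summable (\<lambda>n. f n x)"
      using f(2) by (intro summable_suminf_not_top) auto
    then show "(\<lambda>n. f n x) \<longlonglongrightarrow> 0" by (rule summable_LIMSEQ_zero)
  qed
qed

text \<open>The integral of \<open>min 1 (norm (u - v))\<close> metrises convergence in measure.
  Each \<open>f n\<close> has a simple function within \<open>(1/2)^n\<close> in this sense, and
  such summable errors tend to 0 almost everywhere.\<close>

lemma strongly_measurable_AE_limit:
  fixes f :: "nat \<Rightarrow> 'a \<Rightarrow> 'b::real_normed_vector"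
  assumes fin: "finite_measure M" and cm: "complete_measure M"
    and f: "\<And>n. strongly_measurable M (f n)" and lim: "AE x in M. (\<lambda>n. f n x) \<longlonglongrightarrow> g x"
  shows "strongly_measurable M g"
proof -
  interpret finite_measure M by fact
  interpret complete_measure M by fact
  have "\<exists>s. simple_function M s \<and> (\<integral>x. min 1 (norm (f n x - s x)) \<partial>M) \<le> (1/2)^n" for n
  proof -
    obtain s where s: "\<And>k::nat. simple_function M (s k)" "AE x in M. (\<lambda>k. s k x) \<longlonglongrightarrow> f n x"
      using f[of n] unfolding strongly_measurable_def by blast
    have "(\<lambda>k. \<integral>x. min 1 (norm (f n x - s k x)) \<partial>M) \<longlonglongrightarrow> (\<integral>x. 0 \<partial>M)"
    proof (rule integral_dominated_convergence[where w = "\<lambda>_. 1"])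
      show "(\<lambda>x. min 1 (norm (f n x - s k x))) \<in> borel_measurable M" for k
        by (intro borel_measurable_min borel_measurable_strong_norm strongly_measurable_diff
            f strongly_measurable_simple s) auto
      show "AE x in M. (\<lambda>k. min 1 (norm (f n x - s k x))) \<longlonglongrightarrow> 0"
        using s(2)
      proof eventually_elim
        case (elim x)
        have "(\<lambda>k. min 1 (norm (f n x - s k x))) \<longlonglongrightarrow> min 1 (norm (f n x - f n x))"
          by (intro tendsto_intros elim)
        then show ?case by simp
      qed
    qed auto
    then have "eventually (\<lambda>k. (\<integral>x. min 1 (norm (f n x - s k x)) \<partial>M) < (1/2)^n) sequentially"
      by (auto dest: order_tendstoD(2)[where a = "(1/2)^n"])
    then obtain k where "(\<integral>x. min 1 (norm (f n x - s k x)) \<partial>M) < (1/2)^n"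
      by (auto simp: eventually_sequentially)
    then show ?thesis using s(1) by (intro exI[of _ "s k"]) auto
  qed
  then obtain s where s: "\<And>n. simple_function M (s n)"
    "\<And>n. (\<integral>x. min 1 (norm (f n x - s n x)) \<partial>M) \<le> (1/2)^n" by metis
  have "AE x in M. (\<lambda>n. min 1 (norm (f n x - s n x))) \<longlonglongrightarrow> 0"
  proof (rule AE_tendsto_0_if_summable_integrals)
    show "integrable M (\<lambda>x. min 1 (norm (f n x - s n x)))" for n
      by (rule integrable_const_bound[of _ 1])
        (auto intro!: borel_measurable_min
          borel_measurable_strong_norm[OF strongly_measurable_diff[OF f strongly_measurable_simple[OF s(1)]]])
    show "summable (\<lambda>n. \<integral>x. min 1 (norm (f n x - s n x)) \<partial>M)"
    proof (rule summable_comparison_test'[of "\<lambda>n. (1/2)^n"])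
      show "norm (\<integral>x. min 1 (norm (f n x - s n x)) \<partial>M) \<le> (1/2)^n" for n
        using s(2)[of n] by (simp add: Bochner_Integration.integral_nonneg)
    qed (auto intro: summable_geometric)
  qed auto
  then have "AE x in M. (\<lambda>n. s n x) \<longlonglongrightarrow> g x"
    using lim
  proof eventually_elim
    case (elim x)
    have "eventually (\<lambda>n. min 1 (norm (f n x - s n x)) < 1) sequentially"
      using elim(1) by (intro order_tendstoD) auto
    then have "eventually (\<lambda>n. min 1 (norm (f n x - s n x)) = norm (f n x - s n x)) sequentially"
      by eventually_elim (auto simp: min_def split: if_splits)
    then have "(\<lambda>n. norm (f n x - s n x)) \<longlonglongrightarrow> 0"
      using elim(1) by (simp cong: tendsto_cong)
    then have "(\<lambda>n. f n x - s n x) \<longlonglongrightarrow> 0" by (rule tendsto_norm_zero_cancel)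
    from tendsto_diff[OF elim(2) this] show ?case by simp
  qed
  then show ?thesis using s(1) unfolding strongly_measurable_def by blast
qed

section \<open>Gluing along countably many pieces\<close>

lemma simple_function_glue_nat:
  fixes i :: "'a \<Rightarrow> nat"
  assumes i: "i \<in> measurable M (count_space UNIV)" and s: "\<And>j. simple_function M (s j)"
  shows "simple_function M (\<lambda>x. if i x \<le> n then s (i x) x else z)"
proof -
  have "simple_function M (\<lambda>x. if i x \<le> m then s (i x) x else z)" for m
  proof (induction m)
    case 0
    have "simple_function M (\<lambda>x. if i x = 0 then s 0 x else z)"
      using i by (intro simple_function_If s) auto
    then show ?case by (rule simple_function_cong[THEN iffD1, rotated]) auto
  next
    case (Suc m)
    have "simple_function M (\<lambda>x. if i x = Suc m then s (Suc m) x else (if i x \<le> m then s (i x) x else z))"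
      using i by (intro simple_function_If s Suc) auto
    then show ?case by (rule simple_function_cong[THEN iffD1, rotated]) auto
  qed
  then show ?thesis .
qed

lemma strongly_measurable_glue_nat:
  fixes i :: "'a \<Rightarrow> nat" and f :: "nat \<Rightarrow> 'a \<Rightarrow> 'b::real_normed_vector"
  assumes i: "i \<in> measurable M (count_space UNIV)" and f: "\<And>j. strongly_measurable M (f j)"
  shows "strongly_measurable M (\<lambda>x. f (i x) x)"
proof -
  obtain s where s: "\<And>j n. simple_function M (s j n)" "\<And>j. AE x in M. (\<lambda>n. s j n x) \<longlonglongrightarrow> f j x"
    using f unfolding strongly_measurable_def by metis
  have "AE x in M. \<forall>j. (\<lambda>n. s j n x) \<longlonglongrightarrow> f j x"
    using s(2) by (simp add: AE_all_countable)
  \<comment> \<open>The \<open>n\<close>-th approximant uses only the pieces with index at most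
    \<open>n\<close>, so it stays simple; every point is reached after finitely many steps.\<close>
  then have "AE x in M. (\<lambda>n. if i x \<le> n then s (i x) n x else 0) \<longlonglongrightarrow> f (i x) x"
  proof eventually_elim
    case (elim x)
    have "eventually (\<lambda>n. s (i x) n x = (if i x \<le> n then s (i x) n x else 0)) sequentially"
      using eventually_ge_at_top[of "i x"] by eventually_elim auto
    with elim show ?case by (auto intro: Lim_transform_eventually)
  qed
  moreover have "simple_function M (\<lambda>x. if i x \<le> n then s (i x) n x else 0)" for n
    using simple_function_glue_nat[OF i, of "\<lambda>j. s j n"] s(1) by blast
  ultimately show ?thesis unfolding strongly_measurable_def
    by (intro exI[of _ "\<lambda>n x. if i x \<le> n then s (i x) n x else 0"]) auto
qed

lemma strongly_measurable_glue_simple: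
  fixes f :: "'c \<Rightarrow> 'a \<Rightarrow> 'b::real_normed_vector"
  assumes s: "simple_function M s" and f: "\<And>j. strongly_measurable M (f j)"
  shows "strongly_measurable M (\<lambda>x. f (s x) x)"
proof -
  let ?R = "s ` space M"
  have fin: "countable ?R" using s by (auto simp: simple_function_def countable_finite)
  have "(\<lambda>x. to_nat_on ?R (s x)) \<in> measurable M (count_space UNIV)"
    using measurable_simple_function[OF s] by (rule measurable_compose) auto
  from strongly_measurable_glue_nat[OF this, of "\<lambda>j. f (from_nat_into ?R j)"] f
  have "strongly_measurable M (\<lambda>x. f (from_nat_into ?R (to_nat_on ?R (s x))) x)" by auto
  then show ?thesis
    by (rule strongly_measurable_cong_AE) (intro AE_I2, simp add: fin)
qed

lemma strongly_measurable_If: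
  fixes f g :: "'a \<Rightarrow> 'b::real_normed_vector"
  assumes "strongly_measurable M f" "strongly_measurable M g" "Measurable.pred M P"
  shows "strongly_measurable M (\<lambda>x. if P x then f x else g x)"
proof -
  have "strongly_measurable M (\<lambda>x. (if P x then f else g) x)"
    by (rule strongly_measurable_glue_simple[where f = "\<lambda>b. if b then f else g" and s = P])
      (use assms in \<open>auto simp: simple_function_def pred_def intro: measurable_sets\<close>)
  then show ?thesis by (simp add: if_distrib[of "\<lambda>f. f _"])
qed

section \<open>The strong integral\<close>

locale finite_complete_measure = finite_measure M + complete_measure M for M :: "'a measure"

text \<open>Shared by the norm and by the gauges that measure noncompactness, so that moving such a
  functional under the integral is proved once. Homogeneity is one-sided because the gauges come
  from nonnegative combinations.\<close>

locale sublinear_below_norm =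
  fixes N :: "'b::real_normed_vector \<Rightarrow> real"
  assumes nonneg: "0 \<le> N x" and le_norm: "N x \<le> norm x"
    and subadd: "N (x + y) \<le> N x + N y"
    and pos_hom: "0 \<le> c \<Longrightarrow> N (c *\<^sub>R x) = c * N x"
begin

lemma zero: "N 0 = 0"
  using nonneg[of 0] le_norm[of 0] by simp

lemma le_add_norm_diff: "N x \<le> N y + norm (x - y)"
  using subadd[of y "x - y"] le_norm[of "x - y"] by simp

lemma isCont: "isCont N z"
proof -
  have "\<bar>N x - N z\<bar> \<le> norm (x - z)" for x
    using le_add_norm_diff[of x z] le_add_norm_diff[of z x] by (auto simp: norm_minus_commute abs_le_iff)
  then have "(N \<longlongrightarrow> N z) (at z)"
    by (intro metric_LIM_imp_LIM[OF tendsto_ident_at]) (auto simp: dist_norm)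
  then show ?thesis by (simp add: isCont_def)
qed

lemma simple_bochner_integral_le:
  assumes f: "Bochner_Integration.simple_bochner_integrable M f"
  shows "N (Bochner_Integration.simple_bochner_integral M f) \<le> Bochner_Integration.simple_bochner_integral M (\<lambda>x. N (f x))"
proof -
  have sum: "N (\<Sum>y\<in>S. g y) \<le> (\<Sum>y\<in>S. N (g y))" for S and g :: "'b \<Rightarrow> 'b"
  proof (induction S rule: infinite_finite_induct)
    case (insert y S)
    then show ?case using subadd[of "g y" "sum g S"] by simp
  qed (auto simp: zero)
  have "N (Bochner_Integration.simple_bochner_integral M f) \<le>
      (\<Sum>y\<in>f ` space M. N (measure M {x \<in> space M. f x = y} *\<^sub>R y))"
    unfolding simple_bochner_integral_def by (rule sum)
  also have "\<dots> = (\<Sum>y\<in>f ` space M. measure M {x \<in> space M. f x = y} *\<^sub>R N y)"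
    by (simp add: pos_hom)
  also have "\<dots> = Bochner_Integration.simple_bochner_integral M (\<lambda>x. N (f x))"
    using f by (intro simple_bochner_integral_partition[symmetric])
       (auto intro: f simple_bochner_integrable_compose2[where p = "\<lambda>x y. N x"] simp: zero
         elim: simple_bochner_integrable.cases)
  finally show ?thesis .
qed

end

lemma sublinear_below_norm_norm: "sublinear_below_norm norm"
  by standard (auto intro: norm_triangle_ineq)

definition strong_integral :: "'a measure \<Rightarrow> ('a \<Rightarrow> 'b::real_normed_vector) \<Rightarrow> 'b" where
  "strong_integral M f = (THE v. has_strong_integral M f v)"

definition strongly_integrable :: "'a measure \<Rightarrow> ('a \<Rightarrow> 'b::real_normed_vector) \<Rightarrow> bool" where
  "strongly_integrable M f \<longleftrightarrow> strongly_measurable M f \<and> integrable M (\<lambda>x. norm (f x))"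

lemma has_strong_integral_cong_AE:
  assumes "has_strong_integral M f v" "AE x in M. f x = g x"
  shows "has_strong_integral M g v"
proof -
  obtain s where s: "\<And>n::nat. Bochner_Integration.simple_bochner_integrable M (s n)"
      "(\<lambda>n. \<integral>\<^sup>+x. ennreal (norm (f x - s n x)) \<partial>M) \<longlonglongrightarrow> 0"
      "(\<lambda>n. Bochner_Integration.simple_bochner_integral M (s n)) \<longlonglongrightarrow> v" and f: "strongly_measurable M f"
    using assms unfolding has_strong_integral_def by auto
  have "(\<integral>\<^sup>+x. ennreal (norm (f x - s n x)) \<partial>M) = (\<integral>\<^sup>+x. ennreal (norm (g x - s n x)) \<partial>M)" for n
    using assms(2) by (intro nn_integral_cong_AE) auto
  with s strongly_measurable_cong_AE[OF f assms(2)] show ?thesis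
    unfolding has_strong_integral_def by auto
qed

context finite_complete_measure
begin

lemma simple_bochner_integrable_iff: "Bochner_Integration.simple_bochner_integrable M f \<longleftrightarrow> simple_function M f"
  using emeasure_finite by (auto simp: simple_bochner_integrable.simps)

text \<open>The bound passes from simple functions to \<open>f\<close> because \<open>N\<close> is
  1-Lipschitz. With \<open>norm\<close> for \<open>N\<close> and the zero function as integrand it
  also yields uniqueness of the integral.\<close>

lemma sublinear_has_strong_integral_le:
  assumes N: "sublinear_below_norm N" and f: "has_strong_integral M f v"
  shows "ennreal (N v) \<le> (\<integral>\<^sup>+x. ennreal (N (f x)) \<partial>M)"
proof -
  interpret N: sublinear_below_norm N by fact
  obtain s where s: "\<And>n::nat. Bochner_Integration.simple_bochner_integrable M (s n)"
      "(\<lambda>n. \<integral>\<^sup>+x. ennreal (norm (f x - s n x)) \<partial>M) \<longlonglongrightarrow> 0"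
      "(\<lambda>n. Bochner_Integration.simple_bochner_integral M (s n)) \<longlonglongrightarrow> v" and fm: "strongly_measurable M f"
    using f unfolding has_strong_integral_def by auto
  have sm: "strongly_measurable M (s n)" for n
    using s(1) by (auto simp: simple_bochner_integrable_iff intro: strongly_measurable_simple)
  have [measurable]: "(\<lambda>x. N (f x)) \<in> borel_measurable M"
    "(\<lambda>x. norm (f x - s n x)) \<in> borel_measurable M" for n
    by (auto intro!: borel_measurable_strong_compose[of _ N] N.isCont fm borel_measurable_strong_norm
        strongly_measurable_diff sm)
  have "ennreal (N v) \<le> (\<integral>\<^sup>+x. ennreal (N (f x)) \<partial>M) + (\<integral>\<^sup>+x. ennreal (norm (f x - s n x)) \<partial>M)
      + ennreal (norm (Bochner_Integration.simple_bochner_integral M (s n) - v))" for n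
  proof -
    have "ennreal (N (Bochner_Integration.simple_bochner_integral M (s n))) \<le> ennreal (Bochner_Integration.simple_bochner_integral M (\<lambda>x. N (s n x)))"
      by (intro ennreal_leI N.simple_bochner_integral_le s)
    also have "\<dots> = (\<integral>\<^sup>+x. ennreal (N (s n x)) \<partial>M)"
      using s(1)[of n] by (intro simple_bochner_integral_eq_nn_integral)
        (auto simp: simple_bochner_integrable_iff N.nonneg intro: simple_function_compose1)
    also have "\<dots> \<le> (\<integral>\<^sup>+x. ennreal (N (f x)) + ennreal (norm (f x - s n x)) \<partial>M)"
    proof (rule nn_integral_mono)
      fix x show "ennreal (N (s n x)) \<le> ennreal (N (f x)) + ennreal (norm (f x - s n x))"
        using ennreal_leI[OF N.le_add_norm_diff[of "s n x" "f x"]] N.nonneg[of "f x"]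
        by (simp add: norm_minus_commute)
    qed
    also have "\<dots> = (\<integral>\<^sup>+x. ennreal (N (f x)) \<partial>M) + (\<integral>\<^sup>+x. ennreal (norm (f x - s n x)) \<partial>M)"
      by (rule nn_integral_add) auto
    finally have 1: "ennreal (N (Bochner_Integration.simple_bochner_integral M (s n))) \<le> \<dots>" .
    have "ennreal (N v) \<le> ennreal (N (Bochner_Integration.simple_bochner_integral M (s n)))
        + ennreal (norm (Bochner_Integration.simple_bochner_integral M (s n) - v))"
      using ennreal_leI[OF N.le_add_norm_diff[of v "Bochner_Integration.simple_bochner_integral M (s n)"]]
        N.nonneg[of "Bochner_Integration.simple_bochner_integral M (s n)"]
      by (simp add: norm_minus_commute)
    also have "\<dots> \<le> (\<integral>\<^sup>+x. ennreal (N (f x)) \<partial>M) + (\<integral>\<^sup>+x. ennreal (norm (f x - s n x)) \<partial>M)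
      + ennreal (norm (Bochner_Integration.simple_bochner_integral M (s n) - v))"
      by (intro add_right_mono 1)
    finally show ?thesis .
  qed
  moreover have "(\<lambda>n. (\<integral>\<^sup>+x. ennreal (N (f x)) \<partial>M) + (\<integral>\<^sup>+x. ennreal (norm (f x - s n x)) \<partial>M)
      + ennreal (norm (Bochner_Integration.simple_bochner_integral M (s n) - v)))
      \<longlonglongrightarrow> (\<integral>\<^sup>+x. ennreal (N (f x)) \<partial>M) + 0 + ennreal (norm (v - v))"
    by (intro tendsto_add tendsto_ennrealI tendsto_norm tendsto_diff s(2,3) tendsto_const)
  ultimately show ?thesis by (auto intro: LIMSEQ_le_const)
qed

lemma has_strong_integral_add:
  assumes "has_strong_integral M f v" "has_strong_integral M g w"
  shows "has_strong_integral M (\<lambda>x. f x + g x) (v + w)"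
proof -
  obtain s where s: "\<And>n::nat. Bochner_Integration.simple_bochner_integrable M (s n)"
      "(\<lambda>n. \<integral>\<^sup>+x. ennreal (norm (f x - s n x)) \<partial>M) \<longlonglongrightarrow> 0"
      "(\<lambda>n. Bochner_Integration.simple_bochner_integral M (s n)) \<longlonglongrightarrow> v" and f: "strongly_measurable M f"
    using assms unfolding has_strong_integral_def by auto
  obtain t where t: "\<And>n::nat. Bochner_Integration.simple_bochner_integrable M (t n)"
      "(\<lambda>n. \<integral>\<^sup>+x. ennreal (norm (g x - t n x)) \<partial>M) \<longlonglongrightarrow> 0"
      "(\<lambda>n. Bochner_Integration.simple_bochner_integral M (t n)) \<longlonglongrightarrow> w" and g: "strongly_measurable M g"
    using assms unfolding has_strong_integral_def by auto
  have sm: "strongly_measurable M (s n)" "strongly_measurable M (t n)" for n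
    using s(1) t(1) by (auto simp: simple_bochner_integrable_iff intro: strongly_measurable_simple)
  have [measurable]: "(\<lambda>x. norm (f x - s n x)) \<in> borel_measurable M"
    "(\<lambda>x. norm (g x - t n x)) \<in> borel_measurable M" for n
    by (auto intro!: borel_measurable_strong_norm strongly_measurable_diff f g sm)
  show ?thesis unfolding has_strong_integral_def
  proof (intro conjI exI[of _ "\<lambda>n x. s n x + t n x"] allI)
    show "strongly_measurable M (\<lambda>x. f x + g x)" by (intro strongly_measurable_add f g)
    show "Bochner_Integration.simple_bochner_integrable M (\<lambda>x. s n x + t n x)" for n
      by (rule simple_bochner_integrable_compose2[OF _ s(1) t(1)]) simp
    show "(\<lambda>n. Bochner_Integration.simple_bochner_integral M (\<lambda>x. s n x + t n x)) \<longlonglongrightarrow> v + w"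
      using tendsto_add[OF s(3) t(3)] by (simp add: simple_bochner_integral_add s t)
    show "(\<lambda>n. \<integral>\<^sup>+ x. ennreal (norm (f x + g x - (s n x + t n x))) \<partial>M) \<longlonglongrightarrow> 0"
    proof (rule tendsto_sandwich[where f = "\<lambda>_. 0"])
      show "(\<lambda>n. (\<integral>\<^sup>+x. ennreal (norm (f x - s n x)) \<partial>M) + (\<integral>\<^sup>+x. ennreal (norm (g x - t n x)) \<partial>M)) \<longlonglongrightarrow> 0"
        using tendsto_add[OF s(2) t(2)] by simp
      have "(\<integral>\<^sup>+ x. ennreal (norm (f x + g x - (s n x + t n x))) \<partial>M)
         \<le> (\<integral>\<^sup>+x. ennreal (norm (f x - s n x)) + ennreal (norm (g x - t n x)) \<partial>M)" for n
        by (intro nn_integral_mono)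
          (auto simp: ennreal_plus[symmetric] simp del: ennreal_plus intro!: ennreal_leI norm_diff_triangle_ineq)
      then show "eventually (\<lambda>n. (\<integral>\<^sup>+ x. ennreal (norm (f x + g x - (s n x + t n x))) \<partial>M)
         \<le> (\<integral>\<^sup>+x. ennreal (norm (f x - s n x)) \<partial>M) + (\<integral>\<^sup>+x. ennreal (norm (g x - t n x)) \<partial>M)) sequentially"
        by (simp add: nn_integral_add)
    qed auto
  qed
qed

lemma has_strong_integral_scaleR:
  assumes "has_strong_integral M f v"
  shows "has_strong_integral M (\<lambda>x. c *\<^sub>R f x) (c *\<^sub>R v)"
proof -
  obtain s where s: "\<And>n::nat. Bochner_Integration.simple_bochner_integrable M (s n)"
      "(\<lambda>n. \<integral>\<^sup>+x. ennreal (norm (f x - s n x)) \<partial>M) \<longlonglongrightarrow> 0"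
      "(\<lambda>n. Bochner_Integration.simple_bochner_integral M (s n)) \<longlonglongrightarrow> v" and f: "strongly_measurable M f"
    using assms unfolding has_strong_integral_def by auto
  have sm: "strongly_measurable M (s n)" for n
    using s(1) by (auto simp: simple_bochner_integrable_iff intro: strongly_measurable_simple)
  have [measurable]: "(\<lambda>x. norm (f x - s n x)) \<in> borel_measurable M" for n
    by (auto intro!: borel_measurable_strong_norm strongly_measurable_diff f sm)
  have eq: "(\<integral>\<^sup>+ x. ennreal (norm (c *\<^sub>R f x - c *\<^sub>R s n x)) \<partial>M)
      = ennreal \<bar>c\<bar> * (\<integral>\<^sup>+x. ennreal (norm (f x - s n x)) \<partial>M)" for n
    by (subst nn_integral_cmult[symmetric])
      (auto simp: scaleR_diff_right[symmetric] ennreal_mult intro!: nn_integral_cong)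
  show ?thesis unfolding has_strong_integral_def
  proof (intro conjI exI[of _ "\<lambda>n x. c *\<^sub>R s n x"] allI)
    show "strongly_measurable M (\<lambda>x. c *\<^sub>R f x)"
      by (intro strongly_measurable_scaleR f strongly_measurable_const)
    show "Bochner_Integration.simple_bochner_integrable M (\<lambda>x. c *\<^sub>R s n x)" for n
      using s(1)[of n] by (auto simp: simple_bochner_integrable_iff intro: simple_function_compose1)
    show "(\<lambda>n. Bochner_Integration.simple_bochner_integral M (\<lambda>x. c *\<^sub>R s n x)) \<longlonglongrightarrow> c *\<^sub>R v"
      using tendsto_scaleR[OF tendsto_const s(3)]
        simple_bochner_integral_linear[OF bounded_linear.linear[OF bounded_linear_scaleR_right] s(1)]
      by simp
    show "(\<lambda>n. \<integral>\<^sup>+ x. ennreal (norm (c *\<^sub>R f x - c *\<^sub>R s n x)) \<partial>M) \<longlonglongrightarrow> 0"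
      unfolding eq using ennreal_tendsto_cmult[OF _ s(2), of "ennreal \<bar>c\<bar>"] by simp
  qed
qed

lemma has_strong_integral_unique:
  assumes "has_strong_integral M f v" "has_strong_integral M f w"
  shows "v = w"
proof -
  have "has_strong_integral M (\<lambda>x. f x + (-1) *\<^sub>R f x) (v + (-1) *\<^sub>R w)"
    by (intro has_strong_integral_add has_strong_integral_scaleR assms)
  from sublinear_has_strong_integral_le[OF sublinear_below_norm_norm this] show ?thesis by simp
qed

lemma has_strong_integral_exists:
  fixes f :: "'a \<Rightarrow> 'b::banach"
  assumes "strongly_integrable M f"
  shows "\<exists>v. has_strong_integral M f v"
proof -
  have f: "strongly_measurable M f" "integrable M (\<lambda>x. norm (f x))"
    using assms by (auto simp: strongly_integrable_def)
  obtain s where s: "\<And>n::nat. simple_function M (s n)" "AE x in M. (\<lambda>n. s n x) \<longlonglongrightarrow> f x"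
    "\<And>n x. x \<in> space M \<Longrightarrow> norm (s n x) \<le> norm (f x)"
    using strongly_measurable_dominated_approx[OF f(1)] by metis
  have sm: "strongly_measurable M (s n)" for n
    by (rule strongly_measurable_simple[OF s(1)])
  have [measurable]: "(\<lambda>x. norm (f x)) \<in> borel_measurable M"
    "(\<lambda>x. norm (f x - s n x)) \<in> borel_measurable M"
    "(\<lambda>x. norm (s n x - s m x)) \<in> borel_measurable M" for n m
    by (auto intro!: borel_measurable_strong_norm strongly_measurable_diff f sm)
  have le: "norm (f x - s n x) \<le> 2 * norm (f x)" if "x \<in> space M" for x n
    using norm_triangle_ineq4[of "f x" "s n x"] s(3)[OF that, of n] by linarith
  have int: "integrable M (\<lambda>x. norm (f x - s n x))" for n
    by (rule Bochner_Integration.integrable_bound[of M "\<lambda>x. 2 * norm (f x)"])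
      (use f(2) le in auto)
  have lim: "(\<lambda>n. \<integral>x. norm (f x - s n x) \<partial>M) \<longlonglongrightarrow> 0"
  proof -
    have "(\<lambda>n. \<integral>x. norm (f x - s n x) \<partial>M) \<longlonglongrightarrow> (\<integral>x. 0 \<partial>M)"
    proof (rule integral_dominated_convergence[where w = "\<lambda>x. 2 * norm (f x)"])
      show "AE x in M. norm (norm (f x - s n x)) \<le> 2 * norm (f x)" for n
        using le by auto
      show "AE x in M. (\<lambda>n. norm (f x - s n x)) \<longlonglongrightarrow> 0"
        using s(2)
      proof eventually_elim
        case (elim x)
        have "(\<lambda>n. norm (f x - s n x)) \<longlonglongrightarrow> norm (f x - f x)" by (intro tendsto_intros elim)
        then show ?case by simp
      qed
    qed (use f in auto)
    then show ?thesis by simp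
  qed
  let ?S = "\<lambda>n. Bochner_Integration.simple_bochner_integral M (s n)"
  have bound: "norm (?S n - ?S m) \<le> (\<integral>x. norm (f x - s n x) \<partial>M) + (\<integral>x. norm (f x - s m x) \<partial>M)" for n m
  proof -
    have sb: "Bochner_Integration.simple_bochner_integrable M (\<lambda>x. s n x - s m x)"
      by (simp add: simple_bochner_integrable_iff simple_function_compose2[OF s(1) s(1), where h = "\<lambda>a b. a - b"])
    have "norm (?S n - ?S m) = norm (Bochner_Integration.simple_bochner_integral M (\<lambda>x. s n x - s m x))"
      using s(1) by (subst simple_bochner_integral_diff) (auto simp: simple_bochner_integrable_iff)
    also have "\<dots> \<le> Bochner_Integration.simple_bochner_integral M (\<lambda>x. norm (s n x - s m x))"
      by (rule simple_bochner_integral_norm_bound[OF sb])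
    finally have "ennreal (norm (?S n - ?S m)) \<le> \<dots>" by (rule ennreal_leI)
    also have "\<dots> = (\<integral>\<^sup>+x. ennreal (norm (s n x - s m x)) \<partial>M)"
      by (intro simple_bochner_integral_eq_nn_integral)
        (simp_all add: simple_bochner_integrable_iff simple_function_compose2[OF s(1) s(1), where h = "\<lambda>a b. norm (a - b)"])
    also have "\<dots> \<le> (\<integral>\<^sup>+x. ennreal (norm (f x - s n x) + norm (f x - s m x)) \<partial>M)"
    proof (intro nn_integral_mono ennreal_leI)
      fix x show "norm (s n x - s m x) \<le> norm (f x - s n x) + norm (f x - s m x)"
        using norm_triangle_ineq4[of "f x - s m x" "f x - s n x"] by simp
    qed
    also have "\<dots> = ennreal (\<integral>x. norm (f x - s n x) + norm (f x - s m x) \<partial>M)"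
      by (intro nn_integral_eq_integral) (auto intro!: int)
    also have "\<dots> = ennreal ((\<integral>x. norm (f x - s n x) \<partial>M) + (\<integral>x. norm (f x - s m x) \<partial>M))"
      by (subst Bochner_Integration.integral_add) (auto intro!: int)
    finally show ?thesis by (subst (asm) ennreal_le_iff) auto
  qed
  have "Cauchy ?S"
  proof (rule metric_CauchyI)
    fix e :: real assume "0 < e"
    then have "eventually (\<lambda>n. (\<integral>x. norm (f x - s n x) \<partial>M) < e / 2) sequentially"
      using lim by (intro order_tendstoD) auto
    then obtain K where K: "\<And>n. n \<ge> K \<Longrightarrow> (\<integral>x. norm (f x - s n x) \<partial>M) < e / 2"
      by (auto simp: eventually_sequentially)
    show "\<exists>K. \<forall>m\<ge>K. \<forall>n\<ge>K. dist (?S m) (?S n) < e"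
    proof (intro exI[of _ K] allI impI)
      fix m n assume "m \<ge> K" "n \<ge> K"
      from bound[of m n] K[OF this(1)] K[OF this(2)] show "dist (?S m) (?S n) < e"
        by (simp add: dist_norm)
    qed
  qed
  then obtain v where v: "?S \<longlonglongrightarrow> v" using Cauchy_convergent convergent_def by blast
  have "(\<lambda>n. \<integral>\<^sup>+x. ennreal (norm (f x - s n x)) \<partial>M) \<longlonglongrightarrow> 0"
    using tendsto_ennrealI[OF lim] nn_integral_eq_integral[OF int] by simp
  with v f(1) s(1) show ?thesis
    unfolding has_strong_integral_def by (auto simp: simple_bochner_integrable_iff)
qed

lemma has_strong_integral_strong_integral:
  fixes f :: "'a \<Rightarrow> 'b::banach"
  assumes "strongly_integrable M f"
  shows "has_strong_integral M f (strong_integral M f)"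
  unfolding strong_integral_def
  by (rule theI') (use has_strong_integral_exists[OF assms] has_strong_integral_unique in blast)

lemma strong_integral_eqI: "has_strong_integral M f v \<Longrightarrow> strong_integral M f = v"
  unfolding strong_integral_def by (rule the_equality) (auto intro: has_strong_integral_unique)

lemma strong_integral_cong_AE:
  fixes f g :: "'a \<Rightarrow> 'b::banach"
  assumes "strongly_integrable M f" "AE x in M. f x = g x"
  shows "strong_integral M f = strong_integral M g"
  using has_strong_integral_cong_AE[OF has_strong_integral_strong_integral[OF assms(1)] assms(2)]
  by (metis strong_integral_eqI)

lemma strongly_integrable_bound:
  fixes f :: "'a \<Rightarrow> 'b::real_normed_vector" and g :: "'a \<Rightarrow> real"
  assumes "strongly_measurable M f" "integrable M g" "AE x in M. norm (f x) \<le> g x"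
  shows "strongly_integrable M f"
  unfolding strongly_integrable_def
proof
  show "integrable M (\<lambda>x. norm (f x))"
    by (rule Bochner_Integration.integrable_bound[OF assms(2)])
      (use borel_measurable_strong_norm[OF assms(1)] assms(3) in auto)
qed fact

lemma strongly_integrable_add:
  "strongly_integrable M f \<Longrightarrow> strongly_integrable M g \<Longrightarrow> strongly_integrable M (\<lambda>x. f x + g x)"
  by (rule strongly_integrable_bound[of _ "\<lambda>x. norm (f x) + norm (g x)"])
    (auto simp: strongly_integrable_def norm_triangle_ineq intro: strongly_measurable_add)

lemma strongly_integrable_scaleR:
  "strongly_integrable M f \<Longrightarrow> strongly_integrable M (\<lambda>x. c *\<^sub>R f x)"
  by (auto simp: strongly_integrable_def intro: strongly_measurable_scaleR strongly_measurable_const)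

lemma strongly_integrable_diff:
  "strongly_integrable M f \<Longrightarrow> strongly_integrable M g \<Longrightarrow> strongly_integrable M (\<lambda>x. f x - g x)"
  using strongly_integrable_add[OF _ strongly_integrable_scaleR[of g "-1"], of f] by simp

lemma strong_integral_add:
  fixes f g :: "'a \<Rightarrow> 'b::banach"
  shows "strongly_integrable M f \<Longrightarrow> strongly_integrable M g \<Longrightarrow>
    strong_integral M (\<lambda>x. f x + g x) = strong_integral M f + strong_integral M g"
  by (intro strong_integral_eqI has_strong_integral_add has_strong_integral_strong_integral)

lemma strong_integral_scaleR:
  fixes f :: "'a \<Rightarrow> 'b::banach"
  shows "strongly_integrable M f \<Longrightarrow>
    strong_integral M (\<lambda>x. c *\<^sub>R f x) = c *\<^sub>R strong_integral M f"
  by (intro strong_integral_eqI has_strong_integral_scaleR has_strong_integral_strong_integral)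

lemma strong_integral_diff:
  fixes f g :: "'a \<Rightarrow> 'b::banach"
  shows "strongly_integrable M f \<Longrightarrow> strongly_integrable M g \<Longrightarrow>
    strong_integral M (\<lambda>x. f x - g x) = strong_integral M f - strong_integral M g"
  using strong_integral_add[OF _ strongly_integrable_scaleR[of g "-1"], of f]
    strong_integral_scaleR[of g "-1"] by simp

lemma norm_strong_integral_le:
  fixes f :: "'a \<Rightarrow> 'b::banach"
  assumes "strongly_integrable M f"
  shows "norm (strong_integral M f) \<le> (\<integral>x. norm (f x) \<partial>M)"
proof -
  have i: "integrable M (\<lambda>x. norm (f x))" using assms by (simp add: strongly_integrable_def)
  have "ennreal (norm (strong_integral M f)) \<le> (\<integral>\<^sup>+x. ennreal (norm (f x)) \<partial>M)"
    by (intro sublinear_has_strong_integral_le sublinear_below_norm_norm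
        has_strong_integral_strong_integral assms)
  also have "\<dots> = ennreal (\<integral>x. norm (f x) \<partial>M)"
    by (intro nn_integral_eq_integral i) auto
  finally show ?thesis by (subst (asm) ennreal_le_iff) auto
qed

lemma norm_strong_integral_le_bound:
  fixes f :: "'a \<Rightarrow> 'b::banach"
  assumes "strongly_measurable M f" "integrable M g" "AE x in M. norm (f x) \<le> g x"
  shows "norm (strong_integral M f) \<le> (\<integral>x. g x \<partial>M)"
proof -
  have f: "strongly_integrable M f" by (rule strongly_integrable_bound[OF assms])
  have "(\<integral>x. norm (f x) \<partial>M) \<le> (\<integral>x. g x \<partial>M)"
    using f assms by (intro integral_mono_AE) (auto simp: strongly_integrable_def)
  with norm_strong_integral_le[OF f] show ?thesis by simp
qed

end

text \<open>Links the integral over \<open>{0..t}\<close> in the notion of solution to the one over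
  \<open>{0..T}\<close> used in the construction; the kernel vanishes after \<open>t\<close>. The
  two agree because approximations on \<open>A\<close> extend by zero and integrals are
  unique.\<close>

lemma has_strong_integral_restrict_space:
  fixes f :: "'a \<Rightarrow> 'b::banach"
  assumes fc: "finite_complete_measure M" "finite_complete_measure (restrict_space M A)"
    and A: "A \<in> sets M" and f: "strongly_integrable M f"
    and 0: "\<And>x. x \<in> space M - A \<Longrightarrow> f x = 0"
  shows "has_strong_integral (restrict_space M A) f (strong_integral M f)"
proof -
  interpret M: finite_complete_measure M by fact
  interpret R: finite_complete_measure "restrict_space M A" by fact
  have AM: "A \<inter> space M \<in> sets M" using A by auto
  have Asp: "A \<subseteq> space M" using A sets.sets_into_space by auto
  have sfr: "simple_function (restrict_space M A) s" if "simple_function M s" for s :: "'a \<Rightarrow> 'b"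
    using that A Asp
    by (auto simp: simple_function_def space_restrict_space sets_restrict_space
        intro: finite_subset[of "s ` A" "s ` space M"] image_eqI[where x = "s -` {s _} \<inter> space M"])
  have "strongly_measurable (restrict_space M A) f"
  proof -
    obtain s where s: "\<And>n::nat. simple_function M (s n)" "AE x in M. (\<lambda>n. s n x) \<longlonglongrightarrow> f x"
      using f unfolding strongly_integrable_def strongly_measurable_def by blast
    have "AE x in restrict_space M A. (\<lambda>n. s n x) \<longlonglongrightarrow> f x"
      using s(2) by (subst AE_restrict_space_iff[OF AM]) auto
    with sfr[OF s(1)] show ?thesis unfolding strongly_measurable_def by blast
  qed
  moreover have "integrable (restrict_space M A) (\<lambda>x. norm (f x))"
    using f A unfolding strongly_integrable_def
    by (auto simp: integrable_restrict_space intro!: integrable_mult_indicator[where 'b = real, simplified])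
  ultimately have "strongly_integrable (restrict_space M A) f" by (simp add: strongly_integrable_def)
  then obtain v where v: "has_strong_integral (restrict_space M A) f v"
    using R.has_strong_integral_exists by blast
  then obtain s where s: "\<And>n::nat. Bochner_Integration.simple_bochner_integrable (restrict_space M A) (s n)"
      "(\<lambda>n. \<integral>\<^sup>+x. ennreal (norm (f x - s n x)) \<partial>restrict_space M A) \<longlonglongrightarrow> 0"
      "(\<lambda>n. Bochner_Integration.simple_bochner_integral (restrict_space M A) (s n)) \<longlonglongrightarrow> v"
    unfolding has_strong_integral_def by auto
  have "has_strong_integral M f v"
    unfolding has_strong_integral_def
  proof (intro conjI exI[of _ "\<lambda>n x. indicator A x *\<^sub>R s n x"] allI)
    show "strongly_measurable M f" using f by (simp add: strongly_integrable_def)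
    show "Bochner_Integration.simple_bochner_integrable M (\<lambda>x. indicator A x *\<^sub>R s n x)" for n
      using s(1)[of n] by (simp add: simple_bochner_integrable_restrict_space[OF AM])
    show "(\<lambda>n. Bochner_Integration.simple_bochner_integral M (\<lambda>x. indicator A x *\<^sub>R s n x)) \<longlonglongrightarrow> v"
      using s(3) by (simp add: simple_bochner_integral_restrict_space[OF AM s(1)])
    have "(\<integral>\<^sup>+x. ennreal (norm (f x - s n x)) \<partial>restrict_space M A)
        = (\<integral>\<^sup>+x. ennreal (norm (f x - indicator A x *\<^sub>R s n x)) \<partial>M)" for n
      by (subst nn_integral_restrict_space[OF AM])
        (auto intro!: nn_integral_cong simp: 0 indicator_def)
    then show "(\<lambda>n. \<integral>\<^sup>+x. ennreal (norm (f x - indicator A x *\<^sub>R s n x)) \<partial>M) \<longlonglongrightarrow> 0"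
      using s(2) by simp
  qed
  with v show ?thesis by (simp add: M.strong_integral_eqI)
qed

section \<open>A measure of noncompactness for sequences\<close>

text \<open>The penalty on the coefficients places \<open>{x. cone_gauge d m x < \<rho>}\<close> inside the
  \<open>\<rho>\<close>-neighbourhood of a compact set, without any finite-dimensional norm equivalence.\<close>

definition cone_gauge :: "(nat \<Rightarrow> 'b::real_normed_vector) \<Rightarrow> nat \<Rightarrow> 'b \<Rightarrow> real" where
  "cone_gauge d m x =
     (INF a\<in>{a. \<forall>i. 0 \<le> a i}. norm (x - (\<Sum>i\<le>m. a i *\<^sub>R d i)) + (\<Sum>i\<le>m. a i) / (real m + 1))"

lemma cone_gauge_le:
  assumes "\<And>i. 0 \<le> a i"
  shows "cone_gauge d m x \<le> norm (x - (\<Sum>i\<le>m. a i *\<^sub>R d i)) + (\<Sum>i\<le>m. a i) / (real m + 1)"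
  unfolding cone_gauge_def
proof (rule cINF_lower)
  show "bdd_below ((\<lambda>a. norm (x - (\<Sum>i\<le>m. a i *\<^sub>R d i)) + (\<Sum>i\<le>m. a i) / (real m + 1)) ` {a. \<forall>i. 0 \<le> a i})"
    by (rule bdd_belowI2[of _ 0]) (auto intro!: add_nonneg_nonneg divide_nonneg_nonneg sum_nonneg)
qed (use assms in auto)

lemma cone_gauge_lessE:
  assumes "cone_gauge d m x < \<rho>"
  obtains a where "\<And>i. 0 \<le> a i"
    "norm (x - (\<Sum>i\<le>m. a i *\<^sub>R d i)) + (\<Sum>i\<le>m. a i) / (real m + 1) < \<rho>"
proof -
  have b: "bdd_below ((\<lambda>a. norm (x - (\<Sum>i\<le>m. a i *\<^sub>R d i)) + (\<Sum>i\<le>m. a i) / (real m + 1)) ` {a. \<forall>i. 0 \<le> a i})"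
    by (rule bdd_belowI2[of _ 0]) (auto intro!: add_nonneg_nonneg divide_nonneg_nonneg sum_nonneg)
  have "{a :: nat \<Rightarrow> real. \<forall>i. 0 \<le> a i} \<noteq> {}" by (auto intro: exI[of _ "\<lambda>_. 0"])
  from assms[unfolded cone_gauge_def cINF_less_iff[OF this b]] show thesis
    using that by auto
qed

lemma sublinear_below_norm_cone_gauge: "sublinear_below_norm (cone_gauge d m)"
proof
  show nonneg: "0 \<le> cone_gauge d m x" for x
    unfolding cone_gauge_def
    by (rule cINF_greatest) (auto intro!: add_nonneg_nonneg divide_nonneg_nonneg sum_nonneg exI[of _ "\<lambda>_. 0"])
  show le: "cone_gauge d m x \<le> norm x" for x
    using cone_gauge_le[of "\<lambda>_. 0" d m x] by simp
  show "cone_gauge d m (x + y) \<le> cone_gauge d m x + cone_gauge d m y" for x y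
  proof (rule field_le_epsilon)
    fix e :: real assume "0 < e"
    then have x: "cone_gauge d m x < cone_gauge d m x + e / 2"
      and y: "cone_gauge d m y < cone_gauge d m y + e / 2"
      by auto
    from cone_gauge_lessE[OF x] obtain a where
      a: "\<And>i. 0 \<le> a i" "norm (x - (\<Sum>i\<le>m. a i *\<^sub>R d i)) + (\<Sum>i\<le>m. a i) / (real m + 1) < cone_gauge d m x + e / 2"
      by blast
    from cone_gauge_lessE[OF y] obtain b where
      b: "\<And>i. 0 \<le> b i" "norm (y - (\<Sum>i\<le>m. b i *\<^sub>R d i)) + (\<Sum>i\<le>m. b i) / (real m + 1) < cone_gauge d m y + e / 2"
      by blast
    have "cone_gauge d m (x + y) \<le> norm (x + y - (\<Sum>i\<le>m. (a i + b i) *\<^sub>R d i)) + (\<Sum>i\<le>m. a i + b i) / (real m + 1)"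
      using a b by (intro cone_gauge_le) (auto intro: add_nonneg_nonneg)
    also have "norm (x + y - (\<Sum>i\<le>m. (a i + b i) *\<^sub>R d i))
        \<le> norm (x - (\<Sum>i\<le>m. a i *\<^sub>R d i)) + norm (y - (\<Sum>i\<le>m. b i *\<^sub>R d i))"
      by (simp add: scaleR_add_left sum.distrib norm_diff_triangle_ineq)
    finally show "cone_gauge d m (x + y) \<le> cone_gauge d m x + cone_gauge d m y + e"
      using a(2) b(2) by (simp add: sum.distrib add_divide_distrib)
  qed
  have hom: "cone_gauge d m (c *\<^sub>R x) \<le> c * cone_gauge d m x" if "0 < c" for c x
  proof (rule field_le_epsilon)
    fix e :: real assume "0 < e"
    then have "cone_gauge d m x < cone_gauge d m x + e / c" using that by simp
    then obtain a where a: "\<And>i. 0 \<le> a i"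
      "norm (x - (\<Sum>i\<le>m. a i *\<^sub>R d i)) + (\<Sum>i\<le>m. a i) / (real m + 1) < cone_gauge d m x + e / c"
      by (elim cone_gauge_lessE) blast
    have "cone_gauge d m (c *\<^sub>R x) \<le> norm (c *\<^sub>R x - (\<Sum>i\<le>m. (c * a i) *\<^sub>R d i)) + (\<Sum>i\<le>m. c * a i) / (real m + 1)"
      using a that by (intro cone_gauge_le) auto
    also have "(\<Sum>i\<le>m. (c * a i) *\<^sub>R d i) = c *\<^sub>R (\<Sum>i\<le>m. a i *\<^sub>R d i)"
      by (simp add: scaleR_sum_right)
    also have "norm (c *\<^sub>R x - c *\<^sub>R (\<Sum>i\<le>m. a i *\<^sub>R d i)) = c * norm (x - (\<Sum>i\<le>m. a i *\<^sub>R d i))"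
      using that by (simp add: scaleR_diff_right[symmetric])
    also have "\<dots> + (\<Sum>i\<le>m. c * a i) / (real m + 1)
        = c * (norm (x - (\<Sum>i\<le>m. a i *\<^sub>R d i)) + (\<Sum>i\<le>m. a i) / (real m + 1))"
      by (simp add: sum_distrib_left[symmetric] distrib_left)
    also have "\<dots> \<le> c * (cone_gauge d m x + e / c)"
      using a(2) that by (intro mult_left_mono) auto
    finally show "cone_gauge d m (c *\<^sub>R x) \<le> c * cone_gauge d m x + e"
      using that by (simp add: distrib_left)
  qed
  show "cone_gauge d m (c *\<^sub>R x) = c * cone_gauge d m x" if "0 \<le> c" for c x
  proof (cases "c = 0")
    case True
    then show ?thesis using nonneg[of 0] le[of 0] by simp
  next
    case False
    with that have c: "0 < c" by simp
    have "cone_gauge d m x \<le> (1 / c) * cone_gauge d m (c *\<^sub>R x)"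
      using hom[of "1/c" "c *\<^sub>R x"] c by simp
    with hom[OF c, of x] c show ?thesis by (simp add: field_simps)
  qed
qed

text \<open>A larger \<open>m\<close> adds generators and lowers the price of coefficients.
  Monotonicity allows the infimum over \<open>m\<close> to be taken under the integral.\<close>

lemma cone_gauge_Suc_le: "cone_gauge d (Suc m) x \<le> cone_gauge d m x"
proof (rule field_le_epsilon)
  fix e :: real assume "0 < e"
  then have "cone_gauge d m x < cone_gauge d m x + e" by simp
  then obtain a where a: "\<And>i. 0 \<le> a i"
    "norm (x - (\<Sum>i\<le>m. a i *\<^sub>R d i)) + (\<Sum>i\<le>m. a i) / (real m + 1) < cone_gauge d m x + e"
    by (elim cone_gauge_lessE) blast
  let ?a = "\<lambda>i. if i \<le> m then a i else 0"
  have s: "(\<Sum>i\<le>Suc m. ?a i *\<^sub>R d i) = (\<Sum>i\<le>m. a i *\<^sub>R d i)" "(\<Sum>i\<le>Suc m. ?a i) = (\<Sum>i\<le>m. a i)"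
    by auto
  have "cone_gauge d (Suc m) x \<le> norm (x - (\<Sum>i\<le>Suc m. ?a i *\<^sub>R d i)) + (\<Sum>i\<le>Suc m. ?a i) / (real (Suc m) + 1)"
    using a by (intro cone_gauge_le) auto
  also have "\<dots> \<le> norm (x - (\<Sum>i\<le>m. a i *\<^sub>R d i)) + (\<Sum>i\<le>m. a i) / (real m + 1)"
    unfolding s using a by (intro add_left_mono divide_left_mono sum_nonneg) auto
  finally show "cone_gauge d (Suc m) x \<le> cone_gauge d m x + e" using a(2) by simp
qed

lemma cone_gauge_generator_le: "i \<le> m \<Longrightarrow> cone_gauge d m (d i) \<le> 1 / (real m + 1)"
  using cone_gauge_le[of "\<lambda>j. if j = i then 1 else 0" d m "d i"]
  by (simp add: if_distrib[of "\<lambda>a. a *\<^sub>R _"] cong: if_cong)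

text \<open>The price \<open>1 / (real m + 1)\<close> of a unit coefficient vanishes as
  \<open>m\<close> grows, so points of the subspace cost nothing in the limit; for fixed
  \<open>m\<close> it is positive and still bounds the coefficients.\<close>

lemma cone_gauge_tendsto_0:
  assumes "x \<in> closure (range d)"
  shows "(\<lambda>m. cone_gauge d m x) \<longlonglongrightarrow> 0"
proof (rule LIMSEQ_I)
  fix e :: real assume e: "0 < e"
  then obtain i where i: "dist (d i) x < e / 2"
    using assms by (metis closure_approachable half_gt_zero rangeE)
  obtain n :: nat where n: "2 / e < real n" using reals_Archimedean2 by blast
  show "\<exists>no. \<forall>m\<ge>no. norm (cone_gauge d m x - 0) < e"
  proof (intro exI[of _ "max i n"] allI impI)
    fix m assume m: "max i n \<le> m"
    interpret sublinear_below_norm "cone_gauge d m" by (rule sublinear_below_norm_cone_gauge)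
    have "cone_gauge d m x \<le> cone_gauge d m (d i) + norm (x - d i)" by (rule le_add_norm_diff)
    also have "\<dots> \<le> 1 / (real m + 1) + norm (x - d i)"
      using m by (intro add_right_mono cone_gauge_generator_le) auto
    also have "1 / (real m + 1) < e / 2"
    proof -
      have "2 / e < real m + 1" using n m by linarith
      then show ?thesis using e by (simp add: field_simps)
    qed
    finally show "norm (cone_gauge d m x - 0) < e"
      using i nonneg[of x] by (simp add: dist_norm norm_minus_commute)
  qed
qed

lemma compact_bounded_combinations:
  fixes d :: "nat \<Rightarrow> 'b::real_normed_vector"
  shows "compact {\<Sum>i\<le>m. a i *\<^sub>R d i | a :: nat \<Rightarrow> real. \<forall>i. 0 \<le> a i \<and> a i \<le> K}"
proof (induction m)
  have c: "compact ((\<lambda>r. r *\<^sub>R d i) ` {0..K})" for i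
    by (intro compact_continuous_image continuous_intros) auto
  {
    case 0
    have "{\<Sum>i\<le>0. a i *\<^sub>R d i | a. \<forall>i. 0 \<le> a i \<and> a i \<le> K} = (\<lambda>r. r *\<^sub>R d 0) ` {0..K}"
      by (auto simp: image_iff intro: exI[of _ "\<lambda>_::nat. _::real"])
    then show ?case using c by simp
  next
    case (Suc m)
    have "{\<Sum>i\<le>Suc m. a i *\<^sub>R d i | a. \<forall>i. 0 \<le> a i \<and> a i \<le> K} =
      {x + y | x y. x \<in> {\<Sum>i\<le>m. a i *\<^sub>R d i | a. \<forall>i. 0 \<le> a i \<and> a i \<le> K} \<and>
         y \<in> (\<lambda>r. r *\<^sub>R d (Suc m)) ` {0..K}}" (is "?A = ?B")
    proof (intro equalityI subsetI)
      fix z assume "z \<in> ?A"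
      then obtain a where a: "\<forall>i. 0 \<le> a i \<and> a i \<le> K" "z = (\<Sum>i\<le>Suc m. a i *\<^sub>R d i)" by auto
      then have "z = (\<Sum>i\<le>m. a i *\<^sub>R d i) + a (Suc m) *\<^sub>R d (Suc m)" by simp
      moreover have "a (Suc m) *\<^sub>R d (Suc m) \<in> (\<lambda>r. r *\<^sub>R d (Suc m)) ` {0..K}" using a(1) by (intro imageI) auto
      ultimately show "z \<in> ?B" using a(1) by blast
    next
      fix z assume "z \<in> ?B"
      then obtain a r where a: "\<forall>i. 0 \<le> a i \<and> a i \<le> K" "0 \<le> r" "r \<le> K"
        "z = (\<Sum>i\<le>m. a i *\<^sub>R d i) + r *\<^sub>R d (Suc m)" by auto
      have "z = (\<Sum>i\<le>Suc m. (a(Suc m := r)) i *\<^sub>R d i)" using a(4) by simp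
      then show "z \<in> ?A" using a(1-3) by (auto intro!: exI[of _ "a(Suc m := r)"])
    qed
    then show ?case using compact_sums[OF Suc c[of "Suc m"]] by simp
  }
qed

text \<open>For a bounded sequence \<open>z\<close> in the closed subspace \<open>E\<^sub>0 = closure (range d)\<close> this is the
  Hausdorff measure of noncompactness of the set of its members relative to \<open>E\<^sub>0\<close>.\<close>

definition seq_mnc :: "(nat \<Rightarrow> 'b::real_normed_vector) \<Rightarrow> (nat \<Rightarrow> 'b) \<Rightarrow> ennreal" where
  "seq_mnc d z = (INF m. limsup (\<lambda>n. ennreal (cone_gauge d m (z n))))"

text \<open>Finitely many centres have small gauge for one common \<open>m\<close>, and the gauge
  grows by at most the distance to a centre.\<close>

lemma seq_mnc_le_if_finite_net:
  assumes C: "finite C" "C \<subseteq> closure (range d)" and \<rho>: "0 \<le> \<rho>"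
    and z: "eventually (\<lambda>n. \<exists>c\<in>C. norm (z n - c) \<le> \<rho>) sequentially"
  shows "seq_mnc d z \<le> ennreal \<rho>"
proof (rule ennreal_le_epsilon)
  fix \<delta> :: real assume \<delta>: "0 < \<delta>"
  have "eventually (\<lambda>m. \<forall>c\<in>C. cone_gauge d m c < \<delta>) sequentially"
    using C \<delta> by (intro eventually_ball_finite ballI order_tendstoD(2)[OF cone_gauge_tendsto_0]) auto
  then obtain m where m: "\<And>c. c \<in> C \<Longrightarrow> cone_gauge d m c < \<delta>"
    by (auto simp: eventually_sequentially)
  interpret sublinear_below_norm "cone_gauge d m" by (rule sublinear_below_norm_cone_gauge)
  have "seq_mnc d z \<le> limsup (\<lambda>n. ennreal (cone_gauge d m (z n)))"
    unfolding seq_mnc_def by (rule INF_lower) simp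
  also have "\<dots> \<le> ennreal (\<rho> + \<delta>)"
  proof (rule Limsup_bounded)
    show "eventually (\<lambda>n. ennreal (cone_gauge d m (z n)) \<le> ennreal (\<rho> + \<delta>)) sequentially"
      using z
    proof eventually_elim
      case (elim n)
      then obtain c where c: "c \<in> C" "norm (z n - c) \<le> \<rho>" by auto
      show ?case using le_add_norm_diff[of "z n" c] c m[OF c(1)] by (intro ennreal_leI) linarith
    qed
  qed
  finally show "seq_mnc d z \<le> ennreal \<rho> + ennreal \<delta>" using \<rho> \<delta> by simp
qed

text \<open>The converse passage, from functionals back to nets. A gauge value below
  \<open>r\<close> bounds the total coefficient by \<open>r * (real m + 1)\<close>, so the
  approximating combinations lie in a compact set, and a finite net of that set serves all but
  finitely many \<open>z n\<close>.\<close>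

lemma finite_net_if_seq_mnc_less:
  assumes E: "subspace (closure (range d))" and z: "seq_mnc d z < ennreal \<rho>"
  obtains C where "finite C" "C \<subseteq> closure (range d)"
    "eventually (\<lambda>n. \<exists>c\<in>C. norm (z n - c) < \<rho>) sequentially"
proof -
  obtain m where m: "limsup (\<lambda>n. ennreal (cone_gauge d m (z n))) < ennreal \<rho>"
    using z unfolding seq_mnc_def by (auto simp: INF_less_iff)
  then obtain l where l: "limsup (\<lambda>n. ennreal (cone_gauge d m (z n))) = ennreal l" "0 \<le> l"
    by (cases "limsup (\<lambda>n. ennreal (cone_gauge d m (z n)))") (auto simp: top_unique)
  with m have "l < \<rho>" by (simp add: ennreal_less_iff)
  \<comment> \<open>The radius is split: \<open>r\<close> is spent on the gauge and
    \<open>\<rho> - r\<close> on the mesh of the net. Any value strictly between \<open>l\<close>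
    and \<open>\<rho>\<close> would serve.\<close>
  define r where "r = (l + \<rho>) / 2"
  have r: "l < r" "r < \<rho>" "0 < r" using \<open>l < \<rho>\<close> l(2) by (auto simp: r_def)
  have "eventually (\<lambda>n. ennreal (cone_gauge d m (z n)) < ennreal r) sequentially"
    using l r by (intro Limsup_lessD) (auto simp: ennreal_less_iff)
  then have ev: "eventually (\<lambda>n. cone_gauge d m (z n) < r) sequentially"
    by eventually_elim (metis ennreal_leI linorder_not_less)
  define Z where "Z = {\<Sum>i\<le>m. a i *\<^sub>R d i | a :: nat \<Rightarrow> real. \<forall>i. 0 \<le> a i \<and> a i \<le> r * (real m + 1)}"
  have cZ: "compact Z" unfolding Z_def by (rule compact_bounded_combinations)
  have cov: "Z \<subseteq> (\<Union>c\<in>Z. ball c (\<rho> - r))"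
  proof
    fix x assume "x \<in> Z"
    moreover have "x \<in> ball x (\<rho> - r)" using r by simp
    ultimately show "x \<in> (\<Union>c\<in>Z. ball c (\<rho> - r))" by blast
  qed
  obtain C where C: "C \<subseteq> Z" "finite C" "Z \<subseteq> (\<Union>c\<in>C. ball c (\<rho> - r))"
    by (rule compactE_image[OF cZ _ cov, OF open_ball])
  have d: "d i \<in> closure (range d)" for i by (rule subsetD[OF closure_subset]) simp
  have "Z \<subseteq> closure (range d)"
    unfolding Z_def by (auto intro!: subspace_sum[OF E] subspace_scale[OF E] d)
  show thesis
  proof (rule that[OF C(2)])
    show "C \<subseteq> closure (range d)" using C(1) \<open>Z \<subseteq> closure (range d)\<close> by blast
    show "eventually (\<lambda>n. \<exists>c\<in>C. norm (z n - c) < \<rho>) sequentially"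
      using ev
    proof eventually_elim
      case (elim n)
      then obtain a where a: "\<And>i. 0 \<le> a i"
        "norm (z n - (\<Sum>i\<le>m. a i *\<^sub>R d i)) + (\<Sum>i\<le>m. a i) / (real m + 1) < r"
        by (elim cone_gauge_lessE) blast
      define b where "b i = (if i \<le> m then a i else 0)" for i
      have s: "0 \<le> (\<Sum>i\<le>m. a i) / (real m + 1)" using a(1) by (intro divide_nonneg_nonneg sum_nonneg) auto
      have s': "(\<Sum>i\<le>m. a i) < r * (real m + 1)"
      proof -
        have "(\<Sum>i\<le>m. a i) / (real m + 1) < r"
          using a(2) norm_ge_zero[of "z n - (\<Sum>i\<le>m. a i *\<^sub>R d i)"] by linarith
        then show ?thesis by (simp add: pos_divide_less_eq)
      qed
      have "a i \<le> r * (real m + 1)" if "i \<le> m" for i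
        using member_le_sum[of i "{..m}" a] a(1) that s' by auto
      then have "\<forall>i. 0 \<le> b i \<and> b i \<le> r * (real m + 1)" using a(1) r(3) by (auto simp: b_def)
      moreover have "(\<Sum>i\<le>m. b i *\<^sub>R d i) = (\<Sum>i\<le>m. a i *\<^sub>R d i)" by (intro sum.cong) (auto simp: b_def)
      ultimately have "(\<Sum>i\<le>m. a i *\<^sub>R d i) \<in> Z" unfolding Z_def by (auto intro!: exI[of _ b])
      then obtain c where c: "c \<in> C" "norm ((\<Sum>i\<le>m. a i *\<^sub>R d i) - c) < \<rho> - r"
        using C(3) by (force simp: dist_norm norm_minus_commute)
      have "norm (z n - c) \<le> norm (z n - (\<Sum>i\<le>m. a i *\<^sub>R d i)) + norm ((\<Sum>i\<le>m. a i *\<^sub>R d i) - c)"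
        using norm_triangle_ineq[of "z n - (\<Sum>i\<le>m. a i *\<^sub>R d i)" "(\<Sum>i\<le>m. a i *\<^sub>R d i) - c"] by simp
      with a(2) s c show ?case by force
    qed
  qed
qed

text \<open>Nets exist for radii strictly above the measure of noncompactness \<open>x\<close>;
  letting the radius decrease to \<open>x\<close> gives the estimate at \<open>x\<close> itself.
  Finiteness of \<open>x\<close> guarantees that there are such radii.\<close>

lemma ennreal_le_mult_if_real_upper:
  assumes fin: "x < \<infinity>" and c: "0 \<le> c"
    and h: "\<And>\<rho>. x < ennreal \<rho> \<Longrightarrow> y \<le> ennreal (c * \<rho> + e)"
  shows "y \<le> ennreal c * x + ennreal e"
proof -
  obtain l where l: "x = ennreal l" "0 \<le> l" using fin by (cases x) auto
  show ?thesis
  proof (cases y)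
    case (real z)
    have "z \<le> max 0 (c * l + e)"
    proof (rule tendsto_lowerbound[where F = "at_right l" and f = "\<lambda>\<rho>. max 0 (c * \<rho> + e)"])
      show "((\<lambda>\<rho>. max 0 (c * \<rho> + e)) \<longlongrightarrow> max 0 (c * l + e)) (at_right l)"
        by (intro tendsto_intros)
      have "z \<le> max 0 (c * \<rho> + e)" if "l < \<rho>" for \<rho>
        using h[of \<rho>] that l real by (auto simp: ennreal_less_iff ennreal_le_iff2 le_max_iff_disj)
      then show "eventually (\<lambda>\<rho>. z \<le> max 0 (c * \<rho> + e)) (at_right l)"
        by (auto simp: eventually_at_filter)
    qed auto
    then have "y \<le> ennreal (c * l + e)" using real by (auto simp: max_def ennreal_le_iff2 split: if_splits)
    also have "\<dots> \<le> ennreal (c * l) + ennreal e"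
      using c l by (cases "0 \<le> e") (auto simp: ennreal_neg intro!: ennreal_leI)
    finally show ?thesis using c l by (simp add: ennreal_mult)
  next
    case top
    have "x < ennreal (l + 1)" using l by (simp add: ennreal_less_iff)
    from h[OF this] top show ?thesis by (simp add: top_unique)
  qed
qed

section \<open>Sequences under operators, perturbations and selections\<close>

lemma seq_mnc_le_bound:
  assumes "eventually (\<lambda>n. norm (z n) \<le> B) sequentially"
  shows "seq_mnc d z \<le> ennreal B"
proof -
  interpret sublinear_below_norm "cone_gauge d 0" by (rule sublinear_below_norm_cone_gauge)
  have "seq_mnc d z \<le> limsup (\<lambda>n. ennreal (cone_gauge d 0 (z n)))"
    unfolding seq_mnc_def by (rule INF_lower) simp
  also have "\<dots> \<le> ennreal B"
    using assms by (intro Limsup_bounded) (auto elim!: eventually_mono intro!: ennreal_leI order_trans[OF le_norm])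
  finally show ?thesis .
qed

text \<open>The image of a net is a net with radius scaled by \<open>norm A\<close>; invariance
  keeps its centres in the subspace.\<close>

lemma seq_mnc_blinfun_le:
  fixes A :: "'b::real_normed_vector \<Rightarrow>\<^sub>L 'b"
  assumes E: "subspace (closure (range d))" and A: "\<And>x. x \<in> closure (range d) \<Longrightarrow> A x \<in> closure (range d)"
    and z: "seq_mnc d z < \<infinity>"
  shows "seq_mnc d (\<lambda>n. A (z n)) \<le> ennreal (norm A) * seq_mnc d z"
proof -
  have "seq_mnc d (\<lambda>n. A (z n)) \<le> ennreal (norm A) * seq_mnc d z + ennreal 0"
  proof (rule ennreal_le_mult_if_real_upper[OF z])
    fix \<rho> assume \<rho>: "seq_mnc d z < ennreal \<rho>"
    then obtain C where C: "finite C" "C \<subseteq> closure (range d)"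
      "eventually (\<lambda>n. \<exists>c\<in>C. norm (z n - c) < \<rho>) sequentially"
      by (rule finite_net_if_seq_mnc_less[OF E])
    have "0 < \<rho>" using \<rho> by (metis ennreal_0 ennreal_neg linorder_not_le not_less_zero)
    show "seq_mnc d (\<lambda>n. A (z n)) \<le> ennreal (norm A * \<rho> + 0)"
    proof (rule seq_mnc_le_if_finite_net[of "blinfun_apply A ` C"])
      show "eventually (\<lambda>n. \<exists>c\<in>blinfun_apply A ` C. norm (A (z n) - c) \<le> norm A * \<rho> + 0) sequentially"
        using C(3)
      proof eventually_elim
        case (elim n)
        then obtain c where c: "c \<in> C" "norm (z n - c) < \<rho>" by auto
        have "norm (A (z n) - A c) \<le> norm A * norm (z n - c)"
          using norm_blinfun[of A "z n - c"] by (simp add: blinfun.diff_right)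
        also have "\<dots> \<le> norm A * \<rho>" using c by (intro mult_left_mono) auto
        finally show ?case using c by auto
      qed
    qed (use C A \<open>0 < \<rho>\<close> in auto)
  qed auto
  then show ?thesis by simp
qed

text \<open>The net is shifted by \<open>h\<close>. In the application \<open>z n\<close> are
  integrals with an approximate kernel, and \<open>\<epsilon>\<close> absorbs the errors of the
  kernel and of the approximate solution.\<close>

lemma seq_mnc_perturb_le:
  assumes E: "subspace (closure (range d))" and h: "h \<in> closure (range d)" and \<epsilon>: "0 \<le> \<epsilon>"
    and y: "eventually (\<lambda>n. norm (y n - (h + z n)) \<le> \<epsilon>) sequentially"
  shows "seq_mnc d y \<le> seq_mnc d z + ennreal \<epsilon>"
proof (cases "seq_mnc d z < \<infinity>")
  case True
  have "seq_mnc d y \<le> ennreal 1 * seq_mnc d z + ennreal \<epsilon>"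
  proof (rule ennreal_le_mult_if_real_upper[OF True])
    fix \<rho> assume \<rho>: "seq_mnc d z < ennreal \<rho>"
    then obtain C where C: "finite C" "C \<subseteq> closure (range d)"
      "eventually (\<lambda>n. \<exists>c\<in>C. norm (z n - c) < \<rho>) sequentially"
      by (rule finite_net_if_seq_mnc_less[OF E])
    have "0 < \<rho>" using \<rho> by (metis ennreal_0 ennreal_neg linorder_not_le not_less_zero)
    show "seq_mnc d y \<le> ennreal (1 * \<rho> + \<epsilon>)"
    proof (rule seq_mnc_le_if_finite_net[of "(+) h ` C"])
      show "eventually (\<lambda>n. \<exists>c\<in>(+) h ` C. norm (y n - c) \<le> 1 * \<rho> + \<epsilon>) sequentially"
        using C(3) y
      proof eventually_elim
        case (elim n)
        then obtain c where c: "c \<in> C" "norm (z n - c) < \<rho>" by auto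
        have "norm (y n - (h + c)) \<le> norm (y n - (h + z n)) + norm (z n - c)"
          using norm_triangle_ineq[of "y n - (h + z n)" "z n - c"] by (simp add: algebra_simps)
        with c elim(2) show ?case by (auto intro!: bexI[of _ c])
      qed
      show "(+) h ` C \<subseteq> closure (range d)" using C(2) by (auto intro!: subspace_add[OF E] h)
    qed (use C \<open>0 < \<rho>\<close> \<epsilon> in auto)
  qed auto
  then show ?thesis by simp
next
  case False
  then show ?thesis by (simp add: not_less top_unique)
qed

text \<open>A finite net catches a tail of the sequence; the remaining members serve as their own
  centres.\<close>

lemma compact_closure_range_if_seq_mnc_0:
  fixes z :: "nat \<Rightarrow> 'b::banach"
  assumes E: "subspace (closure (range d))" and z: "seq_mnc d z = 0"
  shows "compact (closure (range z))"
  unfolding compact_eq_totally_bounded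
proof (intro conjI allI impI)
  show "complete (closure (range z))" by (simp add: complete_eq_closed)
  fix e :: real assume e: "0 < e"
  have "seq_mnc d z < ennreal (e / 2)" using z e by simp
  then obtain C where C: "finite C" "C \<subseteq> closure (range d)"
    "eventually (\<lambda>n. \<exists>c\<in>C. norm (z n - c) < e / 2) sequentially"
    by (rule finite_net_if_seq_mnc_less[OF E])
  then obtain n0 where n0: "\<And>n. n \<ge> n0 \<Longrightarrow> \<exists>c\<in>C. norm (z n - c) < e / 2"
    by (auto simp: eventually_sequentially)
  let ?k = "C \<union> z ` {..<n0}"
  have "range z \<subseteq> (\<Union>x\<in>?k. cball x (e / 2))"
  proof
    fix y assume "y \<in> range z"
    then obtain n where n: "y = z n" by auto
    show "y \<in> (\<Union>x\<in>?k. cball x (e / 2))"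
    proof (cases "n < n0")
      case True
      then have "z n \<in> ?k" "z n \<in> cball (z n) (e / 2)" using e by auto
      then show ?thesis unfolding n by blast
    next
      case False
      then obtain c where "c \<in> C" "norm (z n - c) < e / 2" using n0[of n] by auto
      then show ?thesis unfolding n by (auto simp: dist_norm norm_minus_commute intro!: bexI[of _ c])
    qed
  qed
  then have "closure (range z) \<subseteq> (\<Union>x\<in>?k. cball x (e / 2))"
    using C(1) by (intro closure_minimal closed_UN) auto
  also have "\<dots> \<subseteq> (\<Union>x\<in>?k. ball x e)" using e by (intro UN_mono) auto
  finally show "\<exists>k. finite k \<and> closure (range z) \<subseteq> (\<Union>x\<in>k. ball x e)"
    using C(1) by (intro exI[of _ ?k]) auto
qed

text \<open>The hypothesis on \<open>F\<close> involves a countable family of test sets, so that the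
  exceptional null sets of (5) can be discarded together. A net of radius \<open>\<rho>\<close> fits
  this family once its radius is raised to a rational \<open>e\<close> and its centres are moved
  into \<open>range d\<close> by less than \<open>e - \<rho>\<close>.\<close>

lemma seq_mnc_selection_le:
  fixes F :: "'b::real_normed_vector \<Rightarrow> 'b set" and \<eta> :: real and d :: "nat \<Rightarrow> 'b"
  defines "\<Omega> \<equiv> \<lambda>C e. closure (range d) \<inter> (\<Union>c\<in>C. ball c e)"
  assumes E: "subspace (closure (range d))"
    and F: "\<And>C e. finite C \<Longrightarrow> C \<subseteq> range d \<Longrightarrow> e \<in> \<rat> \<Longrightarrow> 0 < e \<Longrightarrow>
       ball_mnc (closure (range d)) ((\<Union>x\<in>\<Omega> C e. F x) \<inter> closure (range d))
         \<le> ereal \<eta> * ball_mnc (closure (range d)) (\<Omega> C e)"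
    and \<sigma>: "\<And>n. \<sigma> n \<in> closure (range d)" "seq_mnc d \<sigma> < \<infinity>"
    and w: "\<And>n. w n \<in> closure (range d)" "\<And>n. w n \<in> F (\<sigma> n)"
  shows "seq_mnc d w \<le> ennreal \<bar>\<eta>\<bar> * seq_mnc d \<sigma>"
proof -
  let ?E = "closure (range d)"
  have "seq_mnc d w \<le> ennreal \<bar>\<eta>\<bar> * seq_mnc d \<sigma> + ennreal 0"
  proof (rule ennreal_le_mult_if_real_upper[OF \<sigma>(2)])
    fix \<rho> assume \<rho>: "seq_mnc d \<sigma> < ennreal \<rho>"
    then obtain C where C: "finite C" "C \<subseteq> ?E"
      "eventually (\<lambda>n. \<exists>c\<in>C. norm (\<sigma> n - c) < \<rho>) sequentially"
      by (rule finite_net_if_seq_mnc_less[OF E])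
    have \<rho>0: "0 < \<rho>" using \<rho> by (metis ennreal_0 ennreal_neg linorder_not_le not_less_zero)
    have "seq_mnc d w \<le> ennreal (\<bar>\<eta>\<bar> * e + \<delta>)" if e: "\<rho> < e" "e \<in> \<rat>" and \<delta>: "0 < \<delta>" for e \<delta>
    proof -
      have "\<exists>x\<in>range d. dist x c < e - \<rho>" if "c \<in> C" for c
        using C(2) that e by (simp add: closure_approachable subset_iff)
      then obtain f where f: "\<And>c. c \<in> C \<Longrightarrow> f c \<in> range d" "\<And>c. c \<in> C \<Longrightarrow> dist (f c) c < e - \<rho>"
        by metis
      have fC: "finite (f ` C)" "f ` C \<subseteq> range d" using C f by auto
      have e0: "0 < e" using e \<rho>0 by simp
      have "ball_mnc ?E (\<Omega> (f ` C) e) \<le> ereal e"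
        unfolding ball_mnc_def
        by (rule Inf_lower) (use fC e0 f(1) in \<open>auto simp: \<Omega>_def intro!: exI[of _ "f ` C"] subsetD[OF closure_subset]\<close>)
      moreover have "0 \<le> ball_mnc ?E (\<Omega> (f ` C) e)"
        unfolding ball_mnc_def by (rule Inf_greatest) auto
      \<comment> \<open>The sign of \<open>\<eta>\<close> is arbitrary. Passing to its absolute
        value is safe because the measure of noncompactness lies between 0 and
        \<open>e\<close>.\<close>
      ultimately have "ereal \<eta> * ball_mnc ?E (\<Omega> (f ` C) e) \<le> ereal \<bar>\<eta>\<bar> * ereal e"
        by (intro order_trans[OF ereal_mult_right_mono[of "ereal \<eta>" "ereal \<bar>\<eta>\<bar>"] ereal_mult_left_mono]) auto
      with F[OF fC e(2) e0]
      have "ball_mnc ?E ((\<Union>x\<in>\<Omega> (f ` C) e. F x) \<inter> ?E) \<le> ereal (\<bar>\<eta>\<bar> * e)"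
        by simp
      also have "\<dots> < ereal (\<bar>\<eta>\<bar> * e + \<delta>)" using \<delta> by simp
      finally obtain r D where D: "r < \<bar>\<eta>\<bar> * e + \<delta>" "0 < r" "finite D" "D \<subseteq> ?E"
        "(\<Union>x\<in>\<Omega> (f ` C) e. F x) \<inter> ?E \<subseteq> (\<Union>x\<in>D. ball x r)"
        unfolding ball_mnc_def Inf_less_iff by auto
      show ?thesis
      proof (rule seq_mnc_le_if_finite_net[OF D(3,4)])
        show "eventually (\<lambda>n. \<exists>c\<in>D. norm (w n - c) \<le> \<bar>\<eta>\<bar> * e + \<delta>) sequentially"
          using C(3)
        proof eventually_elim
          case (elim n)
          then obtain c where c: "c \<in> C" "norm (\<sigma> n - c) < \<rho>" by auto
          have "dist (f c) (\<sigma> n) < e"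
            using f(2)[OF c(1)] c(2) dist_triangle[of "f c" "\<sigma> n" c] by (simp add: dist_norm norm_minus_commute)
          then have "\<sigma> n \<in> \<Omega> (f ` C) e" using c \<sigma>(1) by (auto simp: \<Omega>_def)
          then have "w n \<in> (\<Union>x\<in>D. ball x r)" using w D(5) by blast
          then show ?case using D(1) by (force simp: dist_norm norm_minus_commute)
        qed
      qed (use D in linarith)
    qed
    note * = this
    show "seq_mnc d w \<le> ennreal (\<bar>\<eta>\<bar> * \<rho> + 0)"
    proof (rule ennreal_le_epsilon)
      fix \<epsilon> :: real assume \<epsilon>: "0 < \<epsilon>"
      \<comment> \<open>This slack costs at most \<open>\<epsilon> / 2\<close> after multiplication
        by \<open>\<bar>\<eta>\<bar>\<close>; the summand 1 in the denominator covers
        \<open>\<eta> = 0\<close>.\<close>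
      obtain e where e: "e \<in> \<rat>" "\<rho> < e" "e < \<rho> + \<epsilon> / (2 * (\<bar>\<eta>\<bar> + 1))"
        using Rats_dense_in_real[of \<rho> "\<rho> + \<epsilon> / (2 * (\<bar>\<eta>\<bar> + 1))"] \<epsilon> by auto
      have "\<bar>\<eta>\<bar> * e \<le> \<bar>\<eta>\<bar> * (\<rho> + \<epsilon> / (2 * (\<bar>\<eta>\<bar> + 1)))" using e by (intro mult_left_mono) auto
      also have "\<dots> \<le> \<bar>\<eta>\<bar> * \<rho> + \<epsilon> / 2"
        using \<epsilon> by (simp add: distrib_left field_simps)
      finally have "\<bar>\<eta>\<bar> * e + \<epsilon> / 2 \<le> \<bar>\<eta>\<bar> * \<rho> + \<epsilon>" by simp
      then have "ennreal (\<bar>\<eta>\<bar> * e + \<epsilon> / 2) \<le> ennreal (\<bar>\<eta>\<bar> * \<rho> + \<epsilon>)" by (rule ennreal_leI)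
      with *[OF e(2,1), of "\<epsilon> / 2"] \<epsilon> have "seq_mnc d w \<le> ennreal (\<bar>\<eta>\<bar> * \<rho> + \<epsilon>)"
        by (meson half_gt_zero order_trans)
      also have "\<dots> = ennreal (\<bar>\<eta>\<bar> * \<rho> + 0) + ennreal \<epsilon>"
        using \<epsilon> \<rho>0 by (subst ennreal_plus[symmetric]) auto
      finally show "seq_mnc d w \<le> ennreal (\<bar>\<eta>\<bar> * \<rho> + 0) + ennreal \<epsilon>" .
    qed
  qed auto
  then show ?thesis by simp
qed

section \<open>Measurability and integration of the measure of noncompactness\<close>

lemma (in complete_measure) borel_measurable_cone_gauge:
  "strongly_measurable M f \<Longrightarrow> (\<lambda>x. cone_gauge d m (f x)) \<in> borel_measurable M"
  by (rule borel_measurable_strong_compose[where \<phi> = "cone_gauge d m"])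
    (auto intro: sublinear_below_norm.isCont sublinear_below_norm_cone_gauge)

lemma (in complete_measure) borel_measurable_seq_mnc:
  assumes "\<And>n. strongly_measurable M (f n)"
  shows "(\<lambda>x. seq_mnc d (\<lambda>n. f n x)) \<in> borel_measurable M"
  unfolding seq_mnc_def
  by (intro borel_measurable_INF borel_measurable_limsup measurable_compose[OF borel_measurable_cone_gauge[OF assms]])
    auto

text \<open>Sublinear functionals commute with integration up to \<open>\<le>\<close>, which is the reason for measuring
  noncompactness by them.\<close>

lemma (in finite_complete_measure) seq_mnc_strong_integral_le:
  fixes f :: "nat \<Rightarrow> 'a \<Rightarrow> 'b::banach"
  assumes f: "\<And>n. strongly_measurable M (f n)" and H: "integrable M H" "\<And>n. AE x in M. norm (f n x) \<le> H x"
  shows "seq_mnc d (\<lambda>n. strong_integral M (f n)) \<le> (\<integral>\<^sup>+x. seq_mnc d (\<lambda>n. f n x) \<partial>M)"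
proof -
  let ?u = "\<lambda>m x. limsup (\<lambda>n. ennreal (cone_gauge d m (f n x)))"
  have [measurable]: "(\<lambda>x. ennreal (cone_gauge d m (f n x))) \<in> borel_measurable M" for m n
    using borel_measurable_cone_gauge[OF f] by measurable
  have [measurable]: "H \<in> borel_measurable M" using H by auto
  have le: "AE x in M. ennreal (cone_gauge d m (f n x)) \<le> ennreal (H x)" for m n
    using H(2)[of n]
    by eventually_elim (meson ennreal_leI order_trans sublinear_below_norm.le_norm sublinear_below_norm_cone_gauge)
  have Hfin: "(\<integral>\<^sup>+x. ennreal (H x) \<partial>M) < \<infinity>"
  proof -
    have "(\<integral>\<^sup>+x. ennreal (H x) \<partial>M) \<le> (\<integral>\<^sup>+x. ennreal (norm (H x)) \<partial>M)"
      by (intro nn_integral_mono ennreal_leI) auto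
    also have "\<dots> < \<infinity>" using H(1) by (simp add: integrable_iff_bounded)
    finally show ?thesis .
  qed
  have 1: "limsup (\<lambda>n. ennreal (cone_gauge d m (strong_integral M (f n)))) \<le> (\<integral>\<^sup>+x. ?u m x \<partial>M)" for m
  proof -
    have "limsup (\<lambda>n. ennreal (cone_gauge d m (strong_integral M (f n))))
        \<le> limsup (\<lambda>n. \<integral>\<^sup>+x. ennreal (cone_gauge d m (f n x)) \<partial>M)"
      by (intro Limsup_mono always_eventually allI sublinear_has_strong_integral_le
          sublinear_below_norm_cone_gauge has_strong_integral_strong_integral strongly_integrable_bound[OF f H])
    \<comment> \<open>Reverse Fatou: the gauge is below the norm, and the norms are below the
      integrable \<open>H\<close>.\<close>
    also have "\<dots> \<le> (\<integral>\<^sup>+x. ?u m x \<partial>M)"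
      by (rule nn_integral_limsup[where w = "\<lambda>x. ennreal (H x)"]) (use Hfin in \<open>auto intro!: le\<close>)
    finally show ?thesis .
  qed
  have "seq_mnc d (\<lambda>n. strong_integral M (f n)) \<le> (INF m. \<integral>\<^sup>+x. ?u m x \<partial>M)"
    unfolding seq_mnc_def by (intro INF_mono) (use 1 in blast)
  \<comment> \<open>Monotone convergence downwards: the upper limits decrease in \<open>m\<close>,
    and the integral for \<open>m = 0\<close> is finite.\<close>
  also have "\<dots> = (\<integral>\<^sup>+x. (INF m. ?u m x) \<partial>M)"
  proof (rule nn_integral_monotone_convergence_INF_AE'[symmetric])
    show "AE x in M. ?u (Suc i) x \<le> ?u i x" for i
      by (intro AE_I2 Limsup_mono always_eventually allI ennreal_leI cone_gauge_Suc_le)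
    have "AE x in M. \<forall>n. ennreal (cone_gauge d 0 (f n x)) \<le> ennreal (H x)"
      using le by (simp add: AE_all_countable)
    then have "(\<integral>\<^sup>+x. ?u 0 x \<partial>M) \<le> (\<integral>\<^sup>+x. ennreal (H x) \<partial>M)"
      by (intro nn_integral_mono_AE) (auto elim!: eventually_mono intro!: Limsup_bounded)
    then show "(\<integral>\<^sup>+x. ?u 0 x \<partial>M) < \<infinity>" using Hfin by (rule order_le_less_trans)
  qed auto
  finally show ?thesis unfolding seq_mnc_def .
qed

section \<open>Integral inequalities and invariant separable subspaces\<close>

lemma powr_Young_scaled:
  fixes a b :: real
  assumes "1 < q" "1 < r" "1 / q + 1 / r = 1" "0 \<le> a" "0 \<le> b" "0 < A" "0 < B"
  shows "a * b \<le> A powr (1 / r) * B powr (1 / q) * (a powr r / (r * A) + b powr q / (q * B))"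
proof -
  have "(a / A powr (1 / r)) * (b / B powr (1 / q))
      \<le> (a / A powr (1 / r)) powr r / r + (b / B powr (1 / q)) powr q / q"
    using assms by (intro Youngs_inequality) auto
  also have "(a / A powr (1 / r)) powr r = a powr r / A"
    using assms by (simp add: powr_divide powr_powr)
  also have "(b / B powr (1 / q)) powr q = b powr q / B"
    using assms by (simp add: powr_divide powr_powr)
  finally have "a * b / (A powr (1 / r) * B powr (1 / q)) \<le> a powr r / (r * A) + b powr q / (q * B)"
    by (simp add: mult.commute)
  then show ?thesis
    using assms by (simp add: pos_divide_le_eq mult.commute)
qed

text \<open>For finite \<open>r\<close> Young's inequality is applied after division by the two
  norms, so that the integrated right side is \<open>1/r + 1/q = 1\<close>. For
  \<open>r = \<infinity>\<close> the relation of the exponents forces \<open>q = 1\<close>. The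
  absolute value around \<open>Lp_norm\<close> spares a discussion of the sign of the essential
  supremum.\<close>

lemma (in complete_measure) Lp_space_Holder:
  fixes f :: "'a \<Rightarrow> 'b::real_normed_vector" and \<phi> :: "'a \<Rightarrow> real" and q :: real and r :: ereal
  assumes q: "1 \<le> q" and r: "1 < r" "1 / ereal q + 1 / r = 1" and f: "f \<in> Lp_space r M"
    and \<phi>: "\<phi> \<in> borel_measurable M" "\<And>x. 0 \<le> \<phi> x" "integrable M (\<lambda>x. \<phi> x powr q)"
  shows "integrable M (\<lambda>x. norm (f x) * \<phi> x)"
    and "(\<integral>x. norm (f x) * \<phi> x \<partial>M) \<le> \<bar>Lp_norm r M f\<bar> * (\<integral>x. \<phi> x powr q \<partial>M) powr (1 / q)"
proof -
  have fm: "strongly_measurable M f" using f by (simp add: Lp_space_def)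
  have [measurable]: "(\<lambda>x. norm (f x)) \<in> borel_measurable M" by (rule borel_measurable_strong_norm[OF fm])
  note [measurable] = \<phi>(1)
  have "integrable M (\<lambda>x. norm (f x) * \<phi> x) \<and>
    (\<integral>x. norm (f x) * \<phi> x \<partial>M) \<le> \<bar>Lp_norm r M f\<bar> * (\<integral>x. \<phi> x powr q \<partial>M) powr (1 / q)"
  proof (cases r)
    case PInf
    have q1: "q = 1" using r(2) q PInf by (cases "q = 0") (auto simp: one_ereal_def)
    have p1: "\<phi> x powr q = \<phi> x" for x using q1 \<phi>(2) by simp
    have i\<phi>: "integrable M \<phi>" using \<phi>(3) by (simp add: p1)
    obtain C where C: "AE x in M. norm (f x) \<le> C" using f PInf by (auto simp: Lp_space_def)
    have le: "AE x in M. norm (f x) \<le> \<bar>Lp_norm r M f\<bar>"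
    proof (cases "esssup M (\<lambda>x. ereal (norm (f x)))")
      case (real s)
      have "AE x in M. ereal (norm (f x)) \<le> ereal s" using esssup_AE[of _ M] real by metis
      then show ?thesis using real PInf by (auto simp: Lp_norm_def elim!: eventually_mono)
    next
      case PInf
      have "esssup M (\<lambda>x. ereal (norm (f x))) \<le> ereal C"
        using C by (intro esssup_I) auto
      with PInf show ?thesis by simp
    next
      case MInf
      have "AE x in M. ereal (norm (f x)) \<le> -\<infinity>" using esssup_AE[of "\<lambda>x. ereal (norm (f x))" M] MInf by metis
      then show ?thesis by (auto elim!: eventually_mono)
    qed
    have le': "AE x in M. norm (f x) * \<phi> x \<le> \<bar>Lp_norm r M f\<bar> * \<phi> x"
      using le by eventually_elim (auto intro!: mult_right_mono \<phi>)
    have i: "integrable M (\<lambda>x. norm (f x) * \<phi> x)"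
      by (rule Bochner_Integration.integrable_bound[of M "\<lambda>x. \<bar>Lp_norm r M f\<bar> * \<phi> x"])
        (use le' i\<phi> \<phi>(2) in \<open>auto elim!: eventually_mono simp: abs_mult\<close>)
    have "(\<integral>x. norm (f x) * \<phi> x \<partial>M) \<le> (\<integral>x. \<bar>Lp_norm r M f\<bar> * \<phi> x \<partial>M)"
      using i i\<phi> le' by (intro integral_mono_AE) auto
    moreover have "0 \<le> (\<integral>x. \<phi> x \<partial>M)" using \<phi>(2) by (intro integral_nonneg_AE) auto
    ultimately show ?thesis using i q1 by (simp add: \<phi>(2))
  next
    case (real s)
    have s1: "1 < s" using r(1) real by simp
    have qs: "1 / q + 1 / s = 1" using r(2) real q s1 by (simp add: one_ereal_def)
    have q1: "1 < q"
    proof -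
      have "0 < 1 / s" using s1 by simp
      then have "1 / q < 1" using qs by linarith
      then show ?thesis using q by (simp add: field_simps)
    qed
    have fi: "integrable M (\<lambda>x. norm (f x) powr s)" using f real by (simp add: Lp_space_def)
    define A where "A = (\<integral>x. norm (f x) powr s \<partial>M)"
    define B where "B = (\<integral>x. \<phi> x powr q \<partial>M)"
    have AB: "0 \<le> A" "0 \<le> B" by (auto simp: A_def B_def intro!: integral_nonneg_AE)
    have N: "Lp_norm r M f = A powr (1 / s)" using real by (simp add: Lp_norm_def A_def)
    have i: "integrable M (\<lambda>x. norm (f x) * \<phi> x)"
      by (rule Bochner_Integration.integrable_bound[of M "\<lambda>x. norm (f x) powr s / s + \<phi> x powr q / q"])
        (use fi \<phi>(2,3) Youngs_inequality[OF s1 q1 qs[unfolded add.commute[of "1 / q"]]] in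
          \<open>auto simp: abs_mult intro!: AE_I2 order_trans[OF _ abs_ge_self]\<close>)
    have "(\<integral>x. norm (f x) * \<phi> x \<partial>M) \<le> A powr (1 / s) * B powr (1 / q)"
    \<comment> \<open>Division by the norms requires both to be positive; otherwise the product
      vanishes almost everywhere.\<close>
    proof (cases "A = 0 \<or> B = 0")
      case True
      have "AE x in M. norm (f x) * \<phi> x = 0"
        using True
      proof
        assume "A = 0"
        then have "AE x in M. norm (f x) powr s = 0"
          using integral_nonneg_eq_0_iff_AE[OF fi] by (auto simp: A_def)
        then show ?thesis by eventually_elim auto
      next
        assume "B = 0"
        then have "AE x in M. \<phi> x powr q = 0"
          using integral_nonneg_eq_0_iff_AE[OF \<phi>(3)] by (auto simp: B_def)
        then show ?thesis by eventually_elim auto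
      qed
      then have "(\<integral>x. norm (f x) * \<phi> x \<partial>M) = 0" by (rule integral_eq_zero_AE)
      then show ?thesis by simp
    next
      case False
      with AB have pos: "0 < A" "0 < B" by auto
      have "(\<integral>x. norm (f x) * \<phi> x \<partial>M)
          \<le> (\<integral>x. A powr (1 / s) * B powr (1 / q) * (norm (f x) powr s / (s * A) + \<phi> x powr q / (q * B)) \<partial>M)"
        using i fi \<phi>(3) powr_Young_scaled[OF q1 s1 qs _ \<phi>(2) pos]
        by (intro integral_mono) auto
      also have "\<dots> = A powr (1 / s) * B powr (1 / q) * (A / (s * A) + B / (q * B))"
        using fi \<phi>(3) by (simp add: A_def B_def)
      also have "A / (s * A) + B / (q * B) = 1" using pos qs by (simp add: add.commute)
      finally show ?thesis by simp
    qed
    then show ?thesis using i N by (simp add: B_def)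
  next
    case MInf
    then show ?thesis using r by simp
  qed
  then show "integrable M (\<lambda>x. norm (f x) * \<phi> x)"
    "(\<integral>x. norm (f x) * \<phi> x \<partial>M) \<le> \<bar>Lp_norm r M f\<bar> * (\<integral>x. \<phi> x powr q \<partial>M) powr (1 / q)" by auto
qed

text \<open>If one argument is zero, the claim reduces to \<open>s powr p \<le> s\<close> for
  \<open>0 < s < 1\<close>; otherwise it is convexity of the power.\<close>

lemma powr_convex_combination_le:
  fixes u v s t p :: real
  assumes "1 \<le> p" "0 \<le> u" "0 \<le> v" "0 < s" "0 < t" "s + t = 1"
  shows "(s * u + t * v) powr p \<le> s * u powr p + t * v powr p"
proof -
  have le: "a powr p \<le> a" if "0 < a" "a < 1" for a
    using powr_mono'[of 1 p a] that assms(1) by simp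
  consider "u = 0" | "v = 0" | "0 < u" "0 < v" using assms by force
  then show ?thesis
  proof cases
    case 1
    then show ?thesis using le[of t] assms by (simp add: powr_mult mult_right_mono)
  next
    case 2
    then show ?thesis using le[of s] assms by (simp add: powr_mult mult_right_mono)
  next
    case 3
    then show ?thesis using convex_onD[OF powr_convex[OF assms(1)], of t u v] assms
      by (simp add: eq_diff_eq[symmetric])
  qed
qed

text \<open>Up to the factor \<open>a + b\<close>, \<open>f + g\<close> is a convex combination of
  \<open>f / a\<close> and \<open>g / b\<close>. For \<open>a\<close> and \<open>b\<close> just
  above the two norms, convexity of the power bounds the integral by
  \<open>(a + b) powr p\<close>.\<close>

lemma powr_norm_Minkowski:
  fixes f g :: "'a \<Rightarrow> real"
  assumes p: "1 \<le> p" and [measurable]: "f \<in> borel_measurable M" "g \<in> borel_measurable M"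
    and nonneg: "\<And>x. 0 \<le> f x" "\<And>x. 0 \<le> g x"
    and int: "integrable M (\<lambda>x. f x powr p)" "integrable M (\<lambda>x. g x powr p)"
  shows "integrable M (\<lambda>x. (f x + g x) powr p)"
    and "(\<integral>x. (f x + g x) powr p \<partial>M) powr (1 / p)
      \<le> (\<integral>x. f x powr p \<partial>M) powr (1 / p) + (\<integral>x. g x powr p \<partial>M) powr (1 / p)"
proof -
  define A where "A = (\<integral>x. f x powr p \<partial>M) powr (1 / p)"
  define B where "B = (\<integral>x. g x powr p \<partial>M) powr (1 / p)"
  have AB: "0 \<le> A" "0 \<le> B" by (auto simp: A_def B_def)
  have Ap: "(\<integral>x. f x powr p \<partial>M) = A powr p" "(\<integral>x. g x powr p \<partial>M) = B powr p"
    using p by (auto simp: A_def B_def powr_powr intro: integral_nonneg_AE)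
  have bound: "(f x + g x) powr p \<le> (a + b) powr p * (a / (a + b) * (f x powr p / a powr p)
      + b / (a + b) * (g x powr p / b powr p))" if "0 < a" "0 < b" for a b x
  proof -
    have "f x + g x = (a + b) * (a / (a + b) * (f x / a) + b / (a + b) * (g x / b))"
      using that by (simp add: distrib_left)
    then have "(f x + g x) powr p = (a + b) powr p * (a / (a + b) * (f x / a) + b / (a + b) * (g x / b)) powr p"
      using that nonneg by (simp add: powr_mult)
    also have "\<dots> \<le> (a + b) powr p * (a / (a + b) * (f x / a) powr p + b / (a + b) * (g x / b) powr p)"
      using that nonneg p by (intro mult_left_mono powr_convex_combination_le)
        (auto simp: add_divide_distrib[symmetric])
    finally show ?thesis using that nonneg by (simp add: powr_divide)
  qed
  show i: "integrable M (\<lambda>x. (f x + g x) powr p)"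
    by (rule Bochner_Integration.integrable_bound[of M "\<lambda>x. (1 + 1) powr p * (1 / (1 + 1) * (f x powr p / 1 powr p)
      + 1 / (1 + 1) * (g x powr p / 1 powr p))"])
      (use int bound[of 1 1] in \<open>auto intro!: AE_I2 order_trans[OF _ abs_ge_self]\<close>)
  have "(\<integral>x. (f x + g x) powr p \<partial>M) powr (1 / p) \<le> A + B"
  proof (rule field_le_epsilon)
    fix e :: real assume e: "0 < e"
    \<comment> \<open>The added \<open>e / 2\<close> keeps the divisors positive even if a norm
      vanishes.\<close>
    define a where "a = A + e / 2"
    define b where "b = B + e / 2"
    have ab: "0 < a" "0 < b" "A \<le> a" "B \<le> b" using AB e by (auto simp: a_def b_def)
    have "(\<integral>x. (f x + g x) powr p \<partial>M) \<le> (\<integral>x. (a + b) powr p * (a / (a + b) * (f x powr p / a powr p)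
      + b / (a + b) * (g x powr p / b powr p)) \<partial>M)"
      using i int bound[OF ab(1,2)] by (intro integral_mono) auto
    also have "\<dots> = (a + b) powr p * (a / (a + b) * (A powr p / a powr p) + b / (a + b) * (B powr p / b powr p))"
      using int by (simp add: Ap)
    also have "\<dots> \<le> (a + b) powr p * (a / (a + b) * 1 + b / (a + b) * 1)"
      using ab AB p by (intro mult_left_mono add_mono divide_le_eq_1_pos[THEN iffD2] powr_mono2) auto
    also have "\<dots> = (a + b) powr p" using ab by (simp add: add_divide_distrib[symmetric])
    finally have "(\<integral>x. (f x + g x) powr p \<partial>M) powr (1 / p) \<le> ((a + b) powr p) powr (1 / p)"
      using p by (intro powr_mono2) (auto intro: integral_nonneg_AE)
    also have "\<dots> = A + B + e" using p ab by (simp add: powr_powr a_def b_def)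
    finally show "(\<integral>x. (f x + g x) powr p \<partial>M) powr (1 / p) \<le> A + B + e" .
  qed
  then show "(\<integral>x. (f x + g x) powr p \<partial>M) powr (1 / p)
      \<le> (\<integral>x. f x powr p \<partial>M) powr (1 / p) + (\<integral>x. g x powr p \<partial>M) powr (1 / p)"
    by (simp add: A_def B_def)
qed

section \<open>Absolute continuity and a Gronwall inequality\<close>

lemma integral_absolutely_continuous:
  fixes \<phi> :: "'a \<Rightarrow> real"
  assumes \<phi>: "integrable M \<phi>" "\<And>x. 0 \<le> \<phi> x" and e: "0 < e" and fin: "finite_measure M"
  obtains \<delta> where "0 < \<delta>"
    "\<And>A. A \<in> sets M \<Longrightarrow> measure M A \<le> \<delta> \<Longrightarrow> (\<integral>x. indicator A x * \<phi> x \<partial>M) < e"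
proof -
  interpret finite_measure M by fact
  have [measurable]: "\<phi> \<in> borel_measurable M" using \<phi> by auto
  have "(\<lambda>n. \<integral>x. \<phi> x - min (\<phi> x) (real n) \<partial>M) \<longlonglongrightarrow> (\<integral>x. 0 \<partial>M)"
  proof (rule integral_dominated_convergence[where w = \<phi>])
    show "AE x in M. (\<lambda>n. \<phi> x - min (\<phi> x) (real n)) \<longlonglongrightarrow> 0"
    proof (rule AE_I2)
      fix x
      obtain N :: nat where "\<phi> x \<le> real N" using real_arch_simple by blast
      then have "eventually (\<lambda>n. 0 = \<phi> x - min (\<phi> x) (real n)) sequentially"
        by (auto simp: eventually_sequentially intro!: exI[of _ N])
      then show "(\<lambda>n. \<phi> x - min (\<phi> x) (real n)) \<longlonglongrightarrow> 0"
        by (rule Lim_transform_eventually[rotated]) simp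
    qed
  qed (use \<phi> in auto)
  then have "eventually (\<lambda>n. (\<integral>x. \<phi> x - min (\<phi> x) (real n) \<partial>M) < e / 2) sequentially"
    using e by (auto dest: order_tendstoD(2)[where a = "e / 2"])
  then obtain n where n: "(\<integral>x. \<phi> x - min (\<phi> x) (real n) \<partial>M) < e / 2"
    by (auto simp: eventually_sequentially)
  have im: "integrable M (\<lambda>x. min (\<phi> x) (real n))"
    by (rule Bochner_Integration.integrable_bound[OF \<phi>(1)]) (use \<phi>(2) in auto)
  \<comment> \<open>Cutting \<open>\<phi>\<close> at height \<open>n\<close> leaves less than
    \<open>e / 2\<close> above the cut, and \<open>real n * \<delta> \<le> e / 2\<close> below it.
    The summand 1 avoids division by zero.\<close>
  define \<delta> where "\<delta> = e / (2 * (real n + 1))"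
  show thesis
  proof (rule that[of \<delta>])
    show "0 < \<delta>" using e by (simp add: \<delta>_def)
    fix A assume A[measurable]: "A \<in> sets M" "measure M A \<le> \<delta>"
    have i1: "integrable M (\<lambda>x. indicator A x * \<phi> x)"
      using integrable_mult_indicator[OF A(1) \<phi>(1)] by simp
    have i2: "integrable M (\<lambda>x. real n * indicator A x)"
      using A emeasure_finite by (intro integrable_mult_right integrable_real_indicator) (auto simp: less_top[symmetric])
    have "(\<integral>x. indicator A x * \<phi> x \<partial>M) \<le> (\<integral>x. (\<phi> x - min (\<phi> x) (real n)) + real n * indicator A x \<partial>M)"
      using i1 i2 \<phi> im by (intro integral_mono) (auto simp: indicator_def min_def)
    also have "\<dots> = (\<integral>x. \<phi> x - min (\<phi> x) (real n) \<partial>M) + real n * measure M A"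
      using i2 \<phi>(1) im A sets.sets_into_space[OF A(1)] by (simp add: Int_absorb2)
    also have "real n * measure M A \<le> real n * \<delta>" using A by (intro mult_left_mono) auto
    also have "real n * \<delta> \<le> e / 2" using e by (simp add: \<delta>_def field_simps)
    finally show "(\<integral>x. indicator A x * \<phi> x \<partial>M) < e" using n by simp
  qed
qed

lemma measure_lebesgue_on_window_le:
  fixes s t T :: real
  assumes "s \<le> t"
  shows "{s..t} \<inter> {0..T} \<in> sets (lebesgue_on {0..T})"
    "measure (lebesgue_on {0..T}) ({s..t} \<inter> {0..T}) \<le> t - s"
proof -
  show 1: "{s..t} \<inter> {0..T} \<in> sets (lebesgue_on {0..T})" by (auto simp: sets_restrict_space)
  have "measure (lebesgue_on {0..T}) ({s..t} \<inter> {0..T}) = measure lebesgue ({s..t} \<inter> {0..T})"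
    by (rule measure_restrict_space) auto
  also have "\<dots> \<le> measure lebesgue {s..t}" by (rule measure_mono_fmeasurable) auto
  also have "\<dots> = t - s" using assms by simp
  finally show "measure (lebesgue_on {0..T}) ({s..t} \<inter> {0..T}) \<le> t - s" .
qed

lemma finite_complete_measure_lebesgue_on:
  "finite_complete_measure (lebesgue_on {a..b::real})"
proof -
  have "complete_measure (lebesgue_on {a..b})"
  proof
    fix A B assume "B \<subseteq> A" "A \<in> null_sets (lebesgue_on {a..b})"
    then show "B \<in> sets (lebesgue_on {a..b})"
      using complete_measure.complete2[OF completion.complete_measure_axioms, of B A] by (auto simp: null_sets_restrict_space sets_restrict_space)
  qed
  moreover have "finite_measure (lebesgue_on {a..b})"
    by (rule finite_measure_lebesgue_on) auto
  ultimately show ?thesis by (simp add: finite_complete_measure_def)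
qed

lemma integral_small_on_windows:
  fixes \<phi> :: "real \<Rightarrow> real"
  assumes \<phi>: "integrable (lebesgue_on {0..T}) \<phi>" "\<And>x. 0 \<le> \<phi> x" and e: "0 < e"
  obtains \<delta> where "0 < \<delta>"
    "\<And>s t. t - s \<le> \<delta> \<Longrightarrow> (\<integral>x. indicator {s..t} x * \<phi> x \<partial>lebesgue_on {0..T}) < e"
proof -
  interpret finite_complete_measure "lebesgue_on {0..T}" by (rule finite_complete_measure_lebesgue_on)
  obtain \<delta> where \<delta>: "0 < \<delta>" "\<And>A. A \<in> sets (lebesgue_on {0..T}) \<Longrightarrow> measure (lebesgue_on {0..T}) A \<le> \<delta>
     \<Longrightarrow> (\<integral>x. indicator A x * \<phi> x \<partial>lebesgue_on {0..T}) < e"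
    using integral_absolutely_continuous[OF \<phi> e finite_measure_axioms] by blast
  show thesis
  proof (rule that[OF \<delta>(1)])
    fix s t assume st: "t - s \<le> \<delta>"
    show "(\<integral>x. indicator {s..t} x * \<phi> x \<partial>lebesgue_on {0..T}) < e"
    proof (cases "s \<le> t")
      case True
      have "(\<integral>x. indicator ({s..t} \<inter> {0..T}) x * \<phi> x \<partial>lebesgue_on {0..T}) < e"
        using measure_lebesgue_on_window_le[OF True, of T] st by (intro \<delta>(2)) auto
      also have "(\<integral>x. indicator ({s..t} \<inter> {0..T}) x * \<phi> x \<partial>lebesgue_on {0..T})
          = (\<integral>x. indicator {s..t} x * \<phi> x \<partial>lebesgue_on {0..T})"
        by (intro Bochner_Integration.integral_cong) (auto simp: indicator_def)
      finally show ?thesis .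
    qed (use e in auto)
  qed
qed

text \<open>The interval is cut into blocks on which \<open>a\<close> has integral below 1/2. If
  \<open>z\<close> vanishes before a block, then \<open>z \<le> a * Z\<close> on it, where
  \<open>Z\<close> is the integral of \<open>z\<close> up to the end of the block; integrating gives
  \<open>Z \<le> Z / 2\<close>.\<close>

lemma AE_eq_0_if_Volterra_bound:
  fixes z a :: "real \<Rightarrow> real" and T :: real
  defines "M \<equiv> lebesgue_on {0..T}"
  assumes z: "integrable M z" "\<And>t. 0 \<le> z t" and a: "integrable M a" "\<And>t. 0 \<le> a t"
    and le: "AE t in M. z t \<le> a t * (\<integral>s. indicator {..t} s * z s \<partial>M)"
  shows "AE t in M. z t = 0"
proof -
  have [measurable]: "z \<in> borel_measurable M" "a \<in> borel_measurable M" using z a by auto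
  have sp: "space M = {0..T}" by (simp add: M_def)
  have meas: "A \<inter> {0..T} \<in> sets M" if "A \<in> sets borel" for A
  proof -
    have "A \<in> sets lebesgue" using that by simp
    then show ?thesis unfolding M_def sets_restrict_space by (rule image_eqI[rotated]) (rule Int_commute)
  qed
  have ind: "integrable M (\<lambda>s. indicator A s * f s)" if "A \<in> sets borel" "integrable M f" for A and f :: "real \<Rightarrow> real"
  proof -
    have "integrable M (\<lambda>s. indicator (A \<inter> {0..T}) s * f s)"
      using integrable_mult_indicator[OF meas[OF that(1)] that(2)] by simp
    then show ?thesis
      by (rule Bochner_Integration.integrable_cong[THEN iffD1, rotated 2]) (auto simp: sp indicator_def)
  qed
  obtain \<delta> where \<delta>: "0 < \<delta>" "\<And>s t. t - s \<le> \<delta> \<Longrightarrow> (\<integral>x. indicator {s..t} x * a x \<partial>M) < 1 / 2"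
    using integral_small_on_windows[of T a "1 / 2"] a unfolding M_def by auto
  have zero: "(\<integral>s. indicator {..<real n * \<delta>} s * z s \<partial>M) = 0" for n
  proof (induction n)
    case 0
    have "(\<integral>s. indicator {..<real 0 * \<delta>} s * z s \<partial>M) = (\<integral>s. 0 \<partial>M)"
      by (intro Bochner_Integration.integral_cong) (auto simp: sp)
    then show ?case by simp
  next
    case (Suc n)
    let ?c = "real n * \<delta>" and ?c' = "real (Suc n) * \<delta>"
    define Z where "Z = (\<integral>s. indicator {..<?c'} s * z s \<partial>M)"
    have Z0: "0 \<le> Z" unfolding Z_def using z by (intro integral_nonneg_AE) auto
    have "AE s in M. indicator {..<?c} s * z s = 0"
      using Suc z by (subst (asm) integral_nonneg_eq_0_iff_AE) (auto intro!: ind)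
    then have "AE s in M. indicator {..<?c'} s * z s \<le> indicator {?c..?c'} s * a s * Z"
      using le
    proof (eventually_elim)
      case (elim t)
      show ?case
      proof (cases "?c \<le> t \<and> t < ?c'")
        case True
        have "(\<integral>s. indicator {..t} s * z s \<partial>M) \<le> Z"
          unfolding Z_def using z True by (intro integral_mono ind mult_right_mono) (auto simp: indicator_def)
        then have "a t * (\<integral>s. indicator {..t} s * z s \<partial>M) \<le> a t * Z" using a by (intro mult_left_mono) auto
        with elim(2) True show ?thesis by simp
      next
        case False
        then consider "t < ?c" | "?c' \<le> t" by linarith
        then show ?thesis
        proof cases
          case 1
          then have "z t = 0" using elim by simp
          then show ?thesis using a Z0 by simp
        next
          case 2
          then show ?thesis using a Z0 by simp
        qed
      qed
    qed
    then have "Z \<le> (\<integral>s. indicator {?c..?c'} s * a s * Z \<partial>M)"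
      unfolding Z_def by (intro integral_mono_AE) (auto intro!: ind z a)
    also have "\<dots> = (\<integral>s. indicator {?c..?c'} s * a s \<partial>M) * Z" by simp
    also have "\<dots> \<le> (1 / 2) * Z"
      using \<delta>(2)[of ?c' ?c] Z0 by (intro mult_right_mono) (auto simp: algebra_simps)
    finally have "Z = 0" using Z0 by simp
    then show ?case by (simp add: Z_def)
  qed
  obtain n :: nat where n: "T < real n * \<delta>" using reals_Archimedean3[OF \<delta>(1)] by blast
  have "(\<integral>s. indicator {..<real n * \<delta>} s * z s \<partial>M) = (\<integral>s. z s \<partial>M)"
    using n by (intro Bochner_Integration.integral_cong) (auto simp: sp indicator_def)
  then have "(\<integral>s. z s \<partial>M) = 0" using zero by simp
  then show ?thesis using z by (subst (asm) integral_nonneg_eq_0_iff_AE) auto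
qed

text \<open>Closing in stages under sums, rational multiples and the given operators preserves
  countability. The closure then admits real scalars, and it is invariant by continuity.\<close>

lemma countable_dense_invariant_subspace:
  fixes S :: "'b::real_normed_vector set" and \<A> :: "('b \<Rightarrow>\<^sub>L 'b) set"
  assumes S: "countable S" and \<A>: "countable \<A>"
  obtains d :: "nat \<Rightarrow> 'b" where "subspace (closure (range d))" "S \<subseteq> closure (range d)"
    "\<And>A x. A \<in> \<A> \<Longrightarrow> x \<in> closure (range d) \<Longrightarrow> A x \<in> closure (range d)"
proof -
  define step where "step X = X \<union> (\<lambda>(x, y). x + y) ` (X \<times> X) \<union> (\<lambda>(c::real, x). c *\<^sub>R x) ` (\<rat> \<times> X)
    \<union> (\<lambda>(A, x). blinfun_apply A x) ` (\<A> \<times> X)" for X :: "'b set"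
  define D where "D = (\<Union>n. (step ^^ n) (insert 0 S))"
  have "countable ((step ^^ n) (insert 0 S))" for n
    by (induction n) (auto simp: step_def S \<A> countable_rat)
  then have cD: "countable D" by (auto simp: D_def)
  have sub: "insert 0 S \<subseteq> D" using UN_upper[of 0 UNIV "\<lambda>n. (step ^^ n) (insert 0 S)"] by (simp add: D_def)
  have mono: "(step ^^ m) X \<subseteq> (step ^^ n) X" if "m \<le> n" for m n X
    using that by (induction n rule: dec_induct) (auto simp: step_def)
  have D1: "x \<in> D \<Longrightarrow> y \<in> D \<Longrightarrow> x + y \<in> D" for x y
  proof -
    assume "x \<in> D" "y \<in> D"
    then obtain m n where "x \<in> (step ^^ m) (insert 0 S)" "y \<in> (step ^^ n) (insert 0 S)" by (auto simp: D_def)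
    then have "x \<in> (step ^^ max m n) (insert 0 S)" "y \<in> (step ^^ max m n) (insert 0 S)"
      using mono[of m "max m n"] mono[of n "max m n"] by auto
    then have "x + y \<in> (step ^^ Suc (max m n)) (insert 0 S)" by (auto simp: step_def)
    then show "x + y \<in> D" unfolding D_def by blast
  qed
  have D2: "c *\<^sub>R x \<in> D" if that': "c \<in> \<rat>" "x \<in> D" for c x
  proof -
    obtain n where "x \<in> (step ^^ n) (insert 0 S)" using that'(2) by (auto simp: D_def)
    then have "c *\<^sub>R x \<in> (step ^^ Suc n) (insert 0 S)" using that' by (auto simp: step_def)
    then show ?thesis unfolding D_def by blast
  qed
  have D3: "A x \<in> D" if that': "A \<in> \<A>" "x \<in> D" for A x
  proof -
    obtain n where "x \<in> (step ^^ n) (insert 0 S)" using that'(2) by (auto simp: D_def)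
    then have "A x \<in> (step ^^ Suc n) (insert 0 S)" using that' by (auto simp: step_def)
    then show ?thesis unfolding D_def by blast
  qed
  have r: "range (from_nat_into D) = D" using cD sub by (intro range_from_nat_into) auto
  show thesis
  proof (rule that[of "from_nat_into D"], unfold r)
    show "S \<subseteq> closure D" using sub closure_subset[of D] by auto
    show "subspace (closure D)"
      unfolding subspace_def
    proof (intro conjI ballI allI)
      show "0 \<in> closure D" using sub closure_subset[of D] by auto
    next
      fix x y assume "x \<in> closure D" "y \<in> closure D"
      then obtain f g where "\<And>n::nat. f n \<in> D" "f \<longlonglongrightarrow> x" "\<And>n::nat. g n \<in> D" "g \<longlonglongrightarrow> y"
        unfolding closure_sequential by blast
      then show "x + y \<in> closure D" unfolding closure_sequential
        by (intro exI[of _ "\<lambda>n. f n + g n"]) (auto intro: D1 tendsto_add)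
    next
      fix c :: real and x assume "x \<in> closure D"
      moreover have "c \<in> closure \<rat>" by (simp add: Rats_closure_real)
      ultimately obtain f g where "\<And>n::nat. f n \<in> D" "f \<longlonglongrightarrow> x" "\<And>n::nat. g n \<in> \<rat>" "g \<longlonglongrightarrow> c"
        unfolding closure_sequential by blast
      then show "c *\<^sub>R x \<in> closure D" unfolding closure_sequential
        by (intro exI[of _ "\<lambda>n. g n *\<^sub>R f n"]) (auto intro: D2 tendsto_scaleR)
    qed
    fix A x assume A: "A \<in> \<A>" and "x \<in> closure D"
    then obtain f where "\<And>n::nat. f n \<in> D" "f \<longlonglongrightarrow> x"
      unfolding closure_sequential by blast
    then show "A x \<in> closure D" unfolding closure_sequential
      by (intro exI[of _ "\<lambda>n. A (f n)"]) (auto intro: D3[OF A] tendsto_intros)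
  qed
qed

lemma separable_space_closure_range:
  fixes d :: "nat \<Rightarrow> 'b::metric_space"
  shows "separable_space (top_of_set (closure (range d)))"
  unfolding separable_space_def
  by (intro exI[of _ "range d"])
    (auto simp: closure_of_subtopology closure_subset Int_absorb1 subsetD[OF closure_subset])

section \<open>Almost everywhere convergent convex combinations\<close>

text \<open>The combinations are formed on functions, with the same coefficients at every point, so
  they commute with integration. Midpoints suffice because the strict convexity argument compares
  two elements with their midpoint, and they turn every closure property into an induction with one
  step.\<close>

inductive_set midpoint_closure :: "('a \<Rightarrow> 'b::real_vector) set \<Rightarrow> ('a \<Rightarrow> 'b) set"
  for W where
  base: "w \<in> W \<Longrightarrow> w \<in> midpoint_closure W"
| midpoint: "u \<in> midpoint_closure W \<Longrightarrow> v \<in> midpoint_closure W \<Longrightarrow>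
    (\<lambda>x. (1 / 2) *\<^sub>R (u x + v x)) \<in> midpoint_closure W"

lemma convex_midpoint: "convex C \<Longrightarrow> a \<in> C \<Longrightarrow> b \<in> C \<Longrightarrow> (1 / 2) *\<^sub>R (a + b) \<in> C"
  using convexD[of C a b "1/2" "1/2"] by (simp add: scaleR_add_right)

lemma midpoint_closure_in_convex:
  assumes "g \<in> midpoint_closure W" "convex C" "\<And>w. w \<in> W \<Longrightarrow> w x \<in> C"
  shows "g x \<in> C"
  using assms(1) by induction (auto intro: assms convex_midpoint)

lemma midpoint_closure_mono: "V \<subseteq> W \<Longrightarrow> midpoint_closure V \<subseteq> midpoint_closure W"
proof
  fix g assume V: "V \<subseteq> W" and "g \<in> midpoint_closure V"
  from this(2) show "g \<in> midpoint_closure W"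
    by induction (use V in \<open>auto intro: midpoint_closure.intros\<close>)
qed

lemma strongly_measurable_midpoint_closure:
  assumes "g \<in> midpoint_closure W" "\<And>w. w \<in> W \<Longrightarrow> strongly_measurable M w"
  shows "strongly_measurable M g"
  using assms(1)
  by induction (auto intro: assms(2) intro!: strongly_measurable_scaleR strongly_measurable_const strongly_measurable_add)

text \<open>Sublevel sets of a gauge are convex, hence midpoints from a tail stay below the supremum
  over that tail.\<close>

lemma seq_mnc_midpoint_closure_le:
  assumes "\<And>k. g k \<in> midpoint_closure (w ` {k..})"
  shows "seq_mnc d (\<lambda>k. g k x) \<le> seq_mnc d (\<lambda>n. w n x)"
  unfolding seq_mnc_def limsup_INF_SUP
proof (intro INF_mono bexI)
  fix m n
  interpret sublinear_below_norm "cone_gauge d m" by (rule sublinear_below_norm_cone_gauge)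
  let ?S = "SUP n\<in>{n..}. ennreal (cone_gauge d m (w n x))"
  have "convex {v. ennreal (cone_gauge d m v) \<le> ?S}"
  proof (rule convexI)
    fix u v :: 'b and s t :: real
    assume uv: "u \<in> {v. ennreal (cone_gauge d m v) \<le> ?S}" "v \<in> {v. ennreal (cone_gauge d m v) \<le> ?S}"
      and st: "0 \<le> s" "0 \<le> t" "s + t = 1"
    have "cone_gauge d m (s *\<^sub>R u + t *\<^sub>R v) \<le> s * cone_gauge d m u + t * cone_gauge d m v"
      using subadd[of "s *\<^sub>R u" "t *\<^sub>R v"] pos_hom st by simp
    also have "\<dots> \<le> max (cone_gauge d m u) (cone_gauge d m v)"
      using st by (intro convex_bound_le) auto
    finally have "ennreal (cone_gauge d m (s *\<^sub>R u + t *\<^sub>R v))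
        \<le> ennreal (max (cone_gauge d m u) (cone_gauge d m v))" by (rule ennreal_leI)
    also have "\<dots> \<le> ?S" using uv by (auto simp: max_def)
    finally show "s *\<^sub>R u + t *\<^sub>R v \<in> {v. ennreal (cone_gauge d m v) \<le> ?S}" by simp
  qed
  then have "g k x \<in> {v. ennreal (cone_gauge d m v) \<le> ?S}" if "n \<le> k" for k
    using that by (intro midpoint_closure_in_convex[OF assms]) (auto intro: SUP_upper)
  then show "(SUP k\<in>{n..}. ennreal (cone_gauge d m (g k x))) \<le> ?S" by (intro SUP_least) auto
qed auto

text \<open>Compactness gives a cluster point. The distances of the whole sequence to a point
  \<open>d j\<close> near it converge to the distance of the cluster point, which is small, so the
  whole sequence is eventually close.\<close>

lemma convergent_if_dists_convergent:
  fixes y :: "nat \<Rightarrow> 'b::real_normed_vector"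
  assumes c: "compact (closure (range y))" and E: "range y \<subseteq> closure (range d)"
    and conv: "\<And>j. convergent (\<lambda>k. norm (y k - d j))"
  shows "convergent y"
proof -
  obtain z r where z: "strict_mono (r :: nat \<Rightarrow> nat)" "(y \<circ> r) \<longlonglongrightarrow> z"
    using c closure_subset[of "range y"] unfolding compact_def
    by (metis (no_types, lifting) range_subsetD)
  have "z \<in> closure (range d)"
    using E by (intro closed_sequentially[OF closed_closure _ z(2)]) auto
  have "y \<longlonglongrightarrow> z"
  proof (rule LIMSEQ_I)
    fix e :: real assume e: "0 < e"
    obtain j where j: "norm (z - d j) < e / 2"
      using \<open>z \<in> closure (range d)\<close> e
      by (metis closure_approachable dist_commute dist_norm half_gt_zero rangeE)
    obtain l where l: "(\<lambda>k. norm (y k - d j)) \<longlonglongrightarrow> l" using conv[of j] by (auto simp: convergent_def)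
    have "(\<lambda>k. norm ((y \<circ> r) k - d j)) \<longlonglongrightarrow> norm (z - d j)" by (intro tendsto_intros z)
    moreover have "(\<lambda>k. norm ((y \<circ> r) k - d j)) \<longlonglongrightarrow> l"
      using LIMSEQ_subseq_LIMSEQ[OF l z(1)] by (simp add: o_def)
    ultimately have "l < e / 2" using j LIMSEQ_unique by blast
    with l have "eventually (\<lambda>k. norm (y k - d j) < e / 2) sequentially" by (rule order_tendstoD)
    then obtain K where K: "\<And>k. k \<ge> K \<Longrightarrow> norm (y k - d j) < e / 2" by (auto simp: eventually_sequentially)
    show "\<exists>no. \<forall>n\<ge>no. norm (y n - z) < e"
    proof (intro exI[of _ K] allI impI)
      fix n assume "K \<le> n"
      then show "norm (y n - z) < e"
        using K[of n] j norm_triangle_ineq[of "y n - d j" "d j - z"] by (simp add: norm_minus_commute)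
    qed
  qed
  then show ?thesis by (rule convergentI)
qed

text \<open>After taking roots, consecutive differences are at most
  \<open>sqrt C * (1 / 2) ^ k\<close>, which is summable.\<close>

lemma convergent_if_sq_diffs_geometric:
  fixes a :: "nat \<Rightarrow> real"
  assumes "eventually (\<lambda>k. (a k - a (Suc k))\<^sup>2 \<le> C * (1 / 4) ^ k) sequentially"
  shows "convergent a"
proof -
  have "eventually (\<lambda>k. norm (a (Suc k) - a k) \<le> sqrt C * (1 / 2) ^ k) sequentially"
    using assms
  proof eventually_elim
    case (elim k)
    have "(1 / 4 :: real) ^ k = ((1 / 2) ^ k)\<^sup>2" by (simp add: power_mult[symmetric] mult.commute power2_eq_square power_mult_distrib[symmetric])
    then have "sqrt ((a k - a (Suc k))\<^sup>2) \<le> sqrt (C * ((1 / 2) ^ k)\<^sup>2)"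
      using elim by (intro real_sqrt_le_mono) simp
    then show ?case by (simp add: real_sqrt_mult abs_minus_commute)
  qed
  then have "summable (\<lambda>k. a (Suc k) - a k)"
    by (rule summable_comparison_test_ev) (intro summable_mult summable_geometric, simp)
  then have "(\<lambda>n. \<Sum>k<n. a (Suc k) - a k) \<longlonglongrightarrow> (\<Sum>k. a (Suc k) - a k)" by (rule summable_LIMSEQ)
  then have "(\<lambda>n. a n - a 0) \<longlonglongrightarrow> (\<Sum>k. a (Suc k) - a k)" by (simp add: sum_lessThan_telescope)
  from tendsto_add[OF this tendsto_const[of "a 0"]] show ?thesis by (auto simp: convergent_def)
qed

text \<open>Strict convexity without duality: the functional \<open>dist_gauge d G\<close> is convex, and its midpoint
  gap controls the differences of the distances to every point of the dense sequence \<open>d\<close>. The weight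
  \<open>1 + G\<close> makes it bounded where \<open>norm v \<le> G\<close>.\<close>

definition dist_ratio :: "(nat \<Rightarrow> 'b::real_normed_vector) \<Rightarrow> real \<Rightarrow> nat \<Rightarrow> 'b \<Rightarrow> real" where
  "dist_ratio d G i v = norm (v - d i) / ((1 + G) * (1 + norm (d i)))"

definition dist_gauge :: "(nat \<Rightarrow> 'b::real_normed_vector) \<Rightarrow> real \<Rightarrow> 'b \<Rightarrow> real" where
  "dist_gauge d G v = (\<Sum>i. (1 / 2) ^ i * (dist_ratio d G i v)\<^sup>2)"

lemma dist_ratio_bounds:
  assumes "norm v \<le> G"
  shows "0 \<le> dist_ratio d G i v" "dist_ratio d G i v \<le> 1"
proof -
  have G: "0 \<le> G" using assms norm_ge_zero order_trans by blast
  have "norm (v - d i) \<le> G + norm (d i)" using norm_triangle_ineq4[of v "d i"] assms by simp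
  also have "\<dots> \<le> (1 + G) * (1 + norm (d i))" using G by (simp add: algebra_simps)
  finally have "norm (v - d i) \<le> (1 + G) * (1 + norm (d i))" .
  moreover have "0 < (1 + G) * (1 + norm (d i))" using G by (intro mult_pos_pos add_pos_nonneg) auto
  ultimately show "0 \<le> dist_ratio d G i v" "dist_ratio d G i v \<le> 1"
    by (auto simp: dist_ratio_def)
qed

lemma summable_dist_gauge:
  assumes "norm v \<le> G"
  shows "summable (\<lambda>i. (1 / 2) ^ i * (dist_ratio d G i v)\<^sup>2)"
proof (rule summable_comparison_test'[of "\<lambda>i. (1 / 2) ^ i"])
  show "norm ((1 / 2) ^ i * (dist_ratio d G i v)\<^sup>2) \<le> (1 / 2) ^ i" for i
    using dist_ratio_bounds[OF assms, of d i] by (simp add: abs_mult mult_left_le power_le_one)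
qed simp

lemma dist_gauge_bounds:
  assumes "norm v \<le> G"
  shows "0 \<le> dist_gauge d G v" "dist_gauge d G v \<le> 2"
proof -
  show "0 \<le> dist_gauge d G v"
    unfolding dist_gauge_def by (intro suminf_nonneg summable_dist_gauge assms) auto
  have "dist_gauge d G v \<le> (\<Sum>i. (1 / 2) ^ i)"
    unfolding dist_gauge_def using dist_ratio_bounds[OF assms, of d]
    by (intro suminf_le summable_dist_gauge assms) (auto simp: mult_left_le power_le_one)
  then show "dist_gauge d G v \<le> 2" by (simp add: suminf_geometric)
qed

text \<open>For the real square the midpoint gap at \<open>a\<close> and \<open>b\<close> is exactly
  \<open>(a - b)^2 / 4\<close>. Convexity of the norm then makes every term of the series of gaps
  nonnegative, so its \<open>j\<close>-th term alone is a lower bound.\<close>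

lemma dist_gauge_midpoint:
  assumes u: "norm u \<le> G" and v: "norm v \<le> G"
  shows "(1 / 2) ^ j * (dist_ratio d G j u - dist_ratio d G j v)\<^sup>2 / 4
    \<le> (dist_gauge d G u + dist_gauge d G v) / 2 - dist_gauge d G ((1 / 2) *\<^sub>R (u + v))"
proof -
  let ?m = "(1 / 2) *\<^sub>R (u + v)"
  have m: "norm ?m \<le> G"
    using u v norm_triangle_ineq[of u v] by simp
  have G: "0 \<le> G" using u norm_ge_zero order_trans by blast
  define t where "t i = (1 / 2) ^ i * (((dist_ratio d G i u)\<^sup>2 + (dist_ratio d G i v)\<^sup>2) / 2 - (dist_ratio d G i ?m)\<^sup>2)" for i :: nat
  have t: "(1 / 2) ^ i * (dist_ratio d G i u - dist_ratio d G i v)\<^sup>2 / 4 \<le> t i" for i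
  proof -
    let ?a = "dist_ratio d G i u" and ?b = "dist_ratio d G i v"
    have "?m - d i = (1 / 2) *\<^sub>R ((u - d i) + (v - d i))"
      by (simp add: scaleR_add_right scaleR_diff_right scaleR_2[symmetric] algebra_simps)
    then have "norm (?m - d i) \<le> (norm (u - d i) + norm (v - d i)) / 2"
      using norm_triangle_ineq[of "u - d i" "v - d i"] by simp
    then have "dist_ratio d G i ?m \<le> ((norm (u - d i) + norm (v - d i)) / 2) / ((1 + G) * (1 + norm (d i)))"
      unfolding dist_ratio_def using G by (intro divide_right_mono) auto
    also have "\<dots> = (?a + ?b) / 2" by (simp add: dist_ratio_def add_divide_distrib mult.commute[of _ 2])
    finally have "(dist_ratio d G i ?m)\<^sup>2 \<le> ((?a + ?b) / 2)\<^sup>2"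
      using dist_ratio_bounds[OF m, of d i] by (intro power_mono)
    also have "\<dots> = (?a\<^sup>2 + ?b\<^sup>2) / 2 - (?a - ?b)\<^sup>2 / 4" by (simp add: power2_eq_square field_simps)
    finally have "(?a - ?b)\<^sup>2 / 4 \<le> (?a\<^sup>2 + ?b\<^sup>2) / 2 - (dist_ratio d G i ?m)\<^sup>2" by argo
    from mult_left_mono[OF this, of "(1 / 2) ^ i"] show ?thesis by (simp add: t_def)
  qed
  have s: "summable t" "(\<Sum>i. t i) = (dist_gauge d G u + dist_gauge d G v) / 2 - dist_gauge d G ?m"
  proof -
    have "(\<lambda>i. ((1 / 2) ^ i * (dist_ratio d G i u)\<^sup>2 + (1 / 2) ^ i * (dist_ratio d G i v)\<^sup>2) / 2
        - (1 / 2) ^ i * (dist_ratio d G i ?m)\<^sup>2)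
      sums ((dist_gauge d G u + dist_gauge d G v) / 2 - dist_gauge d G ?m)"
      unfolding dist_gauge_def
      by (intro sums_diff sums_divide sums_add summable_sums summable_dist_gauge u v m)
    also have "(\<lambda>i. ((1 / 2) ^ i * (dist_ratio d G i u)\<^sup>2 + (1 / 2) ^ i * (dist_ratio d G i v)\<^sup>2) / 2
        - (1 / 2) ^ i * (dist_ratio d G i ?m)\<^sup>2) = t"
      by (auto simp: t_def algebra_simps add_divide_distrib)
    finally show "summable t" "(\<Sum>i. t i) = (dist_gauge d G u + dist_gauge d G v) / 2 - dist_gauge d G ?m"
      by (auto simp: sums_iff)
  qed
  have "0 \<le> t i" for i by (rule order_trans[OF _ t]) simp
  then have "(\<Sum>i\<in>{j}. t i) \<le> (\<Sum>i. t i)" by (intro sum_le_suminf s) auto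
  then have "t j \<le> (dist_gauge d G u + dist_gauge d G v) / 2 - dist_gauge d G ?m" using s(2) by simp
  with t[of j] show ?thesis by (rule order_trans)
qed

text \<open>The infima of the functional over the tails increase to a limit \<open>L\<close>, and
  near-minimisers are taken in the tails. The midpoint of two consecutive ones lies in a tail whose
  infimum is still near \<open>L\<close>, so the convexity gap is small in mean. This makes the
  distances to the points \<open>d j\<close> converge, and pointwise compactness turns that into
  convergence.\<close>

lemma (in finite_complete_measure) AE_convergent_midpoint_combinations:
  fixes w :: "nat \<Rightarrow> 'a \<Rightarrow> 'b::banach" and G :: "'a \<Rightarrow> real"
  assumes E: "subspace (closure (range d))"
    and w: "\<And>n. strongly_measurable M (w n)" and G: "G \<in> borel_measurable M"
    and bound: "\<And>n. AE x in M. norm (w n x) \<le> G x"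
    and wE: "\<And>n. AE x in M. w n x \<in> closure (range d)"
    and mnc: "AE x in M. seq_mnc d (\<lambda>n. w n x) = 0"
  obtains g where "\<And>k. g k \<in> midpoint_closure (w ` {k..})" "AE x in M. convergent (\<lambda>k. g k x)"
proof -
  let ?W = "\<lambda>n. midpoint_closure (w ` {n..})"
  define \<Phi> where "\<Phi> u = (\<integral>x. dist_gauge d (G x) (u x) \<partial>M)" for u
  have bd: "AE x in M. norm (u x) \<le> G x" if "u \<in> ?W n" for u n
  proof -
    have "AE x in M. \<forall>n. norm (w n x) \<le> G x" using bound by (simp add: AE_all_countable)
    then show ?thesis
    proof eventually_elim
      case (elim x)
      have "u x \<in> cball 0 (G x)"
        using that by (rule midpoint_closure_in_convex) (use elim in auto)
      then show ?case by simp
    qed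
  qed
  have sm: "strongly_measurable M u" if "u \<in> ?W n" for u n
    using that by (rule strongly_measurable_midpoint_closure) (use w in auto)
  have meas: "(\<lambda>x. dist_gauge d (G x) (u x)) \<in> borel_measurable M" if "u \<in> ?W n" for u n
  proof -
    have [measurable]: "(\<lambda>x. norm (u x - d i)) \<in> borel_measurable M" for i
      by (rule borel_measurable_strong_norm[OF strongly_measurable_diff[OF sm[OF that] strongly_measurable_const]])
    note [measurable] = G
    show ?thesis unfolding dist_gauge_def dist_ratio_def by measurable
  qed
  have int: "integrable M (\<lambda>x. dist_gauge d (G x) (u x))" if "u \<in> ?W n" for u n
    by (rule integrable_const_bound[of _ 2])
      (use bd[OF that] meas[OF that] in \<open>auto elim!: eventually_mono simp: abs_of_nonneg dist_gauge_bounds\<close>)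
  define m where "m n = (INF u\<in>?W n. \<Phi> u)" for n
  have ne: "?W n \<noteq> {}" for n using midpoint_closure.base[of "w n" "w ` {n..}"] by auto
  have \<Phi>0: "0 \<le> \<Phi> u" if "u \<in> ?W n" for u n
    unfolding \<Phi>_def using bd[OF that] dist_gauge_bounds(1)
    by (intro integral_nonneg_AE) (auto elim!: eventually_mono)
  have bb: "bdd_below (\<Phi> ` ?W n)" for n using \<Phi>0 by (intro bdd_belowI2[of _ 0]) auto
  have m_le: "m n \<le> \<Phi> u" if "u \<in> ?W n" for u n
    unfolding m_def by (intro cINF_lower bb that)
  have inc: "m n \<le> m k" if "n \<le> k" for n k
    unfolding m_def using that
    by (intro cINF_superset_mono ne bb midpoint_closure_mono image_mono) auto
  have upper: "m n \<le> 2 * measure M (space M)" for n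
  proof -
    have u: "w n \<in> ?W n" by (intro midpoint_closure.base) auto
    have "\<Phi> (w n) \<le> (\<integral>x. 2 \<partial>M)"
      unfolding \<Phi>_def using bd[OF u] dist_gauge_bounds(2)
      by (intro integral_mono_AE int[OF u]) (auto elim!: eventually_mono)
    with m_le[OF u] show ?thesis by (simp add: mult.commute)
  qed
  have "incseq m" using inc by (simp add: incseq_def)
  then obtain L where L: "m \<longlonglongrightarrow> L" "\<And>n. m n \<le> L"
    using incseq_convergent[of m] upper by metis
  \<comment> \<open>The rate 1/16 leaves room: mean gaps are at most \<open>2 * (1/16)^k\<close>,
    weighting by \<open>4^k\<close> keeps them summable, so that pointwise gaps are eventually at
    most \<open>(1/4)^k\<close>, and roots of these are summable. The index \<open>N\<close> may
    exceed \<open>k\<close> because \<open>m N\<close> too must be close to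
    \<open>L\<close>.\<close>
  have "\<exists>u N. k \<le> N \<and> u \<in> ?W N \<and> L - (1 / 16) ^ k \<le> m N \<and> \<Phi> u \<le> L + (1 / 16) ^ k" for k :: nat
  proof -
    have "eventually (\<lambda>n. L - (1 / 16) ^ k < m n) sequentially"
      using L(1) by (rule order_tendstoD) simp
    then obtain N where N: "k \<le> N" "L - (1 / 16) ^ k < m N"
      unfolding eventually_sequentially by (meson nat_le_linear order_refl)
    have "m N < L + (1 / 16) ^ k" using L(2)[of N] by (rule order_le_less_trans) simp
    then obtain u where "u \<in> ?W N" "\<Phi> u < L + (1 / 16) ^ k"
      unfolding m_def cINF_less_iff[OF ne bb] by auto
    with N show ?thesis by (auto intro!: exI[of _ u] exI[of _ N])
  qed
  then obtain g N where g: "\<And>k. k \<le> N k" "\<And>k. g k \<in> ?W (N k)" "\<And>k. L - (1 / 16) ^ k \<le> m (N k)"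
    "\<And>k. \<Phi> (g k) \<le> L + (1 / 16) ^ k" by metis
  have gk: "g k \<in> ?W k" for k
    using g(1,2)[of k] midpoint_closure_mono[of "w ` {N k..}" "w ` {k..}"] by force
  define \<Delta> where "\<Delta> k x = (dist_gauge d (G x) (g k x) + dist_gauge d (G x) (g (Suc k) x)) / 2
    - dist_gauge d (G x) ((1 / 2) *\<^sub>R (g k x + g (Suc k) x))" for k x
  \<comment> \<open>The minimum is taken because \<open>N\<close> need not be monotone; its infimum
    is near \<open>L\<close> whichever of the two indices it is.\<close>
  have mid: "(\<lambda>x. (1 / 2) *\<^sub>R (g k x + g (Suc k) x)) \<in> ?W (min (N k) (N (Suc k)))" for k
  proof (rule midpoint_closure.midpoint)
    show "g k \<in> ?W (min (N k) (N (Suc k)))" "g (Suc k) \<in> ?W (min (N k) (N (Suc k)))"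
      using g(2)[of k] g(2)[of "Suc k"]
        midpoint_closure_mono[of "w ` {N k..}" "w ` {min (N k) (N (Suc k))..}"]
        midpoint_closure_mono[of "w ` {N (Suc k)..}" "w ` {min (N k) (N (Suc k))..}"]
      by force+
  qed
  have \<Delta>: "AE x in M. \<forall>j. (1 / 2) ^ j * (dist_ratio d (G x) j (g k x) - dist_ratio d (G x) j (g (Suc k) x))\<^sup>2 / 4 \<le> \<Delta> k x" for k
    using bd[OF gk[of k]] bd[OF gk[of "Suc k"]]
    by eventually_elim (simp only: \<Delta>_def dist_gauge_midpoint simp_thms)
  have \<Delta>0: "AE x in M. 0 \<le> \<Delta> k x" for k
    using \<Delta>[of k]
  proof eventually_elim
    case (elim x)
    show ?case by (rule order_trans[OF _ elim[rule_format, of 0]]) simp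
  qed
  have i\<Delta>: "integrable M (\<Delta> k)" for k
    unfolding \<Delta>_def
    by (intro Bochner_Integration.integrable_diff integrable_divide Bochner_Integration.integrable_add int[OF gk] int[OF mid])
  have I\<Delta>: "(\<integral>x. \<Delta> k x \<partial>M) \<le> 2 * (1 / 16) ^ k" for k
  proof -
    have "(\<integral>x. \<Delta> k x \<partial>M) = (\<Phi> (g k) + \<Phi> (g (Suc k))) / 2 - \<Phi> (\<lambda>x. (1 / 2) *\<^sub>R (g k x + g (Suc k) x))"
      unfolding \<Delta>_def \<Phi>_def
      using int[OF gk] int[OF mid[of k]] by simp
    also have "\<dots> \<le> L + (1 / 16) ^ k - \<Phi> (\<lambda>x. (1 / 2) *\<^sub>R (g k x + g (Suc k) x))"
    proof -
      have "(1 / 16 :: real) ^ Suc k \<le> (1 / 16) ^ k" by simp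
      then show ?thesis using g(4)[of k] g(4)[of "Suc k"] by argo
    qed
    also have "\<dots> \<le> L + (1 / 16) ^ k - m (min (N k) (N (Suc k)))"
      using m_le[OF mid[of k]] by simp
    also have "\<dots> \<le> L + (1 / 16) ^ k - (L - (1 / 16) ^ k)"
    proof -
      have "(1 / 16 :: real) ^ Suc k \<le> (1 / 16) ^ k" by simp
      then have "L - (1 / 16) ^ k \<le> m (N (Suc k))" using g(3)[of "Suc k"] by linarith
      with g(3)[of k] have "L - (1 / 16) ^ k \<le> m (min (N k) (N (Suc k)))" by (simp add: min_def)
      then show ?thesis by linarith
    qed
    finally show ?thesis by simp
  qed
  have "AE x in M. (\<lambda>k. 4 ^ k * \<bar>\<Delta> k x\<bar>) \<longlonglongrightarrow> 0"
  proof (rule AE_tendsto_0_if_summable_integrals)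
    show "integrable M (\<lambda>x. 4 ^ k * \<bar>\<Delta> k x\<bar>)" for k using i\<Delta> by simp
    show "summable (\<lambda>k. \<integral>x. 4 ^ k * \<bar>\<Delta> k x\<bar> \<partial>M)"
    proof (rule summable_comparison_test'[of "\<lambda>k. 2 * (1 / 4) ^ k"])
      fix k
      have "(\<integral>x. \<bar>\<Delta> k x\<bar> \<partial>M) = (\<integral>x. \<Delta> k x \<partial>M)"
        using \<Delta>0[of k] i\<Delta>[of k] by (intro integral_cong_AE) auto
      then have "norm (\<integral>x. 4 ^ k * \<bar>\<Delta> k x\<bar> \<partial>M) \<le> 4 ^ k * (2 * (1 / 16) ^ k)"
        using I\<Delta>[of k] by (simp add: abs_mult Bochner_Integration.integral_nonneg integral_nonneg_AE \<Delta>0)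
      also have "\<dots> = 2 * (4 * (1 / 16)) ^ k" by (simp only: power_mult_distrib mult_ac)
      finally show "norm (\<integral>x. 4 ^ k * \<bar>\<Delta> k x\<bar> \<partial>M) \<le> 2 * (1 / 4) ^ k" by simp
    qed (intro summable_mult, simp)
  qed auto
  moreover have "AE x in M. \<forall>k. \<forall>j. (1 / 2) ^ j * (dist_ratio d (G x) j (g k x) - dist_ratio d (G x) j (g (Suc k) x))\<^sup>2 / 4 \<le> \<Delta> k x"
    using \<Delta> by (simp add: AE_all_countable)
  moreover have "AE x in M. \<forall>n. w n x \<in> closure (range d)" using wE by (simp add: AE_all_countable)
  ultimately have "AE x in M. convergent (\<lambda>k. g k x)"
    using mnc bd[OF gk[of 0]]
  proof eventually_elim
    case (elim x)
    have G0: "0 \<le> G x" using elim(5) norm_ge_zero order_trans by blast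
    have "seq_mnc d (\<lambda>k. g k x) = 0"
      using seq_mnc_midpoint_closure_le[OF gk, of d x] elim(4) by simp
    then have c: "compact (closure (range (\<lambda>k. g k x)))" by (rule compact_closure_range_if_seq_mnc_0[OF E])
    have gE: "range (\<lambda>k. g k x) \<subseteq> closure (range d)"
      using elim(3) by (auto intro!: midpoint_closure_in_convex[OF gk] subspace_imp_convex[OF E])
    show ?case
    proof (rule convergent_if_dists_convergent[OF c gE])
      fix j
      have \<Delta>x: "(1 / 2) ^ j * (dist_ratio d (G x) j (g k x) - dist_ratio d (G x) j (g (Suc k) x))\<^sup>2 / 4 \<le> \<Delta> k x" for j k
        using elim(2) by blast
      have ev: "eventually (\<lambda>k. 4 ^ k * \<bar>\<Delta> k x\<bar> < 1) sequentially"
        using elim(1) by (rule order_tendstoD) simp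
      have "convergent (\<lambda>k. dist_ratio d (G x) j (g k x))"
      proof (rule convergent_if_sq_diffs_geometric)
        show "eventually (\<lambda>k. (dist_ratio d (G x) j (g k x) - dist_ratio d (G x) j (g (Suc k) x))\<^sup>2
            \<le> (4 * 2 ^ j) * (1 / 4) ^ k) sequentially"
          using ev
        proof eventually_elim
          case (elim k)
          have "4 ^ k * \<Delta> k x \<le> 4 ^ k * \<bar>\<Delta> k x\<bar>" by (intro mult_left_mono) auto
          then have "4 ^ k * \<Delta> k x \<le> 1" using elim by linarith
          then have "\<Delta> k x \<le> (1 / 4) ^ k"
            by (simp add: power_one_over field_simps)
          with \<Delta>x[of j k] have "(1 / 2) ^ j * (dist_ratio d (G x) j (g k x) - dist_ratio d (G x) j (g (Suc k) x))\<^sup>2 / 4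
              \<le> (1 / 4) ^ k" by linarith
          then show ?case by (simp add: power_one_over field_simps)
        qed
      qed
      then have "convergent (\<lambda>k. ((1 + G x) * (1 + norm (d j))) * dist_ratio d (G x) j (g k x))"
        by (rule convergent_mult[OF convergent_const])
      then show "convergent (\<lambda>k. norm (g k x - d j))"
        using G0 by (simp add: dist_ratio_def add_nonneg_eq_0_iff)
    qed
  qed
  with gk show thesis by (rule that)
qed

section \<open>Approximate solutions\<close>

lemma (in complete_measure) Lp_space_diff:
  fixes f g :: "'a \<Rightarrow> 'b::real_normed_vector"
  assumes r: "1 < r" and f: "f \<in> Lp_space r M" and g: "g \<in> Lp_space r M"
  shows "(\<lambda>x. f x - g x) \<in> Lp_space r M"
proof -
  have sm: "strongly_measurable M f" "strongly_measurable M g" using f g by (auto simp: Lp_space_def)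
  have sd: "strongly_measurable M (\<lambda>x. f x - g x)" by (rule strongly_measurable_diff[OF sm])
  have [measurable]: "(\<lambda>x. norm (f x - g x)) \<in> borel_measurable M" by (rule borel_measurable_strong_norm[OF sd])
  have nonneg: "0 \<le> real_of_ereal r" 
    using order_trans[OF _ less_imp_le[OF r], of 0] by (intro real_of_ereal_pos) simp
  show ?thesis
  proof (cases "r = \<infinity>")
    case True
    obtain C D where "AE x in M. norm (f x) \<le> C" "AE x in M. norm (g x) \<le> D"
      using f g True by (auto simp: Lp_space_def)
    then have "AE x in M. norm (f x - g x) \<le> C + D"
      by eventually_elim (rule order_trans[OF norm_triangle_ineq4], simp)
    with sd True show ?thesis by (auto simp: Lp_space_def)
  next
    case False
    let ?s = "real_of_ereal r"
    have le: "norm (f x - g x) powr ?s \<le> 2 powr ?s * (norm (f x) powr ?s + norm (g x) powr ?s)" for x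
    proof -
      have "norm (f x - g x) \<le> 2 * max (norm (f x)) (norm (g x))"
        using norm_triangle_ineq4[of "f x" "g x"] by linarith
      then have "norm (f x - g x) powr ?s \<le> (2 * max (norm (f x)) (norm (g x))) powr ?s"
        using nonneg by (intro powr_mono2) auto
      also have "\<dots> = 2 powr ?s * max (norm (f x)) (norm (g x)) powr ?s"
        by (rule powr_mult)
      also have "\<dots> \<le> 2 powr ?s * (norm (f x) powr ?s + norm (g x) powr ?s)"
        by (intro mult_left_mono) (auto simp: max_def)
      finally show ?thesis .
    qed
    have "integrable M (\<lambda>x. norm (f x - g x) powr ?s)"
      by (rule Bochner_Integration.integrable_bound[of M "\<lambda>x. 2 powr ?s * (norm (f x) powr ?s + norm (g x) powr ?s)"])
        (use f g False le in \<open>auto simp: Lp_space_def intro!: AE_I2 order_trans[OF _ abs_ge_self]\<close>)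
    with sd False show ?thesis by (simp add: Lp_space_def)
  qed
qed

text \<open>Choosing at each point the first simple approximant within \<open>\<epsilon>\<close>
  buys uniform accuracy at the price of countably many values instead of finitely many.\<close>

lemma (in finite_complete_measure) countably_valued_approximation:
  fixes X :: "'a \<Rightarrow> 'b::real_normed_vector"
  assumes X: "strongly_measurable M X" and e: "0 < \<epsilon>"
  obtains s i where "\<And>n::nat. simple_function M (s n)" "i \<in> measurable M (count_space UNIV)"
    "\<And>x. x \<in> space M \<Longrightarrow> norm (s (i x) x) \<le> norm (X x)" "AE x in M. norm (s (i x) x - X x) \<le> \<epsilon>"
proof -
  obtain s where s: "\<And>n::nat. simple_function M (s n)" "AE x in M. (\<lambda>n. s n x) \<longlonglongrightarrow> X x"
    "\<And>n x. x \<in> space M \<Longrightarrow> norm (s n x) \<le> norm (X x)"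
    by (rule strongly_measurable_dominated_approx[OF X]) blast
  have [measurable]: "(\<lambda>x. norm (s n x - X x)) \<in> borel_measurable M" for n
    by (rule borel_measurable_strong_norm[OF strongly_measurable_diff[OF strongly_measurable_simple[OF s(1)] X]])
  \<comment> \<open>On the null set where no index qualifies, \<open>LEAST\<close> is unspecified,
    but the norm bound holds for every index.\<close>
  define i where "i x = (LEAST n. norm (s n x - X x) \<le> \<epsilon>)" for x
  show thesis
  proof (rule that[OF s(1), of i])
    show "i \<in> measurable M (count_space UNIV)" unfolding i_def by measurable
    show "AE x in M. norm (s (i x) x - X x) \<le> \<epsilon>"
      using s(2)
    proof eventually_elim
      case (elim x)
      have "(\<lambda>n. norm (s n x - X x)) \<longlonglongrightarrow> norm (X x - X x)" by (intro tendsto_intros elim)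
      then have "eventually (\<lambda>n. norm (s n x - X x) < \<epsilon>) sequentially"
        using e by (intro order_tendstoD) auto
      then obtain n where "norm (s n x - X x) < \<epsilon>"
        using eventually_happens'[OF sequentially_bot] by blast
      then have "norm (s n x - X x) \<le> \<epsilon>" by simp
      then show ?case unfolding i_def by (rule LeastI)
    qed
  qed (use s(3) in auto)
qed

text \<open>The functions \<open>k' n\<close> approximate \<open>t \<mapsto> k t\<close> in the norm
  of \<open>L^r\<close>, and \<open>f x\<close> selects along the constant \<open>x\<close>. The
  bound \<open>G_bound\<close> is an a priori estimate that reproduces itself: selections bounded by
  \<open>G\<close> have kernel integrals of norm at most
  \<open>\<bar>Lp_norm r M (k t)\<bar> * W\<close>, and at points of this size, after adding
  \<open>h\<close>, the growth bound is again at most \<open>G\<close>.\<close>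

locale volterra =
  fixes q T c \<alpha> W :: real and r :: ereal and h :: "real \<Rightarrow> 'a::banach"
    and k :: "real \<Rightarrow> real \<Rightarrow> 'a \<Rightarrow>\<^sub>L 'a" and k' :: "nat \<Rightarrow> real \<Rightarrow> real \<Rightarrow> 'a \<Rightarrow>\<^sub>L 'a"
    and F :: "real \<Rightarrow> 'a \<Rightarrow> 'a set" and f :: "'a \<Rightarrow> real \<Rightarrow> 'a" and b G :: "real \<Rightarrow> real" and M
  defines "M \<equiv> lebesgue_on {0..T}"
  assumes q: "1 \<le> q" and r: "1 < r" "1 / ereal q + 1 / r = 1"
    and causal: "\<And>t s. t \<in> {0..T} \<Longrightarrow> s \<in> {0..T} \<Longrightarrow> t < s \<Longrightarrow> k t s = 0"
    and k_Lr: "\<And>t. t \<in> {0..T} \<Longrightarrow> k t \<in> Lp_space r M"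
    and k'_simple: "\<And>n. simple_function M (k' n)"
    and k'_Lr: "\<And>n t. t \<in> {0..T} \<Longrightarrow> k' n t \<in> Lp_space r M"
    and k'_lim: "AE t in M. (\<lambda>n. Lp_norm r M (\<lambda>u. k' n t u - k t u)) \<longlonglongrightarrow> 0"
    and h_meas: "strongly_measurable M h"
    and f_meas: "\<And>x. strongly_measurable M (f x)"
    and f_sel: "\<And>x t. t \<in> {0..T} \<Longrightarrow> f x t \<in> F t x"
    and F_bound: "\<And>x. AE t in M. \<forall>y\<in>F t x. norm y \<le> b t + c * norm x powr \<alpha>"
    and G_meas: "G \<in> borel_measurable M" and G_nonneg: "\<And>t. 0 \<le> G t"
    and G_int: "integrable M (\<lambda>t. G t powr q)"
    and W_def: "W = (\<integral>t. G t powr q \<partial>M) powr (1 / q)"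
    and G_bound: "\<And>t (v :: 'a). t \<in> {0..T} \<Longrightarrow> norm v \<le> norm (h t) + \<bar>Lp_norm r M (k t)\<bar> * W \<Longrightarrow>
      b t + c * norm v powr \<alpha> \<le> G t"
begin

sublocale finite_complete_measure M
  unfolding M_def by (rule finite_complete_measure_lebesgue_on)

lemma space_M [simp]: "space M = {0..T}" by (simp add: M_def)

lemma measurable_ident_M [measurable]: "(\<lambda>t. t) \<in> borel_measurable M"
  unfolding M_def by (intro measurable_restrict_space1 measurable_completion) auto

text \<open>Causality makes this the integral up to \<open>t\<close>, while the domain of
  integration stays independent of \<open>t\<close>.\<close>

definition kernel_integral :: "(real \<Rightarrow> 'a) \<Rightarrow> real \<Rightarrow> 'a" where
  "kernel_integral w t = strong_integral M (\<lambda>s. k t s (w s))"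

lemma norm_blinfun_AE_le:
  fixes g :: "real \<Rightarrow> 'a \<Rightarrow>\<^sub>L 'a"
  assumes "AE s in M. norm (w s) \<le> \<phi> s"
  shows "AE s in M. norm (blinfun_apply (g s) (w s)) \<le> norm (g s) * \<phi> s"
  using assms
  by eventually_elim (rule order_trans[OF norm_blinfun], auto intro: mult_left_mono)

lemma strongly_integrable_blinfun:
  fixes g :: "real \<Rightarrow> 'a \<Rightarrow>\<^sub>L 'a"
  assumes g: "g \<in> Lp_space r M" and w: "strongly_measurable M w" "AE s in M. norm (w s) \<le> \<phi> s"
    and \<phi>: "\<phi> \<in> borel_measurable M" "\<And>s. 0 \<le> \<phi> s" "integrable M (\<lambda>s. \<phi> s powr q)"
  shows "strongly_integrable M (\<lambda>s. blinfun_apply (g s) (w s))"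
    "norm (strong_integral M (\<lambda>s. blinfun_apply (g s) (w s)))
      \<le> \<bar>Lp_norm r M g\<bar> * (\<integral>s. \<phi> s powr q \<partial>M) powr (1 / q)"
proof -
  have sm: "strongly_measurable M (\<lambda>s. blinfun_apply (g s) (w s))"
    using g w by (intro strongly_measurable_blinfun_apply) (auto simp: Lp_space_def)
  note H = Lp_space_Holder[OF q r g \<phi>]
  show "strongly_integrable M (\<lambda>s. blinfun_apply (g s) (w s))"
    by (rule strongly_integrable_bound[OF sm H(1) norm_blinfun_AE_le[OF w(2)]])
  show "norm (strong_integral M (\<lambda>s. blinfun_apply (g s) (w s)))
      \<le> \<bar>Lp_norm r M g\<bar> * (\<integral>s. \<phi> s powr q \<partial>M) powr (1 / q)"
    using norm_strong_integral_le_bound[OF sm H(1) norm_blinfun_AE_le[OF w(2)]] H(2) by (rule order_trans)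
qed

lemmas strongly_integrable_blinfun_G =
  strongly_integrable_blinfun[where \<phi> = G, OF _ _ _ G_meas G_nonneg G_int, folded W_def]

lemma norm_kernel_integral_le:
  assumes "strongly_measurable M w" "AE s in M. norm (w s) \<le> G s" "t \<in> {0..T}"
  shows "norm (kernel_integral w t) \<le> \<bar>Lp_norm r M (k t)\<bar> * W"
  unfolding kernel_integral_def using assms by (intro strongly_integrable_blinfun_G k_Lr)

text \<open>The error depends on \<open>w\<close> only through \<open>G\<close>, so it is uniform
  over all selections in play. Later exchanges of \<open>k t\<close> and \<open>k' n t\<close> rest
  on this uniformity.\<close>

lemma norm_approx_kernel_integral_le:
  assumes w: "strongly_measurable M w" "AE s in M. norm (w s) \<le> G s" and t: "t \<in> {0..T}"
    and g: "g \<in> Lp_space r M"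
  shows "norm (strong_integral M (\<lambda>s. blinfun_apply (g s) (w s)) - kernel_integral w t)
    \<le> \<bar>Lp_norm r M (\<lambda>u. g u - k t u)\<bar> * W"
proof -
  have "strong_integral M (\<lambda>s. blinfun_apply (g s) (w s)) - kernel_integral w t
      = strong_integral M (\<lambda>s. blinfun_apply (g s) (w s) - blinfun_apply (k t s) (w s))"
    unfolding kernel_integral_def
    by (rule strong_integral_diff[symmetric]) (intro strongly_integrable_blinfun_G w g k_Lr t)+
  also have "\<dots> = strong_integral M (\<lambda>s. blinfun_apply (g s - k t s) (w s))"
    by (simp add: blinfun.diff_left)
  also have "norm \<dots> \<le> \<bar>Lp_norm r M (\<lambda>u. g u - k t u)\<bar> * W"
    by (intro strongly_integrable_blinfun_G w Lp_space_diff r(1) g k_Lr t)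
  finally show ?thesis .
qed

text \<open>The quantifier over \<open>w\<close> stands inside: one null set of times serves all
  \<open>w\<close>.\<close>

lemma AE_lim_kernel_integral:
  "AE t in M. \<forall>w :: real \<Rightarrow> 'a. strongly_measurable M w \<longrightarrow> (AE s in M. norm (w s) \<le> G s) \<longrightarrow>
    (\<lambda>n. strong_integral M (\<lambda>s. blinfun_apply (k' n t s) (w s))) \<longlonglongrightarrow> kernel_integral w t"
  using k'_lim AE_space
proof eventually_elim
  case (elim t)
  show ?case
  proof (intro allI impI)
    fix w :: "real \<Rightarrow> 'a" assume w: "strongly_measurable M w" "AE s in M. norm (w s) \<le> G s"
    have t: "t \<in> {0..T}" using elim(2) by simp
    have lim: "(\<lambda>n. \<bar>Lp_norm r M (\<lambda>u. k' n t u - k t u)\<bar> * W) \<longlonglongrightarrow> 0"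
      using tendsto_mult_right[OF tendsto_rabs[OF elim(1)], of W] by simp
    have "(\<lambda>n. strong_integral M (\<lambda>s. blinfun_apply (k' n t s) (w s)) - kernel_integral w t) \<longlonglongrightarrow> 0"
      by (rule Lim_null_comparison[OF always_eventually[OF allI] lim])
        (rule norm_approx_kernel_integral_le[OF w t k'_Lr[OF t]])
    then show "(\<lambda>n. strong_integral M (\<lambda>s. blinfun_apply (k' n t s) (w s))) \<longlonglongrightarrow> kernel_integral w t"
      by (rule LIM_zero_cancel)
  qed
qed

text \<open>Measurability in \<open>t\<close> comes from the simple functions \<open>k' n\<close>:
  for fixed \<open>w\<close> their integrals take finitely many values.\<close>

lemma strongly_measurable_kernel_integral:
  assumes w: "strongly_measurable M w" "AE s in M. norm (w s) \<le> G s"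
  shows "strongly_measurable M (kernel_integral w)"
  unfolding strongly_measurable_def
proof (intro exI conjI allI)
  show "simple_function M (\<lambda>t. strong_integral M (\<lambda>s. blinfun_apply (k' n t s) (w s)))" for n
    using simple_function_compose1[OF k'_simple[of n], of "\<lambda>g. strong_integral M (\<lambda>s. blinfun_apply (g s) (w s))"]
    by simp
  show "AE t in M. (\<lambda>n. strong_integral M (\<lambda>s. blinfun_apply (k' n t s) (w s))) \<longlonglongrightarrow> kernel_integral w t"
    using AE_lim_kernel_integral by eventually_elim (use w in blast)
qed

text \<open>A countably valued argument reconciles two pointwise hypotheses: the null sets of
  \<open>F_bound\<close>, one for each value, have a null union, and the selections
  \<open>f x\<close> along constants can be glued. The error \<open>\<epsilon>\<close> is the
  price.\<close>

lemma selection_along_approximation: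
  assumes w: "strongly_measurable M w" "AE s in M. norm (w s) \<le> G s" and \<epsilon>: "0 < \<epsilon>"
  obtains \<sigma> v where "countable (\<sigma> ` {0..T})" "strongly_measurable M v"
    "\<And>t. t \<in> {0..T} \<Longrightarrow> v t \<in> F t (\<sigma> t)" "AE t in M. norm (v t) \<le> G t"
    "AE t in M. norm (\<sigma> t - (h t + kernel_integral w t)) \<le> \<epsilon>"
proof -
  have X: "strongly_measurable M (\<lambda>t. h t + kernel_integral w t)"
    by (intro strongly_measurable_add h_meas strongly_measurable_kernel_integral w)
  obtain s i where s: "\<And>n::nat. simple_function M (s n)" "i \<in> measurable M (count_space UNIV)"
    "\<And>t. t \<in> space M \<Longrightarrow> norm (s (i t) t) \<le> norm (h t + kernel_integral w t)"
    "AE t in M. norm (s (i t) t - (h t + kernel_integral w t)) \<le> \<epsilon>"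
    by (rule countably_valued_approximation[OF X \<epsilon>]) blast
  let ?C = "\<Union>n. s n ` {0..T}"
  have C: "countable ?C" using s(1) by (auto simp: simple_function_def countable_finite)
  have "AE t in M. \<forall>x\<in>?C. \<forall>y\<in>F t x. norm y \<le> b t + c * norm x powr \<alpha>"
    using F_bound by (simp only: AE_ball_countable[OF C]) blast
  then have v: "AE t in M. norm (f (s (i t) t) t) \<le> G t"
    using AE_space
  proof eventually_elim
    case (elim t)
    have t: "t \<in> {0..T}" using elim(2) by simp
    have "norm (s (i t) t) \<le> norm (h t) + \<bar>Lp_norm r M (k t)\<bar> * W"
      using s(3)[of t] t norm_triangle_ineq[of "h t" "kernel_integral w t"] norm_kernel_integral_le[OF w t]
      by simp
    then have "b t + c * norm (s (i t) t) powr \<alpha> \<le> G t" by (rule G_bound[OF t])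
    moreover have "norm (f (s (i t) t) t) \<le> b t + c * norm (s (i t) t) powr \<alpha>"
      using elim(1) t f_sel[OF t] by blast
    ultimately show ?case by simp
  qed
  show thesis
  proof (rule that[of "\<lambda>t. s (i t) t" "\<lambda>t. f (s (i t) t) t"])
    show "countable ((\<lambda>t. s (i t) t) ` {0..T})" by (rule countable_subset[OF _ C]) auto
    show "strongly_measurable M (\<lambda>t. f (s (i t) t) t)"
      by (rule strongly_measurable_glue_nat[OF s(2), of "\<lambda>n t. f (s n t) t"])
        (rule strongly_measurable_glue_simple[OF s(1) f_meas])
  qed (use f_sel v s(4) in auto)
qed

section \<open>Tonelli approximations with delay\<close>

definition window_norm :: "real \<Rightarrow> real \<Rightarrow> real" where
  "window_norm \<delta> t = (\<integral>s. indicator {t - \<delta>..t} s * G s powr q \<partial>M) powr (1 / q)"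

lemma strongly_measurable_If_less:
  assumes "strongly_measurable M u" "strongly_measurable M v"
  shows "strongly_measurable M (\<lambda>t. if t < a then u t else v t)"
proof (rule strongly_measurable_If[OF assms])
  show "Measurable.pred M (\<lambda>t. t < a)" by measurable
qed

lemma kernel_integral_cong:
  assumes "t \<in> {0..T}" "strongly_measurable M w" "AE s in M. norm (w s) \<le> G s"
    and "\<And>s. s \<in> {0..T} \<Longrightarrow> s \<le> t \<Longrightarrow> w s = v s"
  shows "kernel_integral w t = kernel_integral v t"
  unfolding kernel_integral_def
proof (rule strong_integral_cong_AE)
  show "strongly_integrable M (\<lambda>s. blinfun_apply (k t s) (w s))"
    by (intro strongly_integrable_blinfun_G k_Lr assms)
  have "blinfun_apply (k t s) (w s) = blinfun_apply (k t s) (v s)" if "s \<in> {0..T}" for s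
    using causal[OF assms(1) that] assms(4)[OF that] by (cases "s \<le> t") auto
  then show "AE s in M. blinfun_apply (k t s) (w s) = blinfun_apply (k t s) (v s)" by auto
qed

text \<open>The cost of the delay. The two arguments differ only from \<open>a\<close> on, causality
  discards everything after \<open>t\<close>, and what remains lies in a window of length
  \<open>\<delta>\<close>, where Hoelder applies.\<close>

lemma norm_kernel_integral_diff_le:
  assumes t: "t \<in> {0..T}" and w: "strongly_measurable M w" "AE s in M. norm (w s) \<le> G s"
    and v: "strongly_measurable M v" "AE s in M. norm (v s) \<le> G s"
    and eq: "\<And>s. s < a \<Longrightarrow> v s = w s" "\<And>s. a \<le> s \<Longrightarrow> v s = 0" and a: "t - \<delta> \<le> a"
  shows "norm (kernel_integral w t - kernel_integral v t) \<le> \<bar>Lp_norm r M (k t)\<bar> * window_norm \<delta> t"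
proof -
  let ?\<phi> = "\<lambda>s. indicator {t - \<delta>..t} s * G s"
  have [measurable]: "{t - \<delta>..t} \<inter> space M \<in> sets M" by (auto simp: M_def sets_restrict_space)
  note [measurable] = G_meas
  have u: "strongly_measurable M (\<lambda>s. if s < a then 0 else if s \<le> t then w s else 0)"
  proof -
    have "Measurable.pred M (\<lambda>s. s \<le> t)" by measurable
    then show ?thesis
      by (intro strongly_measurable_If_less strongly_measurable_If strongly_measurable_const w)
  qed
  let ?u = "\<lambda>s. if s < a then 0 else if s \<le> t then w s else 0"
  have "kernel_integral w t - kernel_integral v t
      = strong_integral M (\<lambda>s. blinfun_apply (k t s) (w s) - blinfun_apply (k t s) (v s))"
    unfolding kernel_integral_def
    by (rule strong_integral_diff[symmetric]) (intro strongly_integrable_blinfun_G w v k_Lr t)+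
  also have "\<dots> = strong_integral M (\<lambda>s. blinfun_apply (k t s) (?u s))"
  proof (rule strong_integral_cong_AE)
    show "strongly_integrable M (\<lambda>s. blinfun_apply (k t s) (w s) - blinfun_apply (k t s) (v s))"
      by (intro strongly_integrable_diff strongly_integrable_blinfun_G w v k_Lr t)
    have "blinfun_apply (k t s) (w s) - blinfun_apply (k t s) (v s) = blinfun_apply (k t s) (?u s)"
      if "s \<in> {0..T}" for s
      using causal[OF t that] eq[of s] by (cases "s \<le> t") auto
    then show "AE s in M. blinfun_apply (k t s) (w s) - blinfun_apply (k t s) (v s) = blinfun_apply (k t s) (?u s)"
      by (intro AE_I2) (simp only: space_M)
  qed
  also have "norm \<dots> \<le> \<bar>Lp_norm r M (k t)\<bar> * (\<integral>s. ?\<phi> s powr q \<partial>M) powr (1 / q)"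
  proof (rule strongly_integrable_blinfun(2)[OF k_Lr[OF t] u])
    show "AE s in M. norm (?u s) \<le> ?\<phi> s"
      using w(2) by eventually_elim (use a G_nonneg in \<open>auto simp: indicator_def\<close>)
    show "?\<phi> \<in> borel_measurable M" by measurable
    show "0 \<le> ?\<phi> s" for s using G_nonneg by simp
    have "integrable M (\<lambda>s. indicator ({t - \<delta>..t} \<inter> space M) s *\<^sub>R G s powr q)"
      by (rule integrable_mult_indicator[OF _ G_int]) measurable
    then show "integrable M (\<lambda>s. ?\<phi> s powr q)"
      by (rule Bochner_Integration.integrable_cong[THEN iffD1, rotated 2]) (auto simp: indicator_def)
  qed
  also have "(\<integral>s. ?\<phi> s powr q \<partial>M) powr (1 / q) = window_norm \<delta> t"
    unfolding window_norm_def
    by (intro arg_cong[where f = "\<lambda>x. x powr (1 / q)"] Bochner_Integration.integral_cong)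
      (auto simp: indicator_def)
  finally show ?thesis .
qed

text \<open>The estimate is extended by one block at a time. On the new block the argument
  integrates only \<open>w0\<close>, the old selection cut off at \<open>real n * \<delta>\<close>,
  so the missing part of the integral lies within the last \<open>\<delta>\<close>. By causality the
  integrals at earlier times do not change.\<close>

lemma delayed_solution:
  assumes \<epsilon>: "0 < \<epsilon>" and \<delta>: "0 < \<delta>"
  shows "\<exists>\<sigma> w. countable (\<sigma> ` {0..T}) \<and> strongly_measurable M w \<and> (\<forall>t\<in>{0..T}. w t \<in> F t (\<sigma> t)) \<and>
    (AE t in M. norm (w t) \<le> G t) \<and>
    (AE t in M. t < real n * \<delta> \<longrightarrow> norm (\<sigma> t - (h t + kernel_integral w t))
       \<le> \<epsilon> + \<bar>Lp_norm r M (k t)\<bar> * window_norm \<delta> t)"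
proof (induction n)
  case 0
  \<comment> \<open>With no block the estimate is vacuous on \<open>{0..T}\<close>, but
    \<open>\<sigma>\<close> and \<open>w\<close> must be defined everywhere; selecting along the
    integral of 0 provides them.\<close>
  have "AE s in M. norm (0 :: 'a) \<le> G s" using G_nonneg by simp
  then obtain \<sigma> w where "countable (\<sigma> ` {0..T})" "strongly_measurable M w"
    "\<And>t. t \<in> {0..T} \<Longrightarrow> w t \<in> F t (\<sigma> t)" "AE t in M. norm (w t) \<le> G t"
    by (rule selection_along_approximation[OF strongly_measurable_const _ \<epsilon>]) blast
  then show ?case by (intro exI[of _ \<sigma>] exI[of _ w]) (auto intro!: AE_I2)
next
  case (Suc n)
  then obtain \<sigma> w where IH: "countable (\<sigma> ` {0..T})" "strongly_measurable M w"
    "\<And>t. t \<in> {0..T} \<Longrightarrow> w t \<in> F t (\<sigma> t)" "AE t in M. norm (w t) \<le> G t"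
    "AE t in M. t < real n * \<delta> \<longrightarrow> norm (\<sigma> t - (h t + kernel_integral w t))
       \<le> \<epsilon> + \<bar>Lp_norm r M (k t)\<bar> * window_norm \<delta> t"
    by blast
  let ?a = "real n * \<delta>"
  define w0 where "w0 t = (if t < ?a then w t else 0)" for t
  have w0: "strongly_measurable M w0" "AE t in M. norm (w0 t) \<le> G t"
  proof -
    show "strongly_measurable M w0"
      unfolding w0_def by (intro strongly_measurable_If_less strongly_measurable_const IH)
    show "AE t in M. norm (w0 t) \<le> G t"
      using IH(4) by eventually_elim (auto simp: w0_def G_nonneg)
  qed
  obtain \<sigma>' w' where new: "countable (\<sigma>' ` {0..T})" "strongly_measurable M w'"
    "\<And>t. t \<in> {0..T} \<Longrightarrow> w' t \<in> F t (\<sigma>' t)" "AE t in M. norm (w' t) \<le> G t"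
    "AE t in M. norm (\<sigma>' t - (h t + kernel_integral w0 t)) \<le> \<epsilon>"
    by (rule selection_along_approximation[OF w0 \<epsilon>]) blast
  define u where "u t = (if t < ?a then w t else w' t)" for t
  define \<tau> where "\<tau> t = (if t < ?a then \<sigma> t else \<sigma>' t)" for t
  have u: "strongly_measurable M u" "AE t in M. norm (u t) \<le> G t"
  proof -
    show "strongly_measurable M u" unfolding u_def by (intro strongly_measurable_If_less IH new)
    show "AE t in M. norm (u t) \<le> G t"
      using IH(4) new(4) by eventually_elim (auto simp: u_def)
  qed
  show ?case
  proof (rule exI[of _ \<tau>], rule exI[of _ u], intro conjI ballI u)
    show "countable (\<tau> ` {0..T})"
      by (rule countable_subset[OF _ countable_Un[OF IH(1) new(1)]]) (auto simp: \<tau>_def)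
    show "u t \<in> F t (\<tau> t)" if "t \<in> {0..T}" for t
      using IH(3)[OF that] new(3)[OF that] by (simp add: u_def \<tau>_def)
    show "AE t in M. t < real (Suc n) * \<delta> \<longrightarrow> norm (\<tau> t - (h t + kernel_integral u t))
       \<le> \<epsilon> + \<bar>Lp_norm r M (k t)\<bar> * window_norm \<delta> t"
      using IH(5) new(5) AE_space
    proof eventually_elim
      case (elim t)
      have t: "t \<in> {0..T}" using elim(3) by simp
      show ?case
      proof
        assume lt: "t < real (Suc n) * \<delta>"
        show "norm (\<tau> t - (h t + kernel_integral u t)) \<le> \<epsilon> + \<bar>Lp_norm r M (k t)\<bar> * window_norm \<delta> t"
        proof (cases "t < ?a")
          case True
          have "kernel_integral w t = kernel_integral u t"
            using True by (intro kernel_integral_cong[OF t IH(2,4)]) (simp add: u_def)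
          with True elim(1) show ?thesis by (simp add: \<tau>_def)
        next
          case False
          have "norm (kernel_integral u t - kernel_integral w0 t) \<le> \<bar>Lp_norm r M (k t)\<bar> * window_norm \<delta> t"
            using lt by (intro norm_kernel_integral_diff_le[OF t u w0, of ?a])
              (auto simp: u_def w0_def algebra_simps)
          moreover have "norm (\<tau> t - (h t + kernel_integral u t))
              \<le> norm (\<sigma>' t - (h t + kernel_integral w0 t)) + norm (kernel_integral u t - kernel_integral w0 t)"
            using False norm_triangle_ineq4[of "\<sigma>' t - (h t + kernel_integral w0 t)" "kernel_integral u t - kernel_integral w0 t"]
            by (simp add: \<tau>_def algebra_simps)
          ultimately show ?thesis using elim(2) by linarith
        qed
      qed
    qed
  qed
qed

lemma approximate_solutions:
  obtains \<sigma> w where "\<And>n::nat. countable (\<sigma> n ` {0..T})" "\<And>n. strongly_measurable M (w n)"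
    "\<And>n t. t \<in> {0..T} \<Longrightarrow> w n t \<in> F t (\<sigma> n t)" "\<And>n. AE t in M. norm (w n t) \<le> G t"
    "AE t in M. (\<lambda>n. \<sigma> n t - (h t + kernel_integral (w n) t)) \<longlonglongrightarrow> 0"
proof -
  let ?P = "\<lambda>n \<sigma> w. countable (\<sigma> ` {0..T}) \<and> strongly_measurable M w \<and> (\<forall>t\<in>{0..T}. w t \<in> F t (\<sigma> t)) \<and>
    (AE t in M. norm (w t) \<le> G t) \<and>
    (AE t in M. norm (\<sigma> t - (h t + kernel_integral w t)) \<le> (1 + \<bar>Lp_norm r M (k t)\<bar>) / real (Suc n))"
  have ex: "\<exists>\<sigma> w. ?P n \<sigma> w" for n
  proof -
    let ?e = "1 / real (Suc n)"
    \<comment> \<open>The threshold is a \<open>q\<close>-th power because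
      \<open>window_norm\<close> takes a \<open>q\<close>-th root.\<close>
    obtain \<delta> where \<delta>: "0 < \<delta>"
      "\<And>s t. t - s \<le> \<delta> \<Longrightarrow> (\<integral>x. indicator {s..t} x * G x powr q \<partial>M) < ?e powr q"
      using integral_small_on_windows[of T "\<lambda>x. G x powr q" "?e powr q"] G_int unfolding M_def by auto
    have wn: "window_norm \<delta> t \<le> ?e" for t
    proof -
      have "(\<integral>x. indicator {t - \<delta>..t} x * G x powr q \<partial>M) \<le> ?e powr q"
        using \<delta>(2)[of t "t - \<delta>"] by simp
      then have "window_norm \<delta> t \<le> (?e powr q) powr (1 / q)"
        unfolding window_norm_def using q by (intro powr_mono2) (auto intro!: integral_nonneg_AE)
      also have "\<dots> = ?e" using q by (simp add: powr_powr)
      finally show ?thesis .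
    qed
    obtain N :: nat where N: "T < real N * \<delta>" using reals_Archimedean3[OF \<delta>(1)] by blast
    have e0: "0 < ?e" by simp
    from delayed_solution[OF e0 \<delta>(1), of N] obtain \<sigma> w where
      *: "countable (\<sigma> ` {0..T})" "strongly_measurable M w" "\<forall>t\<in>{0..T}. w t \<in> F t (\<sigma> t)"
      "AE t in M. norm (w t) \<le> G t" "AE t in M. t < real N * \<delta> \<longrightarrow> norm (\<sigma> t - (h t + kernel_integral w t))
       \<le> ?e + \<bar>Lp_norm r M (k t)\<bar> * window_norm \<delta> t"
      by blast
    have "AE t in M. norm (\<sigma> t - (h t + kernel_integral w t)) \<le> (1 + \<bar>Lp_norm r M (k t)\<bar>) / real (Suc n)"
      using *(5) AE_space
    proof eventually_elim
      case (elim t)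
      have "\<bar>Lp_norm r M (k t)\<bar> * window_norm \<delta> t \<le> \<bar>Lp_norm r M (k t)\<bar> * ?e"
        using wn by (intro mult_left_mono) auto
      moreover have "norm (\<sigma> t - (h t + kernel_integral w t)) \<le> ?e + \<bar>Lp_norm r M (k t)\<bar> * window_norm \<delta> t"
        using elim N by auto
      ultimately show ?case by (simp add: add_divide_distrib)
    qed
    with * show ?thesis by blast
  qed
  then have "\<forall>n. \<exists>\<sigma> w. ?P n \<sigma> w" by (rule allI)
  then obtain \<sigma> where "\<forall>n. \<exists>w. ?P n (\<sigma> n) w" by (drule_tac choice) (elim exE)
  then obtain w where P: "\<forall>n. ?P n (\<sigma> n) (w n)" by (drule_tac choice) (elim exE)
  have sw: "countable (\<sigma> n ` {0..T})" "strongly_measurable M (w n)"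
    "t \<in> {0..T} \<Longrightarrow> w n t \<in> F t (\<sigma> n t)" "AE t in M. norm (w n t) \<le> G t"
    "AE t in M. norm (\<sigma> n t - (h t + kernel_integral (w n) t)) \<le> (1 + \<bar>Lp_norm r M (k t)\<bar>) / real (Suc n)" for n t
    using spec[OF P, of n] by blast+
  have "AE t in M. \<forall>n. norm (\<sigma> n t - (h t + kernel_integral (w n) t)) \<le> (1 + \<bar>Lp_norm r M (k t)\<bar>) / real (Suc n)"
    using sw(5) by (simp only: AE_all_countable) blast
  then have "AE t in M. (\<lambda>n. \<sigma> n t - (h t + kernel_integral (w n) t)) \<longlonglongrightarrow> 0"
  proof eventually_elim
    case (elim t)
    have "(\<lambda>n. (1 + \<bar>Lp_norm r M (k t)\<bar>) * (1 / real (Suc n))) \<longlonglongrightarrow> (1 + \<bar>Lp_norm r M (k t)\<bar>) * 0"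
      by (intro tendsto_mult tendsto_const LIMSEQ_Suc[OF lim_1_over_n])
    then have "(\<lambda>n. (1 + \<bar>Lp_norm r M (k t)\<bar>) / real (Suc n)) \<longlonglongrightarrow> 0" by simp
    then show ?case by (rule Lim_null_comparison[rotated]) (use elim in \<open>auto intro!: always_eventually\<close>)
  qed
  with sw(1-4) show thesis by (rule that)
qed

end

section \<open>Compactness of approximate solutions\<close>

lemma openin_weak_topology_imp_open:
  fixes U :: "'b::real_normed_vector set"
  assumes "openin weak_topology U"
  shows "open U"
proof -
  have "generate_topology_on {blinfun_apply \<phi> -` U | (\<phi> :: 'b \<Rightarrow>\<^sub>L real) U. open U} U"
    using assms unfolding weak_topology_def openin_topology_generated_by_iff .
  then show ?thesis
  proof induction
    case (Basis s)
    then show ?case by (auto intro!: open_vimage continuous_intros)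
  qed auto
qed

lemma topspace_weak_topology: "topspace (weak_topology :: 'b::real_normed_vector topology) = UNIV"
proof -
  have "blinfun_apply (0 :: 'b \<Rightarrow>\<^sub>L real) -` UNIV \<in> {blinfun_apply \<phi> -` U | (\<phi> :: 'b \<Rightarrow>\<^sub>L real) U. open U}"
    by blast
  then show ?thesis unfolding weak_topology_def topology_generated_by_topspace by auto
qed

text \<open>Norm convergence implies weak convergence, so the graph condition applies to the norm
  convergent values that compactness supplies.\<close>

lemma sequentially_closedin_norm_weakD:
  fixes F :: "'b::real_normed_vector \<Rightarrow> 'b set"
  assumes cl: "sequentially_closedin (prod_topology euclidean weak_topology) {(x, y). y \<in> F x}"
    and x: "x \<longlonglongrightarrow> a" and y: "y \<longlonglongrightarrow> l" and xy: "\<And>n. y n \<in> F (x n)"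
  shows "l \<in> F a"
proof -
  have "limitin weak_topology y l sequentially"
    unfolding limitin_def
  proof (intro conjI allI impI)
    fix U assume "openin weak_topology U \<and> l \<in> U"
    then show "eventually (\<lambda>n. y n \<in> U) sequentially"
      by (intro topological_tendstoD[OF y openin_weak_topology_imp_open]) auto
  qed (simp add: topspace_weak_topology)
  then have "limitin (prod_topology euclidean weak_topology) (\<lambda>n. (x n, y n)) (a, l) sequentially"
    using x by (simp add: limitin_pairwise o_def)
  then have "(a, l) \<in> {(x, y). y \<in> F x}"
    using cl[unfolded sequentially_closedin_def, THEN conjunct2, rule_format, of "\<lambda>n. (x n, y n)" "(a, l)"] xy
    by simp
  then show ?thesis by simp
qed

text \<open>Compactness and the closed graph put all late \<open>w j\<close> into a given
  neighbourhood of \<open>F a\<close>. The neighbourhood is convex, so it also contains the late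
  \<open>g k\<close>, and \<open>v\<close> lies in the closure of \<open>F a\<close>. The closed
  graph along a constant sequence shows that \<open>F a\<close> is closed.\<close>

lemma convex_limit_in_value:
  fixes F :: "'b::banach \<Rightarrow> 'b set"
  assumes cl: "sequentially_closedin (prod_topology euclidean weak_topology) {(x, y). y \<in> F x}"
    and conv: "convex (F a)"
    and x: "x \<longlonglongrightarrow> a" and w: "compact (closure (range w))" "\<And>n. w n \<in> F (x n)"
    and g: "\<And>k C. convex C \<Longrightarrow> (\<And>j. k \<le> j \<Longrightarrow> w j \<in> C) \<Longrightarrow> g k \<in> C" "g \<longlonglongrightarrow> v"
  shows "v \<in> F a"
proof -
  define S where "S e = (\<Union>z\<in>F a. \<Union>b\<in>ball 0 e. {z + b})" for e :: real
  have conv_S: "convex (S e)" for e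
    unfolding S_def by (intro convex_sums conv convex_ball)
  have ev: "\<exists>N. \<forall>j\<ge>N. w j \<in> S e" if e: "0 < e" for e
  proof (rule ccontr)
    assume "\<not> (\<exists>N. \<forall>j\<ge>N. w j \<in> S e)"
    then have "\<forall>N. \<exists>j>N. w j \<notin> S e" by (meson less_imp_le_nat lessI order_le_less_trans Suc_le_eq)
    then have "infinite {j. w j \<notin> S e}" unfolding infinite_nat_iff_unbounded by simp
    then obtain \<rho> :: "nat \<Rightarrow> nat" where \<rho>: "strict_mono \<rho>" "\<And>n. w (\<rho> n) \<notin> S e"
      using infinite_enumerate[of "{j. w j \<notin> S e}"] by auto
    have "\<forall>n. (w \<circ> \<rho>) n \<in> closure (range w)" by (auto intro: subsetD[OF closure_subset])
    then obtain l \<tau> where l: "strict_mono \<tau>" "((w \<circ> \<rho>) \<circ> \<tau>) \<longlonglongrightarrow> l"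
      using w(1) unfolding compact_def by blast
    have mono: "strict_mono (\<rho> \<circ> \<tau>)" by (rule strict_mono_o[OF \<rho>(1) l(1)])
    have "l \<in> F a"
      by (rule sequentially_closedin_norm_weakD[OF cl LIMSEQ_subseq_LIMSEQ[OF x mono] l(2)])
        (simp add: w(2))
    obtain n where "dist (((w \<circ> \<rho>) \<circ> \<tau>) n) l < e"
      using l(2) e by (meson metric_LIMSEQ_D order_refl)
    then have "w (\<rho> (\<tau> n)) \<in> S e"
      using \<open>l \<in> F a\<close> unfolding S_def
      by (intro UN_I[of l] UN_I[of "w (\<rho> (\<tau> n)) - l"]) (auto simp: dist_norm norm_minus_commute)
    with \<rho>(2) show False by blast
  qed
  have "\<exists>z\<in>F a. dist z v < e" if e: "0 < e" for e
  proof -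
    obtain N where N: "\<And>j. N \<le> j \<Longrightarrow> w j \<in> S (e / 2)" using ev[of "e / 2"] e by auto
    obtain N' where N': "\<And>j. N' \<le> j \<Longrightarrow> dist (g j) v < e / 2" using g(2) e by (meson metric_LIMSEQ_D half_gt_zero)
    let ?n = "max N N'"
    have "g ?n \<in> S (e / 2)" by (rule g(1)[OF conv_S]) (use N in auto)
    then obtain z where z: "z \<in> F a" "dist z (g ?n) < e / 2" by (auto simp: S_def dist_norm)
    with N'[of ?n] dist_triangle[of z v "g ?n"] have "dist z v < e" by simp
    with z(1) show ?thesis by blast
  qed
  then have "v \<in> closure (F a)" by (simp add: closure_approachable)
  then obtain z where z: "\<And>n. z n \<in> F a" "z \<longlonglongrightarrow> v" unfolding closure_sequential by blast
  show ?thesis by (rule sequentially_closedin_norm_weakD[OF cl tendsto_const z(2) z(1)])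
qed

lemma AE_limit_in_closure:
  assumes s: "AE x in M. (\<lambda>n. s n x) \<longlonglongrightarrow> f x" and S: "\<And>n x. x \<in> space M \<Longrightarrow> s n x \<in> closure D"
  shows "AE x in M. f x \<in> closure D"
  using s AE_space
proof eventually_elim
  case (elim x)
  show ?case by (rule closed_sequentially[OF closed_closure _ elim(1)]) (rule S[OF elim(2)])
qed

text \<open>In \<open>F_mnc\<close>, condition (5) is recorded through the integrability of
  \<open>(\<bar>\<eta> t\<bar> * \<bar>Lp_norm r M (k t)\<bar>) powr q\<close>, which is the
  coefficient of the Gronwall inequality.\<close>

locale volterra_compact = volterra +
  assumes T_pos: "0 < T"
    and F_convex: "\<And>t x. t \<in> {0..T} \<Longrightarrow> convex (F t x)"
    and F_closed: "AE t in M. sequentially_closedin (prod_topology euclidean weak_topology) {(x, y). y \<in> F t x}"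
    and F_mnc: "\<And>E. subspace E \<Longrightarrow> closed E \<Longrightarrow> separable_space (top_of_set E) \<Longrightarrow>
      \<exists>\<eta> :: real \<Rightarrow> real. integrable M (\<lambda>t. (\<bar>\<eta> t\<bar> * \<bar>Lp_norm r M (k t)\<bar>) powr q) \<and>
        (\<forall>\<Omega>. bounded \<Omega> \<and> \<Omega> \<subseteq> E \<longrightarrow>
          (AE t in M. ball_mnc E ((\<Union>x\<in>\<Omega>. F t x) \<inter> E) \<le> ereal (\<eta> t) * ball_mnc E \<Omega>))"
begin

text \<open>A value of the simple function \<open>k' n\<close> is itself an operator-valued function
  of \<open>s\<close>. Together these values form a countable family, small enough for a diagonal
  argument and for an invariant separable subspace.\<close>

definition kernel_values :: "(real \<Rightarrow> 'a \<Rightarrow>\<^sub>L 'a) set" where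
  "kernel_values = (\<Union>n. k' n ` {0..T})"

lemma countable_kernel_values: "countable kernel_values"
  using k'_simple by (auto simp: kernel_values_def simple_function_def countable_finite)

lemma kernel_values_Lr: "g \<in> kernel_values \<Longrightarrow> g \<in> Lp_space r M"
  using k'_Lr by (auto simp: kernel_values_def)

text \<open>Simple approximations of \<open>w\<close>, \<open>h\<close> and the functions in
  \<open>kernel_values\<close> have countably many values in total, and so has
  \<open>\<sigma>\<close>. Limits stay in the closed subspace, and for almost all \<open>s\<close>
  the operator \<open>g s\<close> leaves it invariant as a limit of operators that do.\<close>

lemma separable_invariant_subspace:
  fixes w \<sigma> :: "nat \<Rightarrow> real \<Rightarrow> 'a"
  assumes \<sigma>: "\<And>n. countable (\<sigma> n ` {0..T})" and w: "\<And>n. strongly_measurable M (w n)"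
  obtains d :: "nat \<Rightarrow> 'a" where "subspace (closure (range d))"
    "AE t in M. \<forall>n. \<sigma> n t \<in> closure (range d)" "AE t in M. \<forall>n. w n t \<in> closure (range d)"
    "AE t in M. h t \<in> closure (range d)"
    "\<And>g. g \<in> kernel_values \<Longrightarrow> AE s in M. \<forall>x\<in>closure (range d). blinfun_apply (g s) x \<in> closure (range d)"
proof -
  obtain hs where hs: "\<And>j::nat. simple_function M (hs j)" "AE t in M. (\<lambda>j. hs j t) \<longlonglongrightarrow> h t"
    using h_meas unfolding strongly_measurable_def by blast
  have "\<forall>n. \<exists>s. (\<forall>j::nat. simple_function M (s j)) \<and> (AE t in M. (\<lambda>j. s j t) \<longlonglongrightarrow> w n t)"
    using w unfolding strongly_measurable_def by blast
  from choice[OF this] obtain ws where ws: "\<And>n j. simple_function M (ws n j)"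
    "\<And>n. AE t in M. (\<lambda>j. ws n j t) \<longlonglongrightarrow> w n t" by blast
  have "\<forall>g\<in>kernel_values. \<exists>s. (\<forall>j::nat. simple_function M (s j)) \<and> (AE t in M. (\<lambda>j. s j t) \<longlonglongrightarrow> g t)"
    using kernel_values_Lr by (auto simp: Lp_space_def strongly_measurable_def)
  from bchoice[OF this] obtain gs where gs: "\<And>g j. g \<in> kernel_values \<Longrightarrow> simple_function M (gs g j)"
    "\<And>g. g \<in> kernel_values \<Longrightarrow> AE t in M. (\<lambda>j. gs g j t) \<longlonglongrightarrow> g t" by blast
  have fin: "countable (s ` {0..T})" if "simple_function M s" for s :: "real \<Rightarrow> 'z"
    using that by (auto simp: simple_function_def countable_finite)
  define S where "S = (\<Union>n. \<sigma> n ` {0..T}) \<union> (\<Union>n. \<Union>j. ws n j ` {0..T}) \<union> (\<Union>j. hs j ` {0..T})"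
  define \<A> where "\<A> = (\<Union>g\<in>kernel_values. \<Union>j. gs g j ` {0..T})"
  have "countable S" unfolding S_def
    by (intro countable_Un countable_UN) (auto intro: fin ws hs \<sigma>)
  moreover have "countable \<A>" unfolding \<A>_def
    by (intro countable_UN countable_kernel_values) (auto intro: fin gs)
  ultimately obtain d :: "nat \<Rightarrow> 'a" where d: "subspace (closure (range d))" "S \<subseteq> closure (range d)"
    "\<And>A x. A \<in> \<A> \<Longrightarrow> x \<in> closure (range d) \<Longrightarrow> blinfun_apply A x \<in> closure (range d)"
    by (rule countable_dense_invariant_subspace) blast
  have wS: "ws n j t \<in> closure (range d)" if t: "t \<in> space M" for n j t
  proof -
    have "ws n j t \<in> (\<Union>n. \<Union>j. ws n j ` {0..T})" using t unfolding space_M by blast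
    then have "ws n j t \<in> S" unfolding S_def by simp
    then show ?thesis by (rule subsetD[OF d(2)])
  qed
  have hS: "hs j t \<in> closure (range d)" if t: "t \<in> space M" for j t
  proof -
    have "hs j t \<in> (\<Union>j. hs j ` {0..T})" using t unfolding space_M by blast
    then have "hs j t \<in> S" unfolding S_def by simp
    then show ?thesis by (rule subsetD[OF d(2)])
  qed
  show thesis
  proof (rule that[OF d(1)])
    show "AE t in M. \<forall>n. \<sigma> n t \<in> closure (range d)"
    proof (intro AE_I2 allI)
      fix t n assume "t \<in> space M"
      then have "\<sigma> n t \<in> S" unfolding S_def space_M by blast
      then show "\<sigma> n t \<in> closure (range d)" using d(2) by blast
    qed
    have "AE t in M. w n t \<in> closure (range d)" for n
      by (rule AE_limit_in_closure[OF ws(2) wS])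
    then show "AE t in M. \<forall>n. w n t \<in> closure (range d)" by (simp add: AE_all_countable)
    show "AE t in M. h t \<in> closure (range d)"
      by (rule AE_limit_in_closure[OF hs(2) hS])
    fix g assume g: "g \<in> kernel_values"
    show "AE s in M. \<forall>x\<in>closure (range d). blinfun_apply (g s) x \<in> closure (range d)"
      using gs(2)[OF g] AE_space
    proof eventually_elim
      case (elim s)
      show ?case
      proof
        fix x assume x: "x \<in> closure (range d)"
        have \<A>: "gs g j s \<in> \<A>" for j using elim(2) g unfolding \<A>_def space_M by blast
        have "(\<lambda>j. blinfun_apply (gs g j s) x) \<longlonglongrightarrow> blinfun_apply (g s) x"
          by (intro tendsto_intros elim)
        then show "blinfun_apply (g s) x \<in> closure (range d)"
          by (rule closed_sequentially[OF closed_closure d(3)[OF \<A> x]])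
      qed
    qed
  qed
qed

text \<open>The Gronwall step. Along approximate solutions the measure of noncompactness \<open>\<zeta>\<close> of the
  selections satisfies \<open>\<zeta> t \<le> \<bar>\<eta> t\<bar> \<parallel>k t\<parallel>\<^sub>r (\<integral>\<^sub>0\<^sup>t \<zeta>\<^sup>q)\<^sup>1\<^sup>/\<^sup>q\<close>.\<close>

lemma AE_seq_mnc_selections_eq_0:
  assumes sel: "\<And>n t. t \<in> {0..T} \<Longrightarrow> w n t \<in> F t (\<sigma> n t)"
    and w: "\<And>n. strongly_measurable M (w n)" "\<And>n. AE t in M. norm (w n t) \<le> G t"
    and lim: "AE t in M. (\<lambda>n. \<sigma> n t - (h t + kernel_integral (w n) t)) \<longlonglongrightarrow> 0"
    and E: "subspace (closure (range d))"
    and \<sigma>E: "AE t in M. \<forall>n. \<sigma> n t \<in> closure (range d)"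
    and wE: "AE t in M. \<forall>n. w n t \<in> closure (range d)"
    and hE: "AE t in M. h t \<in> closure (range d)"
    and gE: "\<And>g. g \<in> kernel_values \<Longrightarrow>
      AE s in M. \<forall>x\<in>closure (range d). blinfun_apply (g s) x \<in> closure (range d)"
  shows "AE t in M. seq_mnc d (\<lambda>n. w n t) = 0"
    and "\<And>g. g \<in> kernel_values \<Longrightarrow>
      seq_mnc d (\<lambda>n. strong_integral M (\<lambda>s. blinfun_apply (g s) (w n s))) = 0"
proof -
  let ?E = "closure (range d)"
  note [measurable] = G_meas
  define \<zeta> where "\<zeta> s = enn2real (seq_mnc d (\<lambda>n. w n s))" for s
  have [measurable]: "(\<lambda>s. seq_mnc d (\<lambda>n. w n s)) \<in> borel_measurable M"
    by (rule borel_measurable_seq_mnc[OF w(1)])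
  have \<zeta>_meas [measurable]: "\<zeta> \<in> borel_measurable M" unfolding \<zeta>_def by measurable
  have \<zeta>0: "0 \<le> \<zeta> s" for s by (simp add: \<zeta>_def)
  have wG: "AE s in M. \<forall>n. norm (w n s) \<le> G s" using w(2) by (simp add: AE_all_countable)
  \<comment> \<open>The bound by \<open>G\<close> makes the measure of noncompactness finite almost
    everywhere, so nothing is lost in \<open>enn2real\<close>.\<close>
  have \<zeta>: "AE s in M. seq_mnc d (\<lambda>n. w n s) = ennreal (\<zeta> s) \<and> \<zeta> s \<le> G s"
    using wG
  proof eventually_elim
    case (elim s)
    have le: "seq_mnc d (\<lambda>n. w n s) \<le> ennreal (G s)"
      using elim by (intro seq_mnc_le_bound always_eventually) auto
    then have "seq_mnc d (\<lambda>n. w n s) < top" by (rule order_le_less_trans) simp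
    with le show ?case using G_nonneg
      by (auto simp: \<zeta>_def enn2real_leI)
  qed
  have \<zeta>q: "integrable M (\<lambda>s. \<zeta> s powr q)"
  proof (rule Bochner_Integration.integrable_bound[OF G_int])
    show "AE s in M. norm (\<zeta> s powr q) \<le> norm (G s powr q)"
      using \<zeta> by eventually_elim (use \<zeta>0 q in \<open>auto intro!: powr_mono2\<close>)
  qed measurable
  have \<zeta>W: "(\<integral>s. \<zeta> s powr q \<partial>M) powr (1 / q) \<le> W"
    unfolding W_def
  proof (rule powr_mono2)
    show "(\<integral>s. \<zeta> s powr q \<partial>M) \<le> (\<integral>s. G s powr q \<partial>M)"
    proof (rule integral_mono_AE[OF \<zeta>q G_int])
      show "AE s in M. \<zeta> s powr q \<le> G s powr q"
        using \<zeta> by eventually_elim (use \<zeta>0 q in \<open>auto intro!: powr_mono2\<close>)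
    qed
  qed (use q in \<open>auto intro!: integral_nonneg_AE\<close>)
  have mnc_g: "seq_mnc d (\<lambda>n. strong_integral M (\<lambda>s. blinfun_apply (g s) (w n s)))
      \<le> ennreal (\<integral>s. norm (g s) * \<zeta> s \<partial>M)" if g: "g \<in> kernel_values" for g
  proof -
    note gL = kernel_values_Lr[OF g]
    have sm: "strongly_measurable M (\<lambda>s. blinfun_apply (g s) (w n s))" for n
      using gL w(1) by (intro strongly_measurable_blinfun_apply) (auto simp: Lp_space_def)
    have "seq_mnc d (\<lambda>n. strong_integral M (\<lambda>s. blinfun_apply (g s) (w n s)))
        \<le> (\<integral>\<^sup>+s. seq_mnc d (\<lambda>n. blinfun_apply (g s) (w n s)) \<partial>M)"
      by (rule seq_mnc_strong_integral_le[OF sm Lp_space_Holder(1)[OF q r gL G_meas G_nonneg G_int]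
            norm_blinfun_AE_le[OF w(2)]])
    also have "\<dots> \<le> (\<integral>\<^sup>+s. ennreal (norm (g s) * \<zeta> s) \<partial>M)"
    proof (rule nn_integral_mono_AE)
      show "AE s in M. seq_mnc d (\<lambda>n. blinfun_apply (g s) (w n s)) \<le> ennreal (norm (g s) * \<zeta> s)"
        using gE[OF g] \<zeta>
      proof eventually_elim
        case (elim s)
        have "seq_mnc d (\<lambda>n. blinfun_apply (g s) (w n s)) \<le> ennreal (norm (g s)) * seq_mnc d (\<lambda>n. w n s)"
          by (rule seq_mnc_blinfun_le[OF E]) (use elim in auto)
        also have "\<dots> = ennreal (norm (g s) * \<zeta> s)" using elim \<zeta>0 by (simp add: ennreal_mult)
        finally show ?case .
      qed
    qed
    also have "\<dots> = ennreal (\<integral>s. norm (g s) * \<zeta> s \<partial>M)"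
      by (rule nn_integral_eq_integral[OF Lp_space_Holder(1)[OF q r gL \<zeta>_meas \<zeta>0 \<zeta>q]]) (use \<zeta>0 in auto)
    finally show ?thesis .
  qed
  have mnc_\<sigma>: "AE t in M. seq_mnc d (\<lambda>n. \<sigma> n t) \<le> ennreal (\<integral>s. norm (k t s) * \<zeta> s \<partial>M)"
    using k'_lim lim hE AE_space
  proof eventually_elim
    case (elim t)
    have t: "t \<in> {0..T}" using elim(4) by simp
    define e where "e m = \<bar>Lp_norm r M (\<lambda>u. k' m t u - k t u)\<bar> * W" for m
    let ?I = "\<integral>s. norm (k t s) * \<zeta> s \<partial>M"
    have W0: "0 \<le> W" unfolding W_def by simp
    have e0: "0 \<le> e m" for m using W0 by (simp add: e_def)
    have I0: "0 \<le> ?I" using \<zeta>0 by (intro integral_nonneg_AE) auto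
    \<comment> \<open>The detour over \<open>k' m t\<close> is taken because invariance of the
      subspace is known for the functions in \<open>kernel_values\<close>. It costs
      \<open>e m\<close> twice: once for exchanging the kernels in the integral, once for returning
      to \<open>norm (k t s)\<close> in the bound. The term \<open>\<delta>\<close> pays for the
      approximate solution.\<close>
    have step: "seq_mnc d (\<lambda>n. \<sigma> n t) \<le> ennreal (?I + (2 * e m + \<delta>))" if \<delta>: "0 < \<delta>" for m \<delta>
    proof -
      have g: "k' m t \<in> kernel_values" using t unfolding kernel_values_def by blast
      let ?z = "\<lambda>n. strong_integral M (\<lambda>s. blinfun_apply (k' m t s) (w n s))"
      have "eventually (\<lambda>n. norm (\<sigma> n t - (h t + kernel_integral (w n) t)) < \<delta>) sequentially"
        using tendsto_norm[OF elim(2)] \<delta> by (intro order_tendstoD(2)[where y = 0]) auto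
      then have "eventually (\<lambda>n. norm (\<sigma> n t - (h t + ?z n)) \<le> e m + \<delta>) sequentially"
      proof eventually_elim
        case (elim n)
        have "norm (?z n - kernel_integral (w n) t) \<le> e m"
          unfolding e_def by (rule norm_approx_kernel_integral_le[OF w t k'_Lr[OF t]])
        moreover have "norm (\<sigma> n t - (h t + ?z n))
            \<le> norm (\<sigma> n t - (h t + kernel_integral (w n) t)) + norm (?z n - kernel_integral (w n) t)"
          using norm_triangle_ineq4[of "\<sigma> n t - (h t + kernel_integral (w n) t)" "?z n - kernel_integral (w n) t"]
          by (simp add: algebra_simps)
        ultimately show ?case using elim by linarith
      qed
      then have "seq_mnc d (\<lambda>n. \<sigma> n t) \<le> seq_mnc d ?z + ennreal (e m + \<delta>)"
        using e0[of m] \<delta> elim(3) by (intro seq_mnc_perturb_le[OF E]) auto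
      also have "\<dots> \<le> ennreal (\<integral>s. norm (k' m t s) * \<zeta> s \<partial>M) + ennreal (e m + \<delta>)"
        by (intro add_right_mono mnc_g g)
      also have "(\<integral>s. norm (k' m t s) * \<zeta> s \<partial>M) \<le> ?I + e m"
      proof -
        note H = Lp_space_Holder[OF q r _ \<zeta>_meas \<zeta>0 \<zeta>q]
        have dL: "(\<lambda>u. k' m t u - k t u) \<in> Lp_space r M"
          by (intro Lp_space_diff r(1) k'_Lr k_Lr t)
        have "(\<integral>s. norm (k' m t s) * \<zeta> s \<partial>M) \<le> (\<integral>s. norm (k t s) * \<zeta> s + norm (k' m t s - k t s) * \<zeta> s \<partial>M)"
        proof (rule integral_mono)
          fix s
          have "norm (k' m t s) \<le> norm (k t s) + norm (k' m t s - k t s)"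
            using norm_triangle_ineq[of "k t s" "k' m t s - k t s"] by simp
          from mult_right_mono[OF this \<zeta>0[of s]]
          show "norm (k' m t s) * \<zeta> s \<le> norm (k t s) * \<zeta> s + norm (k' m t s - k t s) * \<zeta> s"
            by (simp add: distrib_right)
        qed (intro Bochner_Integration.integrable_add H(1) dL k'_Lr k_Lr t)+
        also have "\<dots> = ?I + (\<integral>s. norm (k' m t s - k t s) * \<zeta> s \<partial>M)"
          by (rule Bochner_Integration.integral_add) (intro H(1) dL k_Lr t)+
        also have "(\<integral>s. norm (k' m t s - k t s) * \<zeta> s \<partial>M)
            \<le> \<bar>Lp_norm r M (\<lambda>u. k' m t u - k t u)\<bar> * (\<integral>s. \<zeta> s powr q \<partial>M) powr (1 / q)"
          by (rule H(2)[OF dL])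
        also have "\<dots> \<le> e m" unfolding e_def using \<zeta>W by (intro mult_left_mono) auto
        finally show ?thesis by simp
      qed
      finally have "seq_mnc d (\<lambda>n. \<sigma> n t) \<le> ennreal (?I + e m) + ennreal (e m + \<delta>)"
        by (simp add: add_right_mono ennreal_leI)
      also have "\<dots> = ennreal (?I + (2 * e m + \<delta>))"
        using I0 e0[of m] \<delta> by (subst ennreal_plus[symmetric]) (auto simp: algebra_simps)
      finally show ?thesis .
    qed
    show ?case
    proof (rule ennreal_le_epsilon)
      fix \<epsilon> :: real assume \<epsilon>: "0 < \<epsilon>"
      have "e \<longlonglongrightarrow> 0" unfolding e_def using tendsto_mult_right[OF tendsto_rabs[OF elim(1)], of W] by simp
      then have "eventually (\<lambda>m. e m < \<epsilon> / 4) sequentially" using \<epsilon> by (intro order_tendstoD) auto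
      then obtain m where "e m < \<epsilon> / 4" using eventually_happens'[OF sequentially_bot] by blast
      then have "ennreal (?I + (2 * e m + \<epsilon> / 2)) \<le> ennreal (?I + \<epsilon>)" by (intro ennreal_leI) simp
      with step[of "\<epsilon> / 2" m] \<epsilon> have "seq_mnc d (\<lambda>n. \<sigma> n t) \<le> ennreal (?I + \<epsilon>)"
        by (meson half_gt_zero order_trans)
      then show "seq_mnc d (\<lambda>n. \<sigma> n t) \<le> ennreal ?I + ennreal \<epsilon>" using I0 \<epsilon> by simp
    qed
  qed
  obtain \<eta> :: "real \<Rightarrow> real" where \<eta>: "integrable M (\<lambda>t. (\<bar>\<eta> t\<bar> * \<bar>Lp_norm r M (k t)\<bar>) powr q)"
    "\<And>\<Omega>. bounded \<Omega> \<Longrightarrow> \<Omega> \<subseteq> ?E \<Longrightarrow>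
       AE t in M. ball_mnc ?E ((\<Union>x\<in>\<Omega>. F t x) \<inter> ?E) \<le> ereal (\<eta> t) * ball_mnc ?E \<Omega>"
    using F_mnc[OF E closed_closure separable_space_closure_range] by blast
  let ?\<Omega> = "\<lambda>C e. ?E \<inter> (\<Union>c\<in>C. ball c (e::real))"
  let ?Cs = "{C. finite C \<and> C \<subseteq> range d}"
  have cC: "countable ?Cs" by (rule countable_Collect_finite_subset) simp
  \<comment> \<open>The null set in (5) depends on the test set; a countable family leaves a common
    one.\<close>
  have "AE t in M. \<forall>C\<in>?Cs. \<forall>e\<in>\<rat>.
      ball_mnc ?E ((\<Union>x\<in>?\<Omega> C e. F t x) \<inter> ?E) \<le> ereal (\<eta> t) * ball_mnc ?E (?\<Omega> C e)"
    unfolding AE_ball_countable[OF cC] AE_ball_countable[OF countable_rat]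
    by (intro ballI \<eta>(2) bounded_subset[OF bounded_UN Int_lower2]) auto
  then have mnc_w: "AE t in M. seq_mnc d (\<lambda>n. w n t) \<le> ennreal \<bar>\<eta> t\<bar> * seq_mnc d (\<lambda>n. \<sigma> n t)"
    using \<sigma>E wE mnc_\<sigma> AE_space
  proof eventually_elim
    case (elim t)
    have t: "t \<in> {0..T}" using elim(5) by simp
    show ?case
    proof (rule seq_mnc_selection_le[OF E])
      show "seq_mnc d (\<lambda>n. \<sigma> n t) < \<infinity>" using elim(4) by (rule order_le_less_trans) simp
      show "w n t \<in> F t (\<sigma> n t)" for n by (rule sel[OF t])
    qed (use elim in auto)
  qed
  let ?Z = "\<lambda>t. \<integral>s. indicator {..t} s * \<zeta> s powr q \<partial>M"
  have "AE t in M. \<zeta> t powr q \<le> (\<bar>\<eta> t\<bar> * \<bar>Lp_norm r M (k t)\<bar>) powr q * ?Z t"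
    using mnc_w mnc_\<sigma> \<zeta> AE_space
  proof eventually_elim
    case (elim t)
    have t: "t \<in> {0..T}" using elim(4) by simp
    let ?\<phi> = "\<lambda>s. indicator {..t} s * \<zeta> s"
    let ?I = "\<integral>s. norm (k t s) * \<zeta> s \<partial>M"
    have [measurable]: "{..t} \<inter> space M \<in> sets M" by (auto simp: M_def sets_restrict_space)
    have \<phi>m: "?\<phi> \<in> borel_measurable M" by measurable
    have p: "?\<phi> s powr q = indicator {..t} s * \<zeta> s powr q" for s by (simp add: indicator_def)
    have "integrable M (\<lambda>s. indicator ({..t} \<inter> space M) s *\<^sub>R \<zeta> s powr q)"
      by (rule integrable_mult_indicator[OF _ \<zeta>q]) measurable
    then have \<phi>i: "integrable M (\<lambda>s. ?\<phi> s powr q)"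
      by (rule Bochner_Integration.integrable_cong[THEN iffD1, rotated 2]) (auto simp: indicator_def)
    have \<phi>0: "0 \<le> ?\<phi> s" for s using \<zeta>0 by simp
    have Z0: "0 \<le> ?Z t" by (intro integral_nonneg_AE) auto
    \<comment> \<open>Causality inserts the indicator of \<open>{..t}\<close>, which gives the bound
      its Volterra form.\<close>
    have "?I = (\<integral>s. norm (k t s) * ?\<phi> s \<partial>M)"
      using causal[OF t] by (intro Bochner_Integration.integral_cong) (auto simp: indicator_def not_le)
    also have "\<dots> \<le> \<bar>Lp_norm r M (k t)\<bar> * (\<integral>s. ?\<phi> s powr q \<partial>M) powr (1 / q)"
      by (rule Lp_space_Holder(2)[OF q r k_Lr[OF t] \<phi>m \<phi>0 \<phi>i])
    finally have I: "?I \<le> \<bar>Lp_norm r M (k t)\<bar> * ?Z t powr (1 / q)" by (simp only: p)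
    have I0: "0 \<le> ?I" using \<zeta>0 by (intro integral_nonneg_AE) auto
    have "ennreal (\<zeta> t) \<le> ennreal \<bar>\<eta> t\<bar> * ennreal ?I"
      using elim(1,3) mult_left_mono[OF elim(2), of "ennreal \<bar>\<eta> t\<bar>"] by (metis order_trans zero_le)
    also have "\<dots> = ennreal (\<bar>\<eta> t\<bar> * ?I)" using I0 by (simp add: ennreal_mult)
    finally have "\<zeta> t \<le> \<bar>\<eta> t\<bar> * ?I" using I0 by (subst (asm) ennreal_le_iff) auto
    also have "\<dots> \<le> \<bar>\<eta> t\<bar> * (\<bar>Lp_norm r M (k t)\<bar> * ?Z t powr (1 / q))"
      by (intro mult_left_mono I) simp
    finally have "\<zeta> t powr q \<le> (\<bar>\<eta> t\<bar> * (\<bar>Lp_norm r M (k t)\<bar> * ?Z t powr (1 / q))) powr q"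
      using \<zeta>0 q by (intro powr_mono2) auto
    also have "\<dots> = (\<bar>\<eta> t\<bar> * \<bar>Lp_norm r M (k t)\<bar>) powr q * ?Z t"
      using q Z0 by (simp add: powr_mult powr_powr mult.assoc)
    finally show ?case .
  qed
  \<comment> \<open>The \<open>q\<close>-th power has made the inequality linear in
    \<open>\<zeta> t powr q\<close>, as the Gronwall inequality requires.\<close>
  then have "AE t in M. \<zeta> t powr q = 0"
    using \<zeta>q \<eta>(1) unfolding M_def by (intro AE_eq_0_if_Volterra_bound) auto
  then have \<zeta>_0: "AE t in M. \<zeta> t = 0" by eventually_elim simp
  then show "AE t in M. seq_mnc d (\<lambda>n. w n t) = 0" using \<zeta> by eventually_elim simp
  fix g assume g: "g \<in> kernel_values"
  have "(\<integral>s. norm (g s) * \<zeta> s \<partial>M) = 0"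
    using \<zeta>_0 by (intro integral_eq_zero_AE) (auto elim!: eventually_mono)
  with mnc_g[OF g] show "seq_mnc d (\<lambda>n. strong_integral M (\<lambda>s. blinfun_apply (g s) (w n s))) = 0"
    by simp
qed

end

context volterra_compact
begin

text \<open>A diagonal subsequence handles the countable family \<open>kernel_values\<close>. The
  approximation error of \<open>k' m t\<close> is uniform in the selections, so the integrals with
  \<open>k t\<close> are Cauchy along the same subsequence.\<close>

lemma convergent_kernel_integrals_subsequence:
  assumes w: "\<And>n. strongly_measurable M (w n)" "\<And>n. AE t in M. norm (w n t) \<le> G t"
    and E: "subspace (closure (range d))"
    and mnc: "\<And>g. g \<in> kernel_values \<Longrightarrow>
      seq_mnc d (\<lambda>n. strong_integral M (\<lambda>s. blinfun_apply (g s) (w n s))) = 0"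
  obtains \<rho> :: "nat \<Rightarrow> nat" where "strict_mono \<rho>"
    "AE t in M. convergent (\<lambda>n. kernel_integral (w (\<rho> n)) t)"
proof -
  let ?z = "\<lambda>g n. strong_integral M (\<lambda>s. blinfun_apply (g s) (w n s))"
  have ne: "kernel_values \<noteq> {}" using T_pos by (auto simp: kernel_values_def)
  define gg where "gg = from_nat_into kernel_values"
  have gg: "range gg = kernel_values" unfolding gg_def
    by (rule range_from_nat_into[OF ne countable_kernel_values])
  then have gg_in: "gg i \<in> kernel_values" for i by blast
  interpret S: subseqs "\<lambda>i \<rho>. convergent (\<lambda>n. ?z (gg i) (\<rho> n))"
  proof
    fix i and s :: "nat \<Rightarrow> nat" assume "strict_mono s"
    have c: "compact (closure (range (?z (gg i))))"
      by (rule compact_closure_range_if_seq_mnc_0[OF E mnc[OF gg_in]])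
    have "?z (gg i) (s n) \<in> closure (range (?z (gg i)))" for n
      by (intro subsetD[OF closure_subset] rangeI)
    from c[unfolded compact_def, rule_format, of "\<lambda>n. ?z (gg i) (s n)", OF this]
    obtain l r where r: "strict_mono r" "((\<lambda>n. ?z (gg i) (s n)) \<circ> r) \<longlonglongrightarrow> l" by (elim bexE exE conjE)
    show "\<exists>r'. strict_mono r' \<and> convergent (\<lambda>n. ?z (gg i) ((s \<circ> r') n))"
      using r(1) convergentI[OF r(2)] unfolding o_def by (intro exI[of _ r] conjI)
  qed
  let ?\<rho> = "S.diagseq"
  have conv: "convergent (\<lambda>n. ?z g (?\<rho> n))" if g: "g \<in> kernel_values" for g
  proof -
    from g obtain i where i: "g = gg i" unfolding gg[symmetric] by (rule rangeE)
    have "convergent (\<lambda>n. ?z (gg i) ((?\<rho> \<circ> ((+) (Suc i))) n))"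
    proof (rule S.diagseq_holds)
      fix r s :: "nat \<Rightarrow> nat" and n assume "strict_mono r" "convergent (\<lambda>k. ?z (gg n) (s k))"
      then show "convergent (\<lambda>k. ?z (gg n) ((s \<circ> r) k))"
        using convergent_subseq_convergent[of "\<lambda>k. ?z (gg n) (s k)" r] by (simp add: o_def)
    qed
    \<comment> \<open>The diagonal sequence is known to refine the \<open>i\<close>-th choice from
      index \<open>Suc i\<close> on; the initial terms do not affect convergence.\<close>
    then have "convergent (\<lambda>n. ?z (gg i) (?\<rho> (n + Suc i)))" by (simp add: o_def add.commute)
    then show ?thesis unfolding i by (subst (asm) convergent_ignore_initial_segment)
  qed
  have "AE t in M. convergent (\<lambda>n. kernel_integral (w (?\<rho> n)) t)"
    using k'_lim AE_space
  proof eventually_elim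
    case (elim t)
    have t: "t \<in> {0..T}" using elim(2) by simp
    have "Cauchy (\<lambda>n. kernel_integral (w (?\<rho> n)) t)"
    proof (rule metric_CauchyI)
      fix e :: real assume e: "0 < e"
      have "(\<lambda>m. \<bar>Lp_norm r M (\<lambda>u. k' m t u - k t u)\<bar> * W) \<longlonglongrightarrow> 0"
        using tendsto_mult_right[OF tendsto_rabs[OF elim(1)], of W] by simp
      then have "eventually (\<lambda>m. \<bar>Lp_norm r M (\<lambda>u. k' m t u - k t u)\<bar> * W < e / 3) sequentially"
        using e by (intro order_tendstoD) auto
      then obtain m where m: "\<bar>Lp_norm r M (\<lambda>u. k' m t u - k t u)\<bar> * W < e / 3"
        using eventually_happens'[OF sequentially_bot] by blast
      have close: "dist (?z (k' m t) n) (kernel_integral (w n) t) < e / 3" for n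
        using norm_approx_kernel_integral_le[OF w t k'_Lr[OF t], of m n] m by (simp add: dist_norm)
      have "k' m t \<in> kernel_values" using t unfolding kernel_values_def by blast
      then have "Cauchy (\<lambda>n. ?z (k' m t) (?\<rho> n))" by (rule convergent_Cauchy[OF conv])
      then obtain N where N: "\<And>i j. N \<le> i \<Longrightarrow> N \<le> j \<Longrightarrow> dist (?z (k' m t) (?\<rho> i)) (?z (k' m t) (?\<rho> j)) < e / 3"
        using e unfolding Cauchy_def by (meson divide_pos_pos zero_less_numeral)
      show "\<exists>N. \<forall>i\<ge>N. \<forall>j\<ge>N. dist (kernel_integral (w (?\<rho> i)) t) (kernel_integral (w (?\<rho> j)) t) < e"
      proof (intro exI[of _ N] allI impI)
        fix i j assume ij: "N \<le> i" "N \<le> j"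
        have "dist (kernel_integral (w (?\<rho> i)) t) (kernel_integral (w (?\<rho> j)) t)
          \<le> dist (?z (k' m t) (?\<rho> i)) (kernel_integral (w (?\<rho> i)) t)
            + (dist (?z (k' m t) (?\<rho> i)) (?z (k' m t) (?\<rho> j))
            + dist (?z (k' m t) (?\<rho> j)) (kernel_integral (w (?\<rho> j)) t))"
          using dist_triangle3[of "kernel_integral (w (?\<rho> i)) t" "kernel_integral (w (?\<rho> j)) t" "?z (k' m t) (?\<rho> i)"]
            dist_triangle[of "?z (k' m t) (?\<rho> i)" "kernel_integral (w (?\<rho> j)) t" "?z (k' m t) (?\<rho> j)"]
          by linarith
        with close[of "?\<rho> i"] close[of "?\<rho> j"] N[OF ij]
        show "dist (kernel_integral (w (?\<rho> i)) t) (kernel_integral (w (?\<rho> j)) t) < e" by linarith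
      qed
    qed
    then show ?case by (rule Cauchy_convergent)
  qed
  with S.subseq_diagseq show thesis by (rule that)
qed

text \<open>The three claims are proved together because splitting the integral of a midpoint uses
  measurability and the bound by \<open>G\<close> for both parts.\<close>

lemma midpoint_closure_kernel_integral:
  assumes g: "g \<in> midpoint_closure V" and t: "t \<in> {0..T}" and C: "convex C"
    and V: "\<And>w. w \<in> V \<Longrightarrow> strongly_measurable M w" "\<And>w. w \<in> V \<Longrightarrow> AE s in M. norm (w s) \<le> G s"
      "\<And>w. w \<in> V \<Longrightarrow> kernel_integral w t \<in> C"
  shows "strongly_measurable M g \<and> (AE s in M. norm (g s) \<le> G s) \<and> kernel_integral g t \<in> C"
  using g
proof induction
  case (base w)
  then show ?case using V by blast
next
  case (midpoint u v)
  then have u: "strongly_measurable M u" "AE s in M. norm (u s) \<le> G s" "kernel_integral u t \<in> C"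
    and v: "strongly_measurable M v" "AE s in M. norm (v s) \<le> G s" "kernel_integral v t \<in> C" by auto
  let ?m = "\<lambda>s. (1 / 2) *\<^sub>R (u s + v s)"
  have "AE s in M. norm (?m s) \<le> G s"
    using u(2) v(2)
  proof eventually_elim
    case (elim s)
    then show ?case using norm_triangle_ineq[of "u s" "v s"] by simp
  qed
  moreover have "strongly_measurable M ?m"
    by (intro strongly_measurable_scaleR strongly_measurable_const strongly_measurable_add u v)
  moreover have "kernel_integral ?m t = (1 / 2) *\<^sub>R (kernel_integral u t + kernel_integral v t)"
  proof -
    note i = strongly_integrable_blinfun_G(1)[OF k_Lr[OF t]]
    have "kernel_integral ?m t
        = strong_integral M (\<lambda>s. (1 / 2) *\<^sub>R (blinfun_apply (k t s) (u s) + blinfun_apply (k t s) (v s)))"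
      unfolding kernel_integral_def by (simp add: blinfun.scaleR_right blinfun.add_right)
    also have "\<dots> = (1 / 2) *\<^sub>R strong_integral M (\<lambda>s. blinfun_apply (k t s) (u s) + blinfun_apply (k t s) (v s))"
      by (rule strong_integral_scaleR[OF strongly_integrable_add[OF i[OF u(1,2)] i[OF v(1,2)]]])
    also have "strong_integral M (\<lambda>s. blinfun_apply (k t s) (u s) + blinfun_apply (k t s) (v s))
        = kernel_integral u t + kernel_integral v t"
      unfolding kernel_integral_def by (rule strong_integral_add[OF i[OF u(1,2)] i[OF v(1,2)]])
    finally show ?thesis .
  qed
  ultimately show ?case using convex_midpoint[OF C u(3) v(3)] by simp
qed

lemma kernel_integral_dominated_convergence:
  assumes t: "t \<in> {0..T}" and g: "\<And>n. strongly_measurable M (g n)" "\<And>n. AE s in M. norm (g n s) \<le> G s"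
    and v: "strongly_measurable M v" "AE s in M. norm (v s) \<le> G s"
    and lim: "AE s in M. (\<lambda>n. g n s) \<longlonglongrightarrow> v s"
  shows "(\<lambda>n. kernel_integral (g n) t) \<longlonglongrightarrow> kernel_integral v t"
proof -
  let ?D = "\<lambda>n s. blinfun_apply (k t s) (g n s - v s)"
  note i = strongly_integrable_blinfun_G(1)[OF k_Lr[OF t]]
  have sm: "strongly_measurable M (?D n)" for n
    using k_Lr[OF t] by (intro strongly_measurable_blinfun_apply strongly_measurable_diff g v) (auto simp: Lp_space_def)
  have bound: "AE s in M. norm (?D n s) \<le> 2 * (norm (k t s) * G s)" for n
    using g(2)[of n] v(2)
  proof eventually_elim
    case (elim s)
    have "norm (?D n s) \<le> norm (k t s) * norm (g n s - v s)" by (rule norm_blinfun)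
    also have "norm (g n s - v s) \<le> 2 * G s" using norm_triangle_ineq4[of "g n s" "v s"] elim by linarith
    finally show ?case by (simp add: mult_left_mono mult.left_commute)
  qed
  have "(\<lambda>n. \<integral>s. norm (?D n s) \<partial>M) \<longlonglongrightarrow> (\<integral>s. 0 \<partial>M)"
  proof (rule integral_dominated_convergence[where w = "\<lambda>s. 2 * (norm (k t s) * G s)"])
    show "integrable M (\<lambda>s. 2 * (norm (k t s) * G s))"
      using Lp_space_Holder(1)[OF q r k_Lr[OF t] G_meas G_nonneg G_int] by simp
    show "(\<lambda>s. norm (?D n s)) \<in> borel_measurable M" for n by (rule borel_measurable_strong_norm[OF sm])
    show "AE s in M. norm (norm (?D n s)) \<le> 2 * (norm (k t s) * G s)" for n using bound by simp
    show "AE s in M. (\<lambda>n. norm (?D n s)) \<longlonglongrightarrow> 0"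
      using lim
    proof eventually_elim
      case (elim s)
      have "(\<lambda>n. norm (?D n s)) \<longlonglongrightarrow> norm (blinfun_apply (k t s) (v s - v s))"
        by (intro tendsto_intros elim)
      then show ?case by simp
    qed
  qed simp
  then have lim0: "(\<lambda>n. \<integral>s. norm (?D n s) \<partial>M) \<longlonglongrightarrow> 0" by simp
  have "(\<lambda>n. kernel_integral (g n) t - kernel_integral v t) \<longlonglongrightarrow> 0"
  proof (rule Lim_null_comparison[OF always_eventually[OF allI] lim0])
    fix n
    have D: "kernel_integral (g n) t - kernel_integral v t = strong_integral M (?D n)"
      unfolding kernel_integral_def blinfun.diff_right
      by (rule strong_integral_diff[OF i[OF g] i[OF v], symmetric])
    have "strongly_integrable M (?D n)"
      unfolding blinfun.diff_right by (rule strongly_integrable_diff[OF i[OF g] i[OF v]])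
    then show "norm (kernel_integral (g n) t - kernel_integral v t) \<le> (\<integral>s. norm (?D n s) \<partial>M)"
      unfolding D by (rule norm_strong_integral_le)
  qed
  then show ?thesis by (rule LIM_zero_cancel)
qed

text \<open>Two limits have to be matched: that of the integrals of \<open>w (\<rho> n)\<close>, and
  the integral of the limit \<open>v\<close> of the midpoint combinations. Balls are convex, so the
  integrals of the combinations have the first limit; dominated convergence gives them the second.
  Hence \<open>\<sigma> (\<rho> n) t\<close> tends to the very state at which \<open>v t\<close> has
  to be a value of \<open>F\<close>.\<close>

lemma solution_exists:
  "\<exists>v. strongly_measurable M v \<and> (AE t in M. norm (v t) \<le> G t) \<and>
    (AE t in M. v t \<in> F t (h t + kernel_integral v t))"
proof -
  obtain \<sigma> w where \<sigma>: "\<And>n::nat. countable (\<sigma> n ` {0..T})" and w: "\<And>n. strongly_measurable M (w n)"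
    and sel: "\<And>n t. t \<in> {0..T} \<Longrightarrow> w n t \<in> F t (\<sigma> n t)" and wG: "\<And>n. AE t in M. norm (w n t) \<le> G t"
    and lim: "AE t in M. (\<lambda>n. \<sigma> n t - (h t + kernel_integral (w n) t)) \<longlonglongrightarrow> 0"
    by (rule approximate_solutions) blast
  obtain d :: "nat \<Rightarrow> 'a" where E: "subspace (closure (range d))"
    and \<sigma>E: "AE t in M. \<forall>n. \<sigma> n t \<in> closure (range d)" and wE: "AE t in M. \<forall>n. w n t \<in> closure (range d)"
    and hE: "AE t in M. h t \<in> closure (range d)"
    and gE: "\<And>g. g \<in> kernel_values \<Longrightarrow> AE s in M. \<forall>x\<in>closure (range d). blinfun_apply (g s) x \<in> closure (range d)"
    by (rule separable_invariant_subspace[of \<sigma> w, OF \<sigma> w]) blast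
  have mnc0: "AE t in M. seq_mnc d (\<lambda>n. w n t) = 0"
    by (rule AE_seq_mnc_selections_eq_0(1)[of w \<sigma>, OF sel w wG lim E \<sigma>E wE hE gE])
  have mnc_g: "seq_mnc d (\<lambda>n. strong_integral M (\<lambda>s. blinfun_apply (g s) (w n s))) = 0"
    if "g \<in> kernel_values" for g
    by (rule AE_seq_mnc_selections_eq_0(2)[of w \<sigma>, OF sel w wG lim E \<sigma>E wE hE gE that])
  obtain \<rho> :: "nat \<Rightarrow> nat" where \<rho>: "strict_mono \<rho>"
    and conv: "AE t in M. convergent (\<lambda>n. kernel_integral (w (\<rho> n)) t)"
    by (rule convergent_kernel_integrals_subsequence[OF w wG E mnc_g])
  have compact: "AE t in M. compact (closure (range (\<lambda>n. w (\<rho> n) t)))"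
    using mnc0
  proof eventually_elim
    case (elim t)
    have c: "compact (closure (range (\<lambda>n. w n t)))"
      by (rule compact_closure_range_if_seq_mnc_0[OF E elim])
    have "closure (range (\<lambda>n. w (\<rho> n) t)) \<subseteq> closure (range (\<lambda>n. w n t))"
      by (rule closure_mono) auto
    with compact_Int_closed[OF c closed_closure[of "range (\<lambda>n. w (\<rho> n) t)"]] show ?case
      by (simp add: Int_absorb1)
  qed
  have mnc\<rho>: "AE t in M. seq_mnc d (\<lambda>n. w (\<rho> n) t) = 0"
    using mnc0
  proof eventually_elim
    case (elim t)
    have "seq_mnc d (\<lambda>n. w (\<rho> n) t) \<le> seq_mnc d (\<lambda>n. w n t)"
      unfolding seq_mnc_def
      by (rule INF_mono') (rule limsup_subseq_mono[OF \<rho>, unfolded o_def])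
    then show ?case using elim by simp
  qed
  have wE': "AE x in M. w (\<rho> n) x \<in> closure (range d)" for n using wE by eventually_elim blast
  obtain g where g: "\<And>k. g k \<in> midpoint_closure ((\<lambda>n. w (\<rho> n)) ` {k..})"
    and gconv: "AE x in M. convergent (\<lambda>k. g k x)"
    using AE_convergent_midpoint_combinations[OF E w G_meas wG wE' mnc\<rho>] by blast
  define v where "v t = lim (\<lambda>k. g k t)" for t
  have gv: "AE t in M. (\<lambda>k. g k t) \<longlonglongrightarrow> v t"
    using gconv by eventually_elim (simp add: v_def convergent_LIMSEQ_iff)
  have gC: "strongly_measurable M (g n) \<and> (AE s in M. norm (g n s) \<le> G s) \<and> kernel_integral (g n) t \<in> C"
    if "t \<in> {0..T}" "convex C" "\<And>j. n \<le> j \<Longrightarrow> kernel_integral (w (\<rho> j)) t \<in> C" for n t C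
    by (rule midpoint_closure_kernel_integral[OF g that(1,2)]) (use w wG that(3) in auto)
  \<comment> \<open>The choice \<open>t = 0\<close> and \<open>C = UNIV\<close> keeps just the
    measurability and the bound.\<close>
  have gm: "strongly_measurable M (g n)" "AE s in M. norm (g n s) \<le> G s" for n
    using gC[of 0 UNIV n] T_pos by auto
  have v: "strongly_measurable M v"
    by (rule strongly_measurable_AE_limit[OF finite_measure_axioms complete_measure_axioms gm(1) gv])
  have vG: "AE t in M. norm (v t) \<le> G t"
  proof -
    have "AE t in M. \<forall>n. norm (g n t) \<le> G t" using gm(2) by (simp add: AE_all_countable)
    then show ?thesis using gv
      by eventually_elim (rule LIMSEQ_le_const2[OF tendsto_norm], auto)
  qed
  have "AE t in M. v t \<in> F t (h t + kernel_integral v t)"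
    using conv compact gv lim F_closed AE_space
  proof eventually_elim
    case (elim t)
    have t: "t \<in> {0..T}" using elim(6) by simp
    obtain y where y: "(\<lambda>n. kernel_integral (w (\<rho> n)) t) \<longlonglongrightarrow> y" using elim(1) by (auto simp: convergent_def)
    have "(\<lambda>n. kernel_integral (g n) t) \<longlonglongrightarrow> y"
    proof (rule metric_LIMSEQ_I)
      fix e :: real assume "0 < e"
      then obtain N where N: "\<And>j. N \<le> j \<Longrightarrow> dist (kernel_integral (w (\<rho> j)) t) y < e"
        using metric_LIMSEQ_D[OF y] by blast
      have "kernel_integral (g n) t \<in> ball y e" if "N \<le> n" for n
        using gC[OF t convex_ball, of n y e] N that by (auto simp: dist_commute)
      then show "\<exists>no. \<forall>n\<ge>no. dist (kernel_integral (g n) t) y < e" by (auto simp: dist_commute)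
    qed
    moreover have "(\<lambda>n. kernel_integral (g n) t) \<longlonglongrightarrow> kernel_integral v t"
      by (rule kernel_integral_dominated_convergence[OF t gm v vG gv])
    ultimately have yv: "y = kernel_integral v t" by (rule LIMSEQ_unique)
    have "(\<lambda>n. \<sigma> (\<rho> n) t - (h t + kernel_integral (w (\<rho> n)) t)) \<longlonglongrightarrow> 0"
      using LIMSEQ_subseq_LIMSEQ[OF elim(4) \<rho>] by (simp add: o_def)
    from tendsto_add[OF this tendsto_add[OF tendsto_const[of "h t"] y]]
    have x: "(\<lambda>n. \<sigma> (\<rho> n) t) \<longlonglongrightarrow> h t + kernel_integral v t" by (simp add: yv)
    show ?case
    proof (rule convex_limit_in_value[OF elim(5) F_convex[OF t] x elim(2) sel[OF t] _ elim(3)])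
      fix n and C :: "'a set" assume "convex C" "\<And>j. n \<le> j \<Longrightarrow> w (\<rho> j) t \<in> C"
      then show "g n t \<in> C" by (intro midpoint_closure_in_convex[OF g]) auto
    qed
  qed
  with v vG show ?thesis by blast
qed

end

section \<open>Volterra integral inclusions\<close>

lemma powr_mult_le_powr_add:
  fixes a b p q :: real
  assumes "1 \<le> q" "q < p" "0 \<le> a" "0 \<le> b"
  shows "(a * b) powr q \<le> a powr (p * q / (p - q)) + b powr p"
proof -
  let ?s = "p / (p - q)"
  have s: "1 < ?s" "1 < p / q" "1 / ?s + 1 / (p / q) = 1"
    using assms by (auto simp: field_simps)
  have "(a * b) powr q = a powr q * b powr q" using assms by (simp add: powr_mult)
  also have "\<dots> \<le> (a powr q) powr ?s / ?s + (b powr q) powr (p / q) / (p / q)"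
    by (rule Youngs_inequality[OF s]) auto
  also have "\<dots> \<le> (a powr q) powr ?s / 1 + (b powr q) powr (p / q) / 1"
    using s by (intro add_mono divide_left_mono) auto
  also have "\<dots> = a powr (p * q / (p - q)) + b powr p"
    using assms by (simp add: powr_powr mult.commute)
  finally show ?thesis .
qed

text \<open>For \<open>q < p\<close>, Young's inequality with the conjugate exponents
  \<open>p / (p - q)\<close> and \<open>p / q\<close> separates the product; for
  \<open>p = q\<close> the factor \<open>\<eta>\<close> is essentially bounded.\<close>

lemma integrable_powr_mult_Lp:
  fixes \<eta> \<kappa> :: "'a \<Rightarrow> real"
  assumes M: "finite_complete_measure M" and pq: "1 \<le> q" "q \<le> p"
    and \<eta>: "\<eta> \<in> Lp_space (if p = q then \<infinity> else ereal (p * q / (p - q))) M"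
    and \<kappa>: "\<kappa> \<in> Lp_space (ereal p) M"
  shows "integrable M (\<lambda>t. (\<bar>\<eta> t\<bar> * \<bar>\<kappa> t\<bar>) powr q)"
proof -
  interpret finite_complete_measure M by fact
  have [measurable]: "\<eta> \<in> borel_measurable M" "\<kappa> \<in> borel_measurable M"
    using \<eta> \<kappa> by (auto simp: Lp_space_def intro: strongly_measurable_real)
  have i\<kappa>: "integrable M (\<lambda>t. \<bar>\<kappa> t\<bar> powr p)" using \<kappa> by (simp add: Lp_space_def)
  show ?thesis
  proof (cases "p = q")
    case True
    then obtain C where C: "AE t in M. \<bar>\<eta> t\<bar> \<le> C" using \<eta> by (auto simp: Lp_space_def)
    show ?thesis
    proof (rule Bochner_Integration.integrable_bound[of M "\<lambda>t. C powr p * \<bar>\<kappa> t\<bar> powr p"])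
      show "AE t in M. norm ((\<bar>\<eta> t\<bar> * \<bar>\<kappa> t\<bar>) powr q) \<le> norm (C powr p * \<bar>\<kappa> t\<bar> powr p)"
        using C
      proof eventually_elim
        case (elim t)
        have "\<bar>\<eta> t\<bar> powr p \<le> C powr p" using elim pq True by (intro powr_mono2) auto
        then show ?case using True by (simp add: powr_mult mult_right_mono)
      qed
    qed (use i\<kappa> in auto)
  next
    case False
    then have i\<eta>: "integrable M (\<lambda>t. \<bar>\<eta> t\<bar> powr (p * q / (p - q)))" using \<eta> by (simp add: Lp_space_def)
    show ?thesis
    proof (rule Bochner_Integration.integrable_bound[of M "\<lambda>t. \<bar>\<eta> t\<bar> powr (p * q / (p - q)) + \<bar>\<kappa> t\<bar> powr p"])
      show "AE t in M. norm ((\<bar>\<eta> t\<bar> * \<bar>\<kappa> t\<bar>) powr q) \<le> norm (\<bar>\<eta> t\<bar> powr (p * q / (p - q)) + \<bar>\<kappa> t\<bar> powr p)"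
        using powr_mult_le_powr_add[of q p "\<bar>\<eta> _\<bar>" "\<bar>\<kappa> _\<bar>"] pq False
        by (auto intro!: AE_I2 order_trans[OF _ abs_ge_self])
    qed (use i\<kappa> i\<eta> in auto)
  qed
qed

lemma Lp_norm_affine_bound:
  fixes h :: "'a \<Rightarrow> 'b::real_normed_vector" and \<kappa> :: "'a \<Rightarrow> real"
  assumes M: "finite_complete_measure M" and p: "1 \<le> p"
    and h: "h \<in> Lp_space (ereal p) M" and \<kappa>: "\<kappa> \<in> Lp_space (ereal p) M" and W: "0 \<le> W"
  shows "integrable M (\<lambda>t. (norm (h t) + \<bar>\<kappa> t\<bar> * W) powr p)"
    and "(\<integral>t. (norm (h t) + \<bar>\<kappa> t\<bar> * W) powr p \<partial>M) powr (1 / p)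
      \<le> Lp_norm (ereal p) M h + Lp_norm (ereal p) M \<kappa> * W"
proof -
  interpret finite_complete_measure M by fact
  have [measurable]: "(\<lambda>t. norm (h t)) \<in> borel_measurable M" "\<kappa> \<in> borel_measurable M"
    using h \<kappa> by (auto simp: Lp_space_def intro: strongly_measurable_real borel_measurable_strong_norm)
  have i: "integrable M (\<lambda>t. norm (h t) powr p)" "integrable M (\<lambda>t. \<bar>\<kappa> t\<bar> powr p)"
    using h \<kappa> by (auto simp: Lp_space_def)
  have pw: "(\<bar>\<kappa> t\<bar> * W) powr p = \<bar>\<kappa> t\<bar> powr p * W powr p" for t using W by (simp add: powr_mult)
  have ik: "integrable M (\<lambda>t. (\<bar>\<kappa> t\<bar> * W) powr p)" unfolding pw using i(2) by simp
  have "(\<integral>t. (\<bar>\<kappa> t\<bar> * W) powr p \<partial>M) powr (1 / p) = Lp_norm (ereal p) M \<kappa> * W"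
    unfolding pw using W p i(2) by (simp add: Lp_norm_def powr_mult powr_powr integral_nonneg_AE)
  moreover have "(\<integral>t. norm (h t) powr p \<partial>M) powr (1 / p) = Lp_norm (ereal p) M h"
    by (simp add: Lp_norm_def)
  moreover have "(\<lambda>t. \<bar>\<kappa> t\<bar> * W) \<in> borel_measurable M" by measurable
  ultimately show "(\<integral>t. (norm (h t) + \<bar>\<kappa> t\<bar> * W) powr p \<partial>M) powr (1 / p)
      \<le> Lp_norm (ereal p) M h + Lp_norm (ereal p) M \<kappa> * W"
    "integrable M (\<lambda>t. (norm (h t) + \<bar>\<kappa> t\<bar> * W) powr p)"
    using powr_norm_Minkowski[OF p _ _ _ _ i(1) ik] W by auto
qed

text \<open>Since \<open>(u powr (p / q)) powr q = u powr p\<close>, the growth condition carries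
  \<open>L^p\<close> into \<open>L^q\<close>; Minkowski then adds the two terms.\<close>

lemma Lp_norm_growth_bound:
  fixes b u :: "'a \<Rightarrow> real"
  assumes M: "finite_complete_measure M" and pq: "1 \<le> q" "q \<le> p" and c: "0 \<le> c"
    and b: "b \<in> Lp_space (ereal q) M"
    and u: "u \<in> borel_measurable M" "\<And>t. 0 \<le> u t" "integrable M (\<lambda>t. u t powr p)"
    and B: "(\<integral>t. u t powr p \<partial>M) powr (1 / p) \<le> B"
  shows "integrable M (\<lambda>t. (\<bar>b t\<bar> + c * u t powr (p / q)) powr q)"
    and "(\<integral>t. (\<bar>b t\<bar> + c * u t powr (p / q)) powr q \<partial>M) powr (1 / q)
      \<le> Lp_norm (ereal q) M b + c * B powr (p / q)"
proof -
  interpret finite_complete_measure M by fact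
  have [measurable]: "b \<in> borel_measurable M" "u \<in> borel_measurable M"
    using b u by (auto simp: Lp_space_def intro: strongly_measurable_real)
  have ib: "integrable M (\<lambda>t. \<bar>b t\<bar> powr q)" using b by (simp add: Lp_space_def)
  have pw: "(c * u t powr (p / q)) powr q = c powr q * u t powr p" for t
    using c pq by (simp add: powr_mult powr_powr)
  have iu: "integrable M (\<lambda>t. (c * u t powr (p / q)) powr q)" unfolding pw using u(3) by simp
  let ?I = "\<integral>t. u t powr p \<partial>M"
  have I0: "0 \<le> ?I" by (intro integral_nonneg_AE) auto
  have "(\<integral>t. (c * u t powr (p / q)) powr q \<partial>M) powr (1 / q) = c * ?I powr (1 / q)"
    unfolding pw using c pq I0 u(3) by (simp add: powr_mult powr_powr)
  also have "?I powr (1 / q) = (?I powr (1 / p)) powr (p / q)"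
    using pq by (simp add: powr_powr)
  also have "c * \<dots> \<le> c * B powr (p / q)"
    using c B pq by (intro mult_left_mono powr_mono2) auto
  finally have 1: "(\<integral>t. (c * u t powr (p / q)) powr q \<partial>M) powr (1 / q) \<le> c * B powr (p / q)" .
  have 2: "(\<integral>t. \<bar>b t\<bar> powr q \<partial>M) powr (1 / q) = Lp_norm (ereal q) M b"
    by (simp add: Lp_norm_def)
  have m: "(\<lambda>t. \<bar>b t\<bar>) \<in> borel_measurable M" "(\<lambda>t. c * u t powr (p / q)) \<in> borel_measurable M"
    by measurable
  note Mink = powr_norm_Minkowski[OF pq(1) m _ _ ib iu]
  show "integrable M (\<lambda>t. (\<bar>b t\<bar> + c * u t powr (p / q)) powr q)"
    using c by (intro Mink(1)) auto
  have "(\<integral>t. (\<bar>b t\<bar> + c * u t powr (p / q)) powr q \<partial>M) powr (1 / q)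
      \<le> (\<integral>t. \<bar>b t\<bar> powr q \<partial>M) powr (1 / q) + (\<integral>t. (c * u t powr (p / q)) powr q \<partial>M) powr (1 / q)"
    using c by (intro Mink(2)) auto
  also have "\<dots> \<le> Lp_norm (ereal q) M b + c * B powr (p / q)"
    unfolding 2 by (intro add_left_mono 1)
  finally show "(\<integral>t. (\<bar>b t\<bar> + c * u t powr (p / q)) powr q \<partial>M) powr (1 / q)
      \<le> Lp_norm (ereal q) M b + c * B powr (p / q)" .
qed

theorem theorem10:
  fixes p q T R c :: real and r :: ereal
    and h :: "real \<Rightarrow> 'a::banach"
    and k :: "real \<Rightarrow> real \<Rightarrow> 'a \<Rightarrow>\<^sub>L 'a"
    and F :: "real \<Rightarrow> 'a \<Rightarrow> 'a set"
    and b :: "real \<Rightarrow> real"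
  assumes "1 \<le> q" "q \<le> p"
    and "1 < r" "1 / ereal q + 1 / r = 1"
    and "0 < T"
    and "h \<in> Lp_space (ereal p) (lebesgue_on {0..T})"
    and "\<And>t s. t \<in> {0..T} \<Longrightarrow> s \<in> {0..T} \<Longrightarrow> t < s \<Longrightarrow> k t s = 0"
    and k1: "strongly_measurable (lebesgue_on {0..T} \<Otimes>\<^sub>M lebesgue_on {0..T}) (\<lambda>(t, s). k t s)"
    and k2: "\<And>t. t \<in> {0..T} \<Longrightarrow> k t \<in> Lp_space r (lebesgue_on {0..T})"
    and k3: "k \<in> Lp_Lr_space (ereal p) r (lebesgue_on {0..T}) (lebesgue_on {0..T})"
    and F1: "\<And>t x. t \<in> {0..T} \<Longrightarrow> F t x \<noteq> {} \<and> convex (F t x)"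
    and F2: "\<And>x. \<exists>f. strongly_measurable (lebesgue_on {0..T}) f \<and> (\<forall>t\<in>{0..T}. f t \<in> F t x)"
    and F3: "AE t in lebesgue_on {0..T}.
              sequentially_closedin (prod_topology euclidean weak_topology) {(x, y). y \<in> F t x}"
    and F4: "b \<in> Lp_space (ereal q) (lebesgue_on {0..T})" "0 < c"
            "\<And>x. AE t in lebesgue_on {0..T}. \<forall>y\<in>F t x. norm y \<le> b t + c * norm x powr (p / q)"
    and F5: "\<And>E\<^sub>0. subspace E\<^sub>0 \<Longrightarrow> closed E\<^sub>0 \<Longrightarrow> separable_space (top_of_set E\<^sub>0) \<Longrightarrow>
               \<exists>\<eta> :: real \<Rightarrow> real.
                 \<eta> \<in> Lp_space (if p = q then \<infinity> else ereal (p * q / (p - q))) (lebesgue_on {0..T}) \<and>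
                 (\<forall>\<Omega>. bounded \<Omega> \<and> \<Omega> \<subseteq> E\<^sub>0 \<longrightarrow>
                    (AE t in lebesgue_on {0..T}.
                       ball_mnc E\<^sub>0 ((\<Union>x\<in>\<Omega>. F t x) \<inter> E\<^sub>0)
                         \<le> ereal (\<eta> t) * ball_mnc E\<^sub>0 \<Omega>))"
    and "0 < R"
    and "Lp_norm (ereal p) (lebesgue_on {0..T}) (\<lambda>t. Lp_norm r (lebesgue_on {0..T}) (k t)) *
           (Lp_norm (ereal q) (lebesgue_on {0..T}) b +
            c * (R + Lp_norm (ereal p) (lebesgue_on {0..T}) h) powr (p / q)) \<le> R"
  shows "\<exists>x. p_integrable_solution T p q h k F x"
proof -
  let ?M = "lebesgue_on {0..T}"
  let ?\<kappa> = "\<lambda>t. Lp_norm r ?M (k t)"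
  interpret M: finite_complete_measure ?M by (rule finite_complete_measure_lebesgue_on)
  note q = assms(1) and qp = assms(2) and r = assms(3,4) and T = assms(5) and h = assms(6)
    and causal = assms(7) and R = \<open>0 < R\<close>
  have p: "1 \<le> p" using q qp by simp
  have \<kappa>: "?\<kappa> \<in> Lp_space (ereal p) ?M" using k3 by (simp add: Lp_Lr_space_def)
  obtain k' where k': "\<forall>n::nat. simple_function ?M (k' n) \<and> (\<forall>t\<in>space ?M. k' n t \<in> Lp_space r ?M)"
    and k'_lim: "AE t in ?M. (\<lambda>n. Lp_norm r ?M (\<lambda>u. k' n t u - k t u)) \<longlonglongrightarrow> 0"
    using k3 unfolding Lp_Lr_space_def by blast
  have k'_simple: "simple_function ?M (k' n)" for n using k' by blast
  have k'_Lr: "k' n t \<in> Lp_space r ?M" if "t \<in> {0..T}" for n t using k' that by simp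
  have "\<forall>x. \<exists>f. strongly_measurable ?M f \<and> (\<forall>t\<in>{0..T}. f t \<in> F t x)" using F2 by blast
  from choice[OF this] obtain f where f_meas: "\<And>x. strongly_measurable ?M (f x)"
    and f_sel: "\<And>x t. t \<in> {0..T} \<Longrightarrow> f x t \<in> F t x" by blast
  \<comment> \<open>This is the bracket in the smallness condition. With \<open>u\<close> and
    \<open>G\<close> below it closes a circle: if selections have \<open>L^q\<close> norm at most
    \<open>W0\<close>, then \<open>u\<close> dominates the trajectories and its \<open>L^p\<close>
    norm is at most \<open>R\<close> plus the norm of \<open>h\<close>; the resulting growth bound
    \<open>G\<close> has \<open>L^q\<close> norm at most \<open>W0\<close> again.\<close>
  define W0 where "W0 = Lp_norm (ereal q) ?M b + c * (R + Lp_norm (ereal p) ?M h) powr (p / q)"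
  have norm_nonneg: "0 \<le> Lp_norm (ereal s) ?M u" for s and u :: "real \<Rightarrow> 'z::real_normed_vector"
    by (simp add: Lp_norm_def)
  have W0: "0 \<le> W0" using norm_nonneg[of q b] F4(2) by (simp add: W0_def)
  have R_bound: "Lp_norm (ereal p) ?M ?\<kappa> * W0 \<le> R"
    using assms(19) by (simp add: W0_def)
  define u where "u t = norm (h t) + \<bar>?\<kappa> t\<bar> * W0" for t
  have h_meas: "strongly_measurable ?M h" and \<kappa>_meas: "?\<kappa> \<in> borel_measurable ?M"
    and b_meas: "b \<in> borel_measurable ?M"
    using h \<kappa> F4(1) by (auto simp: Lp_space_def intro: M.strongly_measurable_real)
  have u_meas: "u \<in> borel_measurable ?M"
    unfolding u_def
    by (intro borel_measurable_add borel_measurable_times M.borel_measurable_strong_norm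
        borel_measurable_abs borel_measurable_const h_meas \<kappa>_meas)
  have u0: "0 \<le> u t" for t using W0 by (simp add: u_def)
  have u_int: "integrable ?M (\<lambda>t. u t powr p)"
    unfolding u_def by (rule Lp_norm_affine_bound(1)[OF M.finite_complete_measure_axioms p h \<kappa> W0])
  have "(\<integral>t. u t powr p \<partial>?M) powr (1 / p) \<le> Lp_norm (ereal p) ?M h + Lp_norm (ereal p) ?M ?\<kappa> * W0"
    unfolding u_def by (rule Lp_norm_affine_bound(2)[OF M.finite_complete_measure_axioms p h \<kappa> W0])
  with R_bound have u_norm: "(\<integral>t. u t powr p \<partial>?M) powr (1 / p) \<le> R + Lp_norm (ereal p) ?M h" by linarith
  define G where "G t = \<bar>b t\<bar> + c * u t powr (p / q)" for t
  note G_growth = Lp_norm_growth_bound[OF M.finite_complete_measure_axioms q qp less_imp_le[OF F4(2)] F4(1)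
      u_meas u0 u_int u_norm, folded G_def W0_def]
  define W where "W = (\<integral>t. G t powr q \<partial>?M) powr (1 / q)"
  have W_le: "W \<le> W0" and W_nonneg: "0 \<le> W" using G_growth(2) by (auto simp: W_def)
  have G_meas: "G \<in> borel_measurable ?M"
    unfolding G_def using b_meas u_meas by measurable
  \<comment> \<open>The actual norm \<open>W\<close> of \<open>G\<close> may be smaller than
    \<open>W0\<close>; the domination by \<open>u\<close> persists.\<close>
  have u_W: "norm (h t) + \<bar>?\<kappa> t\<bar> * W \<le> u t" for t
    unfolding u_def using W_le by (intro add_left_mono mult_left_mono) auto
  interpret V: volterra_compact q T c "p / q" W r h k k' F f b G "lebesgue_on {0..T}"
  proof unfold_locales
    fix t and v :: 'a assume "norm v \<le> norm (h t) + \<bar>?\<kappa> t\<bar> * W"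
    then have "norm v \<le> u t" using u_W[of t] by linarith
    then have "c * norm v powr (p / q) \<le> c * u t powr (p / q)"
      using F4(2) p q by (intro mult_left_mono powr_mono2) auto
    then show "b t + c * norm v powr (p / q) \<le> G t" by (simp add: G_def)
  next
    fix E :: "'a set" assume E: "subspace E" "closed E" "separable_space (top_of_set E)"
    from F5[OF E] obtain \<eta> :: "real \<Rightarrow> real"
      where \<eta>: "\<eta> \<in> Lp_space (if p = q then \<infinity> else ereal (p * q / (p - q))) ?M"
        "\<forall>\<Omega>. bounded \<Omega> \<and> \<Omega> \<subseteq> E \<longrightarrow>
          (AE t in ?M. ball_mnc E ((\<Union>x\<in>\<Omega>. F t x) \<inter> E) \<le> ereal (\<eta> t) * ball_mnc E \<Omega>)"
      by blast
    with integrable_powr_mult_Lp[OF M.finite_complete_measure_axioms q qp \<eta>(1) \<kappa>]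
    show "\<exists>\<eta> :: real \<Rightarrow> real. integrable ?M (\<lambda>t. (\<bar>\<eta> t\<bar> * \<bar>?\<kappa> t\<bar>) powr q) \<and>
        (\<forall>\<Omega>. bounded \<Omega> \<and> \<Omega> \<subseteq> E \<longrightarrow>
          (AE t in ?M. ball_mnc E ((\<Union>x\<in>\<Omega>. F t x) \<inter> E) \<le> ereal (\<eta> t) * ball_mnc E \<Omega>))"
      by blast
  next
    show "0 \<le> G t" for t using F4(2) by (simp add: G_def)
    show "convex (F t x)" if "t \<in> {0..T}" for t x using F1[OF that] by blast
  qed (fact q r causal k2 k'_simple k'_Lr k'_lim h_meas f_meas f_sel F4(3) G_meas G_growth(1) W_def T F3)+
  obtain v where v: "strongly_measurable ?M v" "AE t in ?M. norm (v t) \<le> G t"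
    "AE t in ?M. v t \<in> F t (h t + V.kernel_integral v t)"
    using V.solution_exists by blast
  let ?x = "\<lambda>t. h t + V.kernel_integral v t"
  have x_meas: "strongly_measurable ?M ?x"
    by (intro strongly_measurable_add h_meas V.strongly_measurable_kernel_integral v)
  have x_le: "norm (?x t) \<le> u t" if "t \<in> {0..T}" for t
    using norm_triangle_ineq[of "h t" "V.kernel_integral v t"] V.norm_kernel_integral_le[OF v(1,2) that] u_W[of t]
    by linarith
  have x_Lp: "?x \<in> Lp_space (ereal p) ?M"
    unfolding Lp_space_def
  proof (simp, intro conjI x_meas)
    show "integrable ?M (\<lambda>t. norm (?x t) powr p)"
    proof (rule Bochner_Integration.integrable_bound[OF u_int])
      show "(\<lambda>t. norm (?x t) powr p) \<in> borel_measurable ?M"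
        using M.borel_measurable_strong_norm[OF x_meas] by measurable
      show "AE t in ?M. norm (norm (?x t) powr p) \<le> norm (u t powr p)"
        using x_le p by (intro AE_I2) (auto intro!: powr_mono2)
    qed
  qed
  have v_Lq: "v \<in> Lp_space (ereal q) ?M"
    unfolding Lp_space_def
  proof (simp, intro conjI v)
    show "integrable ?M (\<lambda>t. norm (v t) powr q)"
    proof (rule Bochner_Integration.integrable_bound[OF G_growth(1)])
      show "(\<lambda>t. norm (v t) powr q) \<in> borel_measurable ?M"
        using M.borel_measurable_strong_norm[OF v(1)] by measurable
      show "AE t in ?M. norm (norm (v t) powr q) \<le> norm (G t powr q)"
        using v(2) q by (auto elim!: eventually_mono intro!: powr_mono2)
    qed
  qed
  have int: "has_strong_integral (lebesgue_on {0..t}) (\<lambda>s. blinfun_apply (k t s) (v s)) (V.kernel_integral v t)"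
    if t: "t \<in> {0..T}" for t
  proof -
    have eq: "restrict_space ?M {0..t} = lebesgue_on {0..t}"
      using t by (simp add: restrict_restrict_space Int_absorb1)
    have "has_strong_integral (restrict_space ?M {0..t}) (\<lambda>s. blinfun_apply (k t s) (v s)) (V.kernel_integral v t)"
      unfolding V.kernel_integral_def
    proof (rule has_strong_integral_restrict_space[OF M.finite_complete_measure_axioms])
      show "finite_complete_measure (restrict_space ?M {0..t})"
        unfolding eq by (rule finite_complete_measure_lebesgue_on)
      show "{0..t} \<in> sets ?M" using t by (simp add: sets_restrict_space_iff)
      show "strongly_integrable ?M (\<lambda>s. blinfun_apply (k t s) (v s))"
        by (intro V.strongly_integrable_blinfun_G k2 t v)
      show "blinfun_apply (k t s) (v s) = 0" if "s \<in> space ?M - {0..t}" for s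
        using causal[OF t, of s] that by auto
    qed
    then show ?thesis by (simp only: eq)
  qed
  have "AE t in ?M. \<exists>y. has_strong_integral (lebesgue_on {0..t}) (\<lambda>s. blinfun_apply (k t s) (v s)) y \<and> ?x t = h t + y"
    using int by (intro AE_I2) auto
  with x_Lp v_Lq v(3) show ?thesis
    unfolding p_integrable_solution_def by blast
qed

end
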